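(* Let $R = \bigoplus_{(\underline{n},i)\in \mathbb{N}^{t+1}} R_{(\underline{n},i)}$ be an $\mathbb{N}^{t+1}$-graded ring (which need not be standard), and let $L = \bigoplus_{(\underline{n},i)\in \mathbb{N}^{t+1}} L_{(\underline{n},i)}$ be a finitely generated $\mathbb{N}^{t+1}$-graded $R$-module. For every $\underline{n}\in\mathbb{N}^t$ set $R_{(\underline{n},\star)} := \bigoplus_{i \in \mathbb{N}} R_{(\underline{n},i)}$ and $L_{(\underline{n},\star)} := \bigoplus_{i \in \mathbb{N}} L_{(\underline{n},i)}$, and set $A := R_{(\underline{0},\star)}$. Suppose that $R = \bigoplus_{\underline{n} \in \mathbb{N}^t} R_{(\underline{n},\star)}$ is standard as an $\mathbb{N}^t$-graded ring and $A$ is standard as an $\mathbb{N}$-graded ring, i.e. $$R = R_{(\underline{0},\star)} [R_{(\underline{e}^1,\star)}, \ldots, R_{(\underline{e}^t,\star)}] \quad\text{and}\quad R_{(\underline{0},\star)} = R_{(\underline{0},0)}[R_{(\underline{0},1)}].$$ Assume that $A_0 = R_{(\underline{0},0)}$ is an Artinian local ring. Then there exist two integers $k$ and $k'$ such that $$\mathrm{reg}\left(L_{(\underline{n},\star)}\right) \le (n_1 + \cdots + n_t) k + k' \quad\text{for all } \underline{n}=(n_1,\ldots,n_t) \in \mathbb{N}^t,$$ where $L_{(\underline{n},\star)}$ is regarded as a finitely generated $\mathbb{N}$-graded $A$-module.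
   Context: All rings are commutative Noetherian with identity; $\mathbb{N}$ is the set of non-negative integers, $t$ is a positive integer, $\underline{e}^i$ is the $i$th standard basis element of $\mathbb{N}^t$, and $\underline{0}$ is the zero element of $\mathbb{N}^t$. Let $A_+$ be the ideal of the standard $\mathbb{N}$-graded ring $A$ generated by the homogeneous elements of positive degree. For a finitely generated $\mathbb{N}$-graded $A$-module $E$, let $H^i_{A_+}(E)$ be its $i$th local cohomology module with respect to $A_+$ and let $a_i(E) := \max\{\mu : H^i_{A_+}(E)_\mu\ne0\}$ if $H^i_{A_+}(E)\neq 0$, and $a_i(E):=-\infty$ if $H^i_{A_+}(E)=0$. The Castelnuovo-Mumford regularity of $E$ is $\mathrm{reg}(E) := \max\{a_i(E)+i : i\ge0\}$. *)

theory Defs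
  imports
    "HOL-Algebra.Algebra"
    "HOL-Analysis.Finite_Cartesian_Product"
    "HOL-Library.Product_Plus"
    "HOL-Library.Extended_Real"
begin

section \<open>Rings and modules\<close>

text \<open>\<open>Module.module\<close> is the locale of HOL-Algebra; the unqualified name is also used by
  \<open>HOL.Modules\<close>.\<close>

definition fin_gen_module :: "('r, 'p) ring_scheme \<Rightarrow> ('r, 'm, 'q) module_scheme \<Rightarrow> bool" where
  "fin_gen_module R M \<longleftrightarrow> Module.module R M \<and>
     (\<exists>S. finite S \<and> S \<subseteq> carrier M \<and> (\<forall>N. submodule N R M \<and> S \<subseteq> N \<longrightarrow> N = carrier M))"

definition artinian_ring :: "('r, 'p) ring_scheme \<Rightarrow> bool" where
  "artinian_ring R \<longleftrightarrow> ring R \<and>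
     (\<forall>I :: nat \<Rightarrow> 'r set. (\<forall>k. ideal (I k) R) \<and> (\<forall>k. I (Suc k) \<subseteq> I k)
        \<longrightarrow> (\<exists>N. \<forall>k\<ge>N. I k = I N))"

definition local_ring :: "('r, 'p) ring_scheme \<Rightarrow> bool" where
  "local_ring R \<longleftrightarrow> cring R \<and> (\<exists>!\<mm>. maximalideal \<mm> R)"

primrec ideal_power :: "('r, 'p) ring_scheme \<Rightarrow> 'r set \<Rightarrow> nat \<Rightarrow> 'r set" where
  "ideal_power R I 0 = carrier R"
| "ideal_power R I (Suc k) = ideal_prod R I (ideal_power R I k)"

definition torsion_part ::
  "('r, 'p) ring_scheme \<Rightarrow> 'r set \<Rightarrow> ('r, 'm, 'q) module_scheme \<Rightarrow> 'm set" where
  "torsion_part R I M =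
     {x \<in> carrier M. \<exists>k. \<forall>a\<in>ideal_power R I k. a \<odot>\<^bsub>M\<^esub> x = \<zero>\<^bsub>M\<^esub>}"


section \<open>Gradings\<close>

definition internal_direct_sum :: "('m, 'q) ring_scheme \<Rightarrow> ('i \<Rightarrow> 'm set) \<Rightarrow> bool" where
  "internal_direct_sum M H \<longleftrightarrow> (\<forall>i. additive_subgroup (H i) M) \<and>
     (\<forall>x\<in>carrier M. \<exists>!f. (\<forall>i. f i \<in> H i) \<and> finite {i. f i \<noteq> \<zero>\<^bsub>M\<^esub>} \<and>
        x = finsum M f {i. f i \<noteq> \<zero>\<^bsub>M\<^esub>})"

definition graded_ring :: "('r, 'p) ring_scheme \<Rightarrow> ('i::comm_monoid_add \<Rightarrow> 'r set) \<Rightarrow> bool" where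
  "graded_ring R G \<longleftrightarrow> cring R \<and> internal_direct_sum R G \<and> \<one>\<^bsub>R\<^esub> \<in> G 0 \<and>
     (\<forall>i j. \<forall>a\<in>G i. \<forall>b\<in>G j. a \<otimes>\<^bsub>R\<^esub> b \<in> G (i + j))"

definition graded_module ::
  "('r, 'p) ring_scheme \<Rightarrow> ('i::comm_monoid_add \<Rightarrow> 'r set) \<Rightarrow>
   ('r, 'm, 'q) module_scheme \<Rightarrow> ('i \<Rightarrow> 'm set) \<Rightarrow> bool" where
  "graded_module R G M H \<longleftrightarrow> Module.module R M \<and> internal_direct_sum M H \<and>
     (\<forall>i j. \<forall>a\<in>G i. \<forall>x\<in>H j. a \<odot>\<^bsub>M\<^esub> x \<in> H (i + j))"

text \<open>The subgroup \<open>\<Oplus>\<^bsub>i \<in> I\<^esub> H\<^sub>i\<close> of \<open>M\<close>.\<close>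

definition partial_sum :: "('m, 'q) ring_scheme \<Rightarrow> ('i \<Rightarrow> 'm set) \<Rightarrow> 'i set \<Rightarrow> 'm set" where
  "partial_sum M H I = {finsum M f F | f F. finite F \<and> F \<subseteq> I \<and> (\<forall>i\<in>F. f i \<in> H i)}"

text \<open>Local cohomology of an \<open>\<nat>\<close>-graded module lives in arbitrary integer degrees, so an
  \<open>\<nat>\<close>-grading is regarded as a \<open>\<int>\<close>-grading that vanishes in negative degrees.\<close>

definition int_grading :: "('m, 'q) ring_scheme \<Rightarrow> (nat \<Rightarrow> 'm set) \<Rightarrow> int \<Rightarrow> 'm set" where
  "int_grading M H i = (if 0 \<le> i then H (nat i) else {\<zero>\<^bsub>M\<^esub>})"

definition irrelevant_ideal :: "('r, 'p) ring_scheme \<Rightarrow> (nat \<Rightarrow> 'r set) \<Rightarrow> 'r set" where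
  "irrelevant_ideal A G = genideal A (\<Union>i\<in>{0<..}. G i)"

definition graded_hom ::
  "('r, 'p) ring_scheme \<Rightarrow> ('r, 'm, 'q) module_scheme \<Rightarrow> ('i \<Rightarrow> 'm set) \<Rightarrow>
   ('r, 'x, 's) module_scheme \<Rightarrow> ('i \<Rightarrow> 'x set) \<Rightarrow> ('m \<Rightarrow> 'x) \<Rightarrow> bool" where
  "graded_hom A M H N H' f \<longleftrightarrow>
     f \<in> carrier M \<rightarrow> carrier N \<and>
     (\<forall>x\<in>carrier M. \<forall>y\<in>carrier M. f (x \<oplus>\<^bsub>M\<^esub> y) = f x \<oplus>\<^bsub>N\<^esub> f y) \<and>
     (\<forall>a\<in>carrier A. \<forall>x\<in>carrier M. f (a \<odot>\<^bsub>M\<^esub> x) = a \<odot>\<^bsub>N\<^esub> f x) \<and>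
     (\<forall>i. f ` H i \<subseteq> H' i)"


section \<open>Graded injective resolutions\<close>

text \<open>\<open>A\<close> is \<open>\<nat>\<close>-graded by \<open>G\<close>, and modules are \<open>\<int>\<close>-graded.

  Injectivity in the category of \<open>\<int>\<close>-graded \<open>A\<close>-modules is expressed through Baer's
  criterion, since a definition cannot quantify over modules on all types: every \<open>A\<close>-linear
  map from a homogeneous ideal to \<open>J\<close> that shifts degrees by \<open>d\<close> is multiplication by an element
  of \<open>J\<^sub>d\<close>.\<close>

definition homogeneous_ideal :: "('r, 'p) ring_scheme \<Rightarrow> (nat \<Rightarrow> 'r set) \<Rightarrow> 'r set \<Rightarrow> bool" where
  "homogeneous_ideal A G I \<longleftrightarrow> ideal I A \<and> I = genideal A (I \<inter> (\<Union>i. G i))"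

definition graded_injective ::
  "('r, 'p) ring_scheme \<Rightarrow> (nat \<Rightarrow> 'r set) \<Rightarrow>
   ('r, 'x, 's) module_scheme \<Rightarrow> (int \<Rightarrow> 'x set) \<Rightarrow> bool" where
  "graded_injective A G J JG \<longleftrightarrow> graded_module A (int_grading A G) J JG \<and>
     (\<forall>I \<phi> d. homogeneous_ideal A G I \<and>
        \<phi> \<in> I \<rightarrow> carrier J \<and>
        (\<forall>a\<in>I. \<forall>b\<in>I. \<phi> (a \<oplus>\<^bsub>A\<^esub> b) = \<phi> a \<oplus>\<^bsub>J\<^esub> \<phi> b) \<and>
        (\<forall>c\<in>carrier A. \<forall>a\<in>I. \<phi> (c \<otimes>\<^bsub>A\<^esub> a) = c \<odot>\<^bsub>J\<^esub> \<phi> a) \<and>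
        (\<forall>i. \<forall>a\<in>I \<inter> G i. \<phi> a \<in> JG (int i + d))
        \<longrightarrow> (\<exists>y\<in>JG d. \<forall>a\<in>I. \<phi> a = a \<odot>\<^bsub>J\<^esub> y))"

record ('r, 'x) graded_cochain =
  cc_obj :: "nat \<Rightarrow> ('r, 'x) module"
  cc_comp :: "nat \<Rightarrow> int \<Rightarrow> 'x set"
  cc_diff :: "nat \<Rightarrow> 'x \<Rightarrow> 'x"

text \<open>\<open>0 \<rightarrow> E \<rightarrow> J\<^sup>0 \<rightarrow> J\<^sup>1 \<rightarrow> \<dots>\<close> exact, with homogeneous maps of degree 0 and every
  \<open>J\<^sup>q\<close> injective in the category of graded modules. For Noetherian \<open>A\<close> such a resolution
  exists on every infinite type \<open>'x\<close> that is at least as large as \<open>A\<close> and \<open>E\<close>, because graded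
  injective hulls do not exceed that cardinality.\<close>

definition graded_injective_resolution ::
  "('r, 'p) ring_scheme \<Rightarrow> (nat \<Rightarrow> 'r set) \<Rightarrow> ('r, 'm, 'q) module_scheme \<Rightarrow> (int \<Rightarrow> 'm set) \<Rightarrow>
   ('r, 'x) graded_cochain \<Rightarrow> bool" where
  "graded_injective_resolution A G E H C \<longleftrightarrow>
     (\<forall>q. graded_injective A G (cc_obj C q) (cc_comp C q)) \<and>
     (\<forall>q. graded_hom A (cc_obj C q) (cc_comp C q) (cc_obj C (Suc q)) (cc_comp C (Suc q)) (cc_diff C q)) \<and>
     (\<exists>\<epsilon>. graded_hom A E H (cc_obj C 0) (cc_comp C 0) \<epsilon> \<and> inj_on \<epsilon> (carrier E) \<and>
        \<epsilon> ` carrier E = {x \<in> carrier (cc_obj C 0). cc_diff C 0 x = \<zero>\<^bsub>cc_obj C 1\<^esub>}) \<and>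
     (\<forall>q. cc_diff C q ` carrier (cc_obj C q) =
        {x \<in> carrier (cc_obj C (Suc q)). cc_diff C (Suc q) x = \<zero>\<^bsub>cc_obj C (Suc (Suc q))\<^esub>})"


section \<open>Local cohomology and regularity\<close>

text \<open>For an injective resolution \<open>C\<close> of \<open>E\<close>, the module \<open>H\<^sup>i\<^sub>I(E)\<close> is the \<open>i\<close>th cohomology of
  the complex \<open>\<Gamma>\<^sub>I(C)\<close> obtained by applying the torsion functor. For homogeneous \<open>I\<close> this is a
  complex of graded modules, and the component of \<open>H\<^sup>i\<^sub>I(E)\<close> in degree \<open>\<mu>\<close> is the \<open>i\<close>th
  cohomology group of its degree \<open>\<mu>\<close> strand.\<close>

definition torsion_strand ::
  "('r, 'p) ring_scheme \<Rightarrow> 'r set \<Rightarrow> ('r, 'x) graded_cochain \<Rightarrow> nat \<Rightarrow> int \<Rightarrow> 'x set" where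
  "torsion_strand A I C q \<mu> = torsion_part A I (cc_obj C q) \<inter> cc_comp C q \<mu>"

definition local_cohomology_comp ::
  "('r, 'p) ring_scheme \<Rightarrow> 'r set \<Rightarrow> ('r, 'x) graded_cochain \<Rightarrow> nat \<Rightarrow> int \<Rightarrow> 'x set monoid" where
  "local_cohomology_comp A I C i \<mu> =
     (add_monoid (cc_obj C i)
        \<lparr>carrier := {z \<in> torsion_strand A I C i \<mu>. cc_diff C i z = \<zero>\<^bsub>cc_obj C (Suc i)\<^esub>}\<rparr>)
     Mod (case i of 0 \<Rightarrow> {\<zero>\<^bsub>cc_obj C 0\<^esub>} | Suc j \<Rightarrow> cc_diff C j ` torsion_strand A I C j \<mu>)"

text \<open>Suprema are taken in the extended reals, where \<open>Sup {} = -\<infinity>\<close>. A nonempty set of integers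
  with finite supremum has a maximum, so a finite value is the maximum required by the usual
  definition; the value \<open>\<infinity>\<close> means that the maximum does not exist.\<close>

definition a_invariant ::
  "('r, 'p) ring_scheme \<Rightarrow> (nat \<Rightarrow> 'r set) \<Rightarrow> ('r, 'x) graded_cochain \<Rightarrow> nat \<Rightarrow> ereal" where
  "a_invariant A G C i =
     Sup {ereal (of_int \<mu>) | \<mu>.
       \<not> trivial_group (local_cohomology_comp A (irrelevant_ideal A G) C i \<mu>)}"

text \<open>The regularity of \<open>E\<close>, computed from an injective resolution \<open>C\<close> of \<open>E\<close>. It does not depend
  on the choice of \<open>C\<close>.\<close>

definition cm_regularity ::
  "('r, 'p) ring_scheme \<Rightarrow> (nat \<Rightarrow> 'r set) \<Rightarrow> ('r, 'x) graded_cochain \<Rightarrow> ereal" where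
  "cm_regularity A G C = (SUP i. a_invariant A G C i + ereal (of_nat i))"


section \<open>Rings and modules graded by \<open>\<nat>\<^sup>t \<times> \<nat>\<close>\<close>

text \<open>\<open>M\<^bsub>(n,\<star>)\<^esub>\<close>; the components \<open>M\<^bsub>(n,i)\<^esub>\<close> are \<open>H (n, i)\<close>, with \<open>n :: nat ^ 't\<close>.\<close>

definition graded_row :: "('m, 'q) ring_scheme \<Rightarrow> ((nat ^ 't) \<times> nat \<Rightarrow> 'm set) \<Rightarrow> nat ^ 't \<Rightarrow> 'm set" where
  "graded_row M H n = partial_sum M H ({n} \<times> UNIV)"

definition row_grading :: "((nat ^ 't) \<times> nat \<Rightarrow> 'm set) \<Rightarrow> nat ^ 't \<Rightarrow> nat \<Rightarrow> 'm set" where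
  "row_grading H n i = H (n, i)"

definition row_ring ::
  "'r ring \<Rightarrow> ((nat ^ 't) \<times> nat \<Rightarrow> 'r set) \<Rightarrow> 'r ring" where
  "row_ring R G = R\<lparr>carrier := graded_row R G 0\<rparr>"

definition row_module ::
  "('r, 'm) module \<Rightarrow> ((nat ^ 't) \<times> nat \<Rightarrow> 'm set) \<Rightarrow> nat ^ 't \<Rightarrow> ('r, 'm) module" where
  "row_module L H n = L\<lparr>carrier := graded_row L H n\<rparr>"

end

theory Submission
  imports Defs
begin

text \<open>
  Let \<open>x\<^sub>1, \<dots>, x\<^sub>d \<in> A\<^sub>1\<close> generate \<open>A\<^sub>+\<close>. The Koszul homology of \<open>L\<close> with respect to the
  \<open>x\<^sub>j\<close> is a finitely generated graded \<open>R\<close>-module annihilated by the \<open>x\<^sub>j\<close>. Since the generators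
  of \<open>R\<close> outside \<open>A\<close> may be taken from the \<open>R\<^bsub>(e\<^sup>j,c)\<^esub>\<close> with \<open>c \<le> b\<close> for some \<open>b\<close>, a homogeneous
  element of \<open>R\<close> of degree \<open>(n,c)\<close> with \<open>c > b |n|\<close> lies in the ideal of the \<open>x\<^sub>j\<close>, so the Koszul
  homology of the row \<open>L\<^bsub>(n,\<star>)\<^esub>\<close> vanishes in all degrees above a bound linear in \<open>|n|\<close>.

  This vanishing passes to local cohomology. Replace the row by its injective resolution \<open>J\<close>. If the
  cone of multiplication by \<open>x\<close> on a complex is exact in all degrees \<open>\<ge> \<mu>\<close>, then so is its
  \<open>x\<close>-torsion subcomplex, provided that the complex is the sum of its \<open>x\<close>-torsion and of its
  \<open>x\<^sup>k\<close>-multiples, as holds for graded injectives by Baer's criterion. The Koszul complex is an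
  iterated cone; exchanging one cone after the other for a torsion subcomplex turns it into
  \<open>\<Gamma>\<^bsub>A\<^sub>+\<^esub>(J)\<close>.
\<close>

section \<open>Homogeneous components\<close>

text \<open>The slope of the bound is the \<open>b\<close> of the overview, the constant term is
  \<open>k0 + d\<close>. Here \<open>k0\<close> bounds the internal degrees of finitely many
  homogeneous Koszul cycles that generate, over \<open>R\<close>, the homogeneous cycles of all rows
  at once; generating over \<open>R\<close> and not row by row over \<open>A\<close> is what makes
  \<open>k0\<close> independent of the row. The summand \<open>d\<close> appears because local
  cohomology vanishes in cohomological degrees beyond \<open>d\<close>, so that the \<open>i\<close>
  in \<open>a_i + i\<close> is at most \<open>d\<close>.

  Exactness of the cone of \<open>x\<close> in a single degree says nothing about powers of
  \<open>x\<close>: going from \<open>x^k\<close> to \<open>x^(k+1)\<close> uses the cone of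
  \<open>x\<close> one internal degree higher. Hence every vanishing statement concerns a half-line
  of degrees, the form in which a bound on top degrees presents itself. Trading a cone for a torsion
  subcomplex keeps both the cohomological degree and the half-line, so nothing is lost in the
  \<open>d\<close> exchanges.

  Chain conditions are available over \<open>R\<close>. For ideals of \<open>A\<close> they are
  obtained on homogeneous elements, by extending to \<open>R\<close> and contracting back to the row
  of degree zero.\<close>

definition grade_comp :: "('m, 'q) ring_scheme \<Rightarrow> ('i \<Rightarrow> 'm set) \<Rightarrow> 'm \<Rightarrow> 'i \<Rightarrow> 'm" where
  "grade_comp M H x =
     (THE f. (\<forall>i. f i \<in> H i) \<and> finite {i. f i \<noteq> \<zero>\<^bsub>M\<^esub>} \<and> x = finsum M f {i. f i \<noteq> \<zero>\<^bsub>M\<^esub>})"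

locale grading = abelian_group M for M (structure) +
  fixes H :: "'i \<Rightarrow> 'a set"
  assumes direct_sum: "internal_direct_sum M H"
begin

lemma H_subgroup: "additive_subgroup (H i) M"
  using direct_sum by (simp add: internal_direct_sum_def)

lemma H_carrier: "x \<in> H i \<Longrightarrow> x \<in> carrier M"
  using additive_subgroup.a_subset[OF H_subgroup] by blast

lemma H_zero [simp]: "\<zero> \<in> H i"
  using additive_subgroup.zero_closed[OF H_subgroup] .

lemma H_add: "x \<in> H i \<Longrightarrow> y \<in> H i \<Longrightarrow> x \<oplus> y \<in> H i"
  using additive_subgroup.a_closed[OF H_subgroup] .

lemma H_neg: "x \<in> H i \<Longrightarrow> \<ominus> x \<in> H i"
  using additive_subgroup.a_inv_closed[OF H_subgroup] abelian_group_axioms by blast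

lemma grade_comp_props:
  assumes "x \<in> carrier M"
  shows "grade_comp M H x i \<in> H i"
    and "finite {i. grade_comp M H x i \<noteq> \<zero>}"
    and "x = finsum M (grade_comp M H x) {i. grade_comp M H x i \<noteq> \<zero>}"
proof -
  have "\<exists>!f. (\<forall>i. f i \<in> H i) \<and> finite {i. f i \<noteq> \<zero>} \<and> x = finsum M f {i. f i \<noteq> \<zero>}"
    using direct_sum assms by (simp add: internal_direct_sum_def)
  from theI'[OF this, folded grade_comp_def]
  show "grade_comp M H x i \<in> H i"
    and "finite {i. grade_comp M H x i \<noteq> \<zero>}"
    and "x = finsum M (grade_comp M H x) {i. grade_comp M H x i \<noteq> \<zero>}"
    by blast+
qed

lemma grade_comp_carrier [simp]: "x \<in> carrier M \<Longrightarrow> grade_comp M H x i \<in> carrier M"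
  using grade_comp_props(1) H_carrier by blast

lemma finsum_extend:
  assumes "finite F" "G \<subseteq> F" "\<And>i. i \<in> F \<Longrightarrow> f i \<in> carrier M" "\<And>i. i \<in> F - G \<Longrightarrow> f i = \<zero>"
  shows "finsum M f G = finsum M f F"
  by (rule add.finprod_mono_neutral_cong_left) (use assms in auto)

text \<open>The direct sum condition sums over the exact support of a family. In computations any
  finite index set containing the support has to do, since supports shrink, for instance when two
  families are added and terms cancel.\<close>

lemma grade_comp_unique:
  assumes "\<And>i. f i \<in> H i" "finite F" "\<And>i. i \<notin> F \<Longrightarrow> f i = \<zero>" "x = finsum M f F"
  shows "grade_comp M H x = f"
proof -
  have x: "x \<in> carrier M"
    unfolding assms(4) by (rule finsum_closed) (use assms(1) H_carrier in blast)
  have sub: "{i. f i \<noteq> \<zero>} \<subseteq> F"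
    using assms(3) by blast
  have "finite {i. f i \<noteq> \<zero>}"
    using finite_subset[OF sub assms(2)] .
  moreover have "x = finsum M f {i. f i \<noteq> \<zero>}"
    unfolding assms(4) by (rule finsum_extend[symmetric]) (use assms(1,2) sub H_carrier in auto)
  moreover have "\<exists>!f. (\<forall>i. f i \<in> H i) \<and> finite {i. f i \<noteq> \<zero>} \<and> x = finsum M f {i. f i \<noteq> \<zero>}"
    using direct_sum x by (simp add: internal_direct_sum_def)
  ultimately show ?thesis
    unfolding grade_comp_def using assms(1) by (intro the1_equality) auto
qed

lemma grade_comp_hom_elt:
  assumes "x \<in> H j"
  shows "grade_comp M H x = (\<lambda>i. if i = j then x else \<zero>)"
proof (rule grade_comp_unique[where F = "{j}"])
  show "x = (\<Oplus>i\<in>{j}. if i = j then x else \<zero>)"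
    using finsum_insert[of "{}" j "\<lambda>i. if i = j then x else \<zero>"] assms H_carrier finsum_empty by auto
qed (use assms in auto)

lemma grade_comp_add:
  assumes "x \<in> carrier M" "y \<in> carrier M"
  shows "grade_comp M H (x \<oplus> y) i = grade_comp M H x i \<oplus> grade_comp M H y i"
proof -
  let ?f = "grade_comp M H x" and ?g = "grade_comp M H y"
  let ?F = "{i. ?f i \<noteq> \<zero>} \<union> {i. ?g i \<noteq> \<zero>}"
  note px = grade_comp_props[OF assms(1)] and py = grade_comp_props[OF assms(2)]
  have fin: "finite ?F"
    using px(2) py(2) by blast
  have "x = finsum M ?f ?F"
    by (rule trans[OF px(3) finsum_extend[OF fin]]) (use assms in auto)
  moreover have "y = finsum M ?g ?F"
    by (rule trans[OF py(3) finsum_extend[OF fin]]) (use assms in auto)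
  ultimately have "x \<oplus> y = finsum M ?f ?F \<oplus> finsum M ?g ?F"
    by (rule arg_cong2)
  also have "\<dots> = (\<Oplus>i\<in>?F. ?f i \<oplus> ?g i)"
    by (rule finsum_addf[symmetric]) (use assms in auto)
  finally have "x \<oplus> y = (\<Oplus>i\<in>?F. ?f i \<oplus> ?g i)" .
  then have "grade_comp M H (x \<oplus> y) = (\<lambda>i. ?f i \<oplus> ?g i)"
    by (intro grade_comp_unique[OF _ fin]) (use px(1) py(1) H_add in auto)
  then show ?thesis by simp
qed

lemma partial_sum_zero: "\<zero> \<in> partial_sum M H I"
proof -
  have "\<zero> = finsum M (\<lambda>_. \<zero>) {}" "finite {}" "{} \<subseteq> I" "\<forall>i\<in>{}. (\<lambda>_. \<zero>) i \<in> H i"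
    by (simp_all add: finsum_empty)
  then show ?thesis
    unfolding partial_sum_def by (intro CollectI exI conjI)
qed

lemma partial_sum_incl:
  assumes "i \<in> I" "x \<in> H i"
  shows "x \<in> partial_sum M H I"
proof -
  have "x = finsum M (\<lambda>_. x) {i}" "finite {i}" "{i} \<subseteq> I" "\<forall>j\<in>{i}. (\<lambda>_. x) j \<in> H j"
    using assms H_carrier finsum_insert[of "{}" i "\<lambda>_. x"] finsum_empty by auto
  then show ?thesis
    unfolding partial_sum_def by (intro CollectI exI conjI)
qed

text \<open>Peels off one homogeneous summand at a time, so that later proofs about rows need not
  handle \<open>finsum\<close>. The tail stays in the same partial sum, which keeps hypotheses
  restricted to that partial sum applicable.\<close>

lemma partial_sum_induct [consumes 1, case_names zero incl add]:
  assumes "x \<in> partial_sum M H I"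
    and "P \<zero>" "\<And>i y. i \<in> I \<Longrightarrow> y \<in> H i \<Longrightarrow> P y"
    and "\<And>i y z. i \<in> I \<Longrightarrow> y \<in> H i \<Longrightarrow> z \<in> partial_sum M H I \<Longrightarrow> z \<in> carrier M \<Longrightarrow> P y \<Longrightarrow> P z \<Longrightarrow> P (y \<oplus> z)"
  shows "P x"
proof -
  obtain f F where F: "finite F" "F \<subseteq> I" "\<forall>i\<in>F. f i \<in> H i" and x: "x = finsum M f F"
    using assms(1) unfolding partial_sum_def by blast
  from F have "P (finsum M f F)"
  proof (induction F rule: finite_induct)
    case empty
    then show ?case using assms(2) by (simp add: finsum_empty)
  next
    case (insert i F)
    have *: "f \<in> F \<rightarrow> carrier M" "f i \<in> carrier M"
      using insert.prems H_carrier by auto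
    have "finsum M f F \<in> partial_sum M H I"
      unfolding partial_sum_def using insert by blast
    then have "P (f i \<oplus> finsum M f F)"
      by (intro assms(4)[of i]) (use insert * finsum_closed assms(3)[of i "f i"] in auto)
    then show ?case
      using finsum_insert[of F i f] insert.hyps * by simp
  qed
  then show ?thesis using x by simp
qed

lemma partial_sum_carrier: "x \<in> partial_sum M H I \<Longrightarrow> x \<in> carrier M"
  by (induction rule: partial_sum_induct) (auto dest: H_carrier)

lemma partial_sum_add1:
  assumes "x \<in> H i" "i \<in> I" "y \<in> partial_sum M H I"
  shows "x \<oplus> y \<in> partial_sum M H I"
proof -
  obtain f F where F: "finite F" "F \<subseteq> I" "\<forall>i\<in>F. f i \<in> H i" and y: "y = finsum M f F"
    using assms(3) unfolding partial_sum_def by blast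
  have fc: "f \<in> F \<rightarrow> carrier M" using F H_carrier by auto
  note xc = H_carrier[OF assms(1)]
  show ?thesis
  proof (cases "i \<in> F")
    case False
    let ?g = "f(i := x)"
    have "finsum M ?g (insert i F) = ?g i \<oplus> finsum M ?g F"
      by (rule finsum_insert) (use False F fc xc in auto)
    moreover have "finsum M ?g F = finsum M f F"
      by (rule finsum_cong') (use False fc in auto)
    ultimately have "x \<oplus> y = finsum M ?g (insert i F)"
      using y by simp
    moreover have "\<forall>j\<in>insert i F. ?g j \<in> H j" "finite (insert i F)" "insert i F \<subseteq> I"
      using F assms by auto
    ultimately show ?thesis
      unfolding partial_sum_def by blast
  next
    case True
    \<comment> \<open>A partial sum has one summand per index, so \<open>x\<close> is merged with
      the summand already present at \<open>i\<close>.\<close>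
    define G where "G = F - {i}"
    have G: "F = insert i G" "i \<notin> G" "finite G"
      using True F unfolding G_def by auto
    let ?g = "f(i := x \<oplus> f i)"
    have fG: "f \<in> G \<rightarrow> carrier M" "f i \<in> carrier M"
      using fc G by auto
    have "finsum M ?g (insert i G) = ?g i \<oplus> finsum M ?g G"
      by (rule finsum_insert) (use G fG xc in auto)
    moreover have "finsum M ?g G = finsum M f G"
      by (rule finsum_cong') (use G fG in auto)
    moreover have "finsum M f (insert i G) = f i \<oplus> finsum M f G"
      by (rule finsum_insert) (use G fG xc in auto)
    ultimately have "x \<oplus> y = finsum M ?g F"
      using y G fG xc by (simp add: a_assoc finsum_closed)
    moreover have "\<forall>j\<in>F. ?g j \<in> H j"
      using F True assms(1) H_add by auto
    ultimately show ?thesis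
      unfolding partial_sum_def using F by blast
  qed
qed

lemma partial_sum_add:
  assumes "x \<in> partial_sum M H I" "y \<in> partial_sum M H I"
  shows "x \<oplus> y \<in> partial_sum M H I"
  using assms(1)
proof (induction rule: partial_sum_induct)
  case zero
  then show ?case using assms(2) partial_sum_carrier by auto
next
  case (incl i x)
  then show ?case using partial_sum_add1 assms(2) by blast
next
  case (add i x z)
  then show ?case
    using partial_sum_add1[of x i I "z \<oplus> y"] assms(2) partial_sum_carrier H_carrier
    by (simp add: a_assoc)
qed

lemma partial_sum_neg:
  assumes "x \<in> partial_sum M H I"
  shows "\<ominus> x \<in> partial_sum M H I"
  using assms
proof (induction rule: partial_sum_induct)
  case zero
  then show ?case using partial_sum_zero add.inv_one by (simp add: a_inv_def)
next
  case (incl i x)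
  then show ?case using partial_sum_incl H_neg by blast
next
  case (add i x z)
  then show ?case
    using partial_sum_add H_carrier by (simp add: minus_add)
qed

lemma partial_sum_UNIV: "partial_sum M H UNIV = carrier M"
proof
  show "carrier M \<subseteq> partial_sum M H UNIV"
  proof
    fix x assume "x \<in> carrier M"
    from grade_comp_props[OF this] show "x \<in> partial_sum M H UNIV"
      unfolding partial_sum_def by blast
  qed
qed (use partial_sum_carrier in blast)

lemma grade_comp_zero [simp]: "grade_comp M H \<zero> i = \<zero>"
  using grade_comp_hom_elt[of \<zero> i] by simp

lemma in_carrier_if_comps:
  assumes "x \<in> carrier M" "Q \<zero>" "\<And>i. Q (grade_comp M H x i)"
    and "\<And>y z. y \<in> carrier M \<Longrightarrow> z \<in> carrier M \<Longrightarrow> Q y \<Longrightarrow> Q z \<Longrightarrow> Q (y \<oplus> z)"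
  shows "Q x"
proof -
  have "finite F \<Longrightarrow> Q (finsum M (grade_comp M H x) F)" for F
  proof (induction F rule: finite_induct)
    case empty
    then show ?case using assms(2) by (simp add: finsum_empty)
  next
    case (insert i F)
    have "grade_comp M H x \<in> F \<rightarrow> carrier M"
      using assms(1) by simp
    then show ?case
      using insert assms by (simp add: finsum_insert finsum_closed)
  qed
  from this[OF grade_comp_props(2)[OF assms(1)]] show ?thesis
    using grade_comp_props(3)[OF assms(1)] by simp
qed

end

text \<open>An additive map that carries degree \<open>i\<close> to degree \<open>s i\<close>
  commutes with taking components as soon as \<open>s\<close> does not merge two degrees; all four
  claims come from one induction over homogeneous summands. The restriction to \<open>I\<close>
  matters: forgetting the row index is injective only within a single row, and this is how a row of
  \<open>L\<close>, or the ring \<open>A\<close>, is compared with the integer grading of an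
  injective module.\<close>

lemma grade_comp_image:
  assumes M: "grading M H" and N: "grading N H'"
    and f: "\<And>x y. x \<in> carrier M \<Longrightarrow> y \<in> carrier M \<Longrightarrow> x \<in> partial_sum M H I \<Longrightarrow> y \<in> partial_sum M H I \<Longrightarrow>
        f (x \<oplus>\<^bsub>M\<^esub> y) = f x \<oplus>\<^bsub>N\<^esub> f y"
    and fH: "\<And>i x. i \<in> I \<Longrightarrow> x \<in> H i \<Longrightarrow> f x \<in> H' (s i)"
    and f0: "f \<zero>\<^bsub>M\<^esub> = \<zero>\<^bsub>N\<^esub>"
    and inj: "inj_on s I" and x: "x \<in> partial_sum M H I"
  shows "i \<in> I \<Longrightarrow> grade_comp N H' (f x) (s i) = f (grade_comp M H x i)"
    and "j \<notin> s ` I \<Longrightarrow> grade_comp N H' (f x) j = \<zero>\<^bsub>N\<^esub>"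
    and "f x \<in> carrier N"
    and "i \<notin> I \<Longrightarrow> grade_comp M H x i = \<zero>\<^bsub>M\<^esub>"
proof -
  interpret M: grading M H by fact
  interpret N: grading N H' by fact
  have comp_in: "grade_comp M H z i \<in> partial_sum M H I" if "z \<in> carrier M" "i \<in> I" for z i
    using M.partial_sum_incl that M.grade_comp_props(1) by blast
  have "f x \<in> carrier N \<and> (\<forall>i\<in>I. grade_comp N H' (f x) (s i) = f (grade_comp M H x i)) \<and>
      (\<forall>j. j \<notin> s ` I \<longrightarrow> grade_comp N H' (f x) j = \<zero>\<^bsub>N\<^esub>) \<and> (\<forall>i. i \<notin> I \<longrightarrow> grade_comp M H x i = \<zero>\<^bsub>M\<^esub>)"
    using x
  proof (induction rule: M.partial_sum_induct)
    case zero
    then show ?case using f0 by simp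
  next
    case (incl i y)
    have fy: "f y \<in> H' (s i)" using fH incl by blast
    show ?case
      using incl inj f0
      by (auto simp: M.grade_comp_hom_elt[OF incl(2)] N.grade_comp_hom_elt[OF fy] N.H_carrier[OF fy]
          inj_on_eq_iff)
  next
    case (add i y z)
    have y: "y \<in> carrier M" "y \<in> partial_sum M H I"
      using add M.H_carrier M.partial_sum_incl by blast+
    have "f (y \<oplus>\<^bsub>M\<^esub> z) = f y \<oplus>\<^bsub>N\<^esub> f z"
      using f y add by blast
    then show ?case
      using add y comp_in by (auto simp: N.grade_comp_add M.grade_comp_add f)
  qed
  then show "i \<in> I \<Longrightarrow> grade_comp N H' (f x) (s i) = f (grade_comp M H x i)"
    and "j \<notin> s ` I \<Longrightarrow> grade_comp N H' (f x) j = \<zero>\<^bsub>N\<^esub>" and "f x \<in> carrier N"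
    and "i \<notin> I \<Longrightarrow> grade_comp M H x i = \<zero>\<^bsub>M\<^esub>"
    by blast+
qed

section \<open>Noetherian modules\<close>

definition mod_span :: "('r, 'p) ring_scheme \<Rightarrow> ('r, 'm, 'q) module_scheme \<Rightarrow> 'm set \<Rightarrow> 'm set" where
  "mod_span R M S = \<Inter>{N. submodule N R M \<and> S \<subseteq> N}"

text \<open>Relative to a subset \<open>P\<close>, so that submodules with the chain condition can
  be added and mapped inside one fixed module.\<close>

definition acc_on :: "('r, 'p) ring_scheme \<Rightarrow> ('r, 'm, 'q) module_scheme \<Rightarrow> 'm set \<Rightarrow> bool" where
  "acc_on R M P \<longleftrightarrow> (\<forall>N :: nat \<Rightarrow> 'm set.
     (\<forall>k. submodule (N k) R M \<and> N k \<subseteq> P \<and> N k \<subseteq> N (Suc k)) \<longrightarrow> (\<exists>n. \<forall>m\<ge>n. N m = N n))"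

text \<open>The ring as a module over itself, in a record with scalar multiplication. Its submodules
  are the ideals, so facts about chains and generators are proved once, for modules.\<close>

definition regular_module :: "('r, 'p) ring_scheme \<Rightarrow> ('r, 'r) module" where
  "regular_module R = \<lparr>carrier = carrier R, monoid.mult = monoid.mult R, one = one R,
     ring.zero = ring.zero R, ring.add = ring.add R, smult = monoid.mult R\<rparr>"

lemma acc_onD:
  assumes "acc_on R M P" "\<And>k. submodule (N k) R M" "\<And>k. N k \<subseteq> P" "\<And>k. N k \<subseteq> N (Suc k)"
  shows "\<exists>n. \<forall>m\<ge>n. N m = N n"
  using assms unfolding acc_on_def by blast

lemma acc_on_mono: "acc_on R M P \<Longrightarrow> Q \<subseteq> P \<Longrightarrow> acc_on R M Q"
  unfolding acc_on_def by (meson subset_trans)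

lemma mod_span_incl: "S \<subseteq> mod_span R M S"
  unfolding mod_span_def by blast

lemma mod_span_minimal: "submodule N R M \<Longrightarrow> S \<subseteq> N \<Longrightarrow> mod_span R M S \<subseteq> N"
  unfolding mod_span_def by blast

lemma mod_span_mono: "S \<subseteq> T \<Longrightarrow> mod_span R M S \<subseteq> mod_span R M T"
  unfolding mod_span_def by blast

context Module.module
begin

lemma submodule_iff:
  "submodule N R M \<longleftrightarrow> N \<subseteq> carrier M \<and> \<zero>\<^bsub>M\<^esub> \<in> N \<and> (\<forall>a\<in>N. \<forall>b\<in>N. a \<oplus>\<^bsub>M\<^esub> b \<in> N) \<and>
     (\<forall>r\<in>carrier R. \<forall>a\<in>N. r \<odot>\<^bsub>M\<^esub> a \<in> N)"
proof
  assume N: "submodule N R M"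
  have "\<zero>\<^bsub>M\<^esub> \<in> N"
    using subgroup.one_closed[OF submodule.axioms(1)[OF N]] by simp
  then show "N \<subseteq> carrier M \<and> \<zero>\<^bsub>M\<^esub> \<in> N \<and> (\<forall>a\<in>N. \<forall>b\<in>N. a \<oplus>\<^bsub>M\<^esub> b \<in> N) \<and>
     (\<forall>r\<in>carrier R. \<forall>a\<in>N. r \<odot>\<^bsub>M\<^esub> a \<in> N)"
    using submoduleE(1,4,5)[OF N] by blast
next
  assume *: "N \<subseteq> carrier M \<and> \<zero>\<^bsub>M\<^esub> \<in> N \<and> (\<forall>a\<in>N. \<forall>b\<in>N. a \<oplus>\<^bsub>M\<^esub> b \<in> N) \<and>
     (\<forall>r\<in>carrier R. \<forall>a\<in>N. r \<odot>\<^bsub>M\<^esub> a \<in> N)"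
  have "\<ominus>\<^bsub>M\<^esub> a \<in> N" if "a \<in> N" for a
  proof -
    have "(\<ominus> \<one>) \<odot>\<^bsub>M\<^esub> a = \<ominus>\<^bsub>M\<^esub> a"
      using that * smult_l_minus[of \<one> a] by auto
    then show ?thesis using * that R.add.inv_closed[OF R.one_closed] by (metis)
  qed
  then show "submodule N R M"
    using * by (intro submoduleI) auto
qed

lemma mod_span_submodule:
  assumes "S \<subseteq> carrier M"
  shows "submodule (mod_span R M S) R M"
proof -
  have "mod_span R M S \<subseteq> carrier M"
    using mod_span_minimal[OF carrier_is_submodule assms] .
  then show ?thesis
    unfolding submodule_iff unfolding mod_span_def using submodule_iff by auto
qed

text \<open>A chain is controlled by its trace on \<open>P\<close> and its image modulo
  \<open>P\<close>. Instead of forming the quotient, the image is represented inside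
  \<open>Q\<close>.\<close>

lemma acc_on_add:
  assumes P: "submodule P R M" "acc_on R M P" and Q: "submodule Q R M" "acc_on R M Q"
  shows "acc_on R M {p \<oplus>\<^bsub>M\<^esub> q | p q. p \<in> P \<and> q \<in> Q}"
  unfolding acc_on_def
proof (intro allI impI)
  fix N :: "nat \<Rightarrow> _ set"
  assume *: "\<forall>k. submodule (N k) R M \<and> N k \<subseteq> {p \<oplus>\<^bsub>M\<^esub> q | p q. p \<in> P \<and> q \<in> Q} \<and> N k \<subseteq> N (Suc k)"
  have N: "submodule (N k) R M" "N k \<subseteq> N (Suc k)" for k
    using * by auto
  note Pc = submoduleE[OF P(1)] and Qc = submoduleE[OF Q(1)] and Nc = submoduleE[OF N(1)]
  have mono: "k \<le> m \<Longrightarrow> N k \<subseteq> N m" for k m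
    using N(2) by (rule lift_Suc_mono_le)
  define N' where "N' k = N k \<inter> P" for k
  \<comment> \<open>This is the intersection of \<open>N k + P\<close> with \<open>Q\<close>; it
    determines the image of \<open>N k\<close> modulo \<open>P\<close>.\<close>
  define N'' where "N'' k = {q \<in> Q. \<exists>p\<in>P. \<exists>y\<in>N k. q = y \<oplus>\<^bsub>M\<^esub> p}" for k
  have N': "submodule (N' k) R M" for k
    using N(1)[of k] P(1) unfolding submodule_iff N'_def by auto
  have N'': "submodule (N'' k) R M" for k
    unfolding submodule_iff
  proof (intro conjI ballI)
    show "N'' k \<subseteq> carrier M" unfolding N''_def using Qc(1) by auto
    have "\<zero>\<^bsub>M\<^esub> = \<zero>\<^bsub>M\<^esub> \<oplus>\<^bsub>M\<^esub> \<zero>\<^bsub>M\<^esub>" by simp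
    then show "\<zero>\<^bsub>M\<^esub> \<in> N'' k" unfolding N''_def
      using Q(1) P(1) N(1)[of k] unfolding submodule_iff by blast
  next
    fix a b assume "a \<in> N'' k" "b \<in> N'' k"
    then obtain p y p' y' where 1: "a \<in> Q" "b \<in> Q" "p \<in> P" "p' \<in> P" "y \<in> N k" "y' \<in> N k"
      "a = y \<oplus>\<^bsub>M\<^esub> p" "b = y' \<oplus>\<^bsub>M\<^esub> p'"
      unfolding N''_def by blast
    then have c: "p \<in> carrier M" "p' \<in> carrier M" "y \<in> carrier M" "y' \<in> carrier M"
      using Pc(1) Nc(1) by blast+
    have "a \<oplus>\<^bsub>M\<^esub> b = (y \<oplus>\<^bsub>M\<^esub> y') \<oplus>\<^bsub>M\<^esub> (p \<oplus>\<^bsub>M\<^esub> p')"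
      using 1 c by (simp add: M.a_ac)
    then show "a \<oplus>\<^bsub>M\<^esub> b \<in> N'' k"
      unfolding N''_def using 1 Pc(5) Qc(5) Nc(5) by blast
  next
    fix r a assume r: "r \<in> carrier R" and "a \<in> N'' k"
    then obtain p y where 1: "a \<in> Q" "p \<in> P" "y \<in> N k" "a = y \<oplus>\<^bsub>M\<^esub> p"
      unfolding N''_def by blast
    then have "r \<odot>\<^bsub>M\<^esub> a = (r \<odot>\<^bsub>M\<^esub> y) \<oplus>\<^bsub>M\<^esub> (r \<odot>\<^bsub>M\<^esub> p)"
      using smult_r_distr[OF r, of y p] Pc(1) Nc(1) by blast
    then show "r \<odot>\<^bsub>M\<^esub> a \<in> N'' k"
      unfolding N''_def using 1 r Pc(4) Qc(4) Nc(4) by blast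
  qed
  have N'P: "N' k \<subseteq> P" "N' k \<subseteq> N' (Suc k)" for k
    using N(2) unfolding N'_def by auto
  have N''Q: "N'' k \<subseteq> Q" "N'' k \<subseteq> N'' (Suc k)" for k
    using N(2) unfolding N''_def by auto
  obtain n1 where n1: "\<And>m. m \<ge> n1 \<Longrightarrow> N' m = N' n1"
    using acc_onD[where N = N', OF P(2) N' N'P] by blast
  obtain n2 where n2: "\<And>m. m \<ge> n2 \<Longrightarrow> N'' m = N'' n2"
    using acc_onD[where N = N'', OF Q(2) N'' N''Q] by blast
  let ?n = "max n1 n2"
  have "N m = N ?n" if m: "m \<ge> ?n" for m
  proof
    show "N m \<subseteq> N ?n"
    proof
      fix x assume x: "x \<in> N m"
      then obtain p q where pq: "x = p \<oplus>\<^bsub>M\<^esub> q" "p \<in> P" "q \<in> Q"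
        using * by blast
      then have c: "p \<in> carrier M" "q \<in> carrier M" "x \<in> carrier M"
        using Pc(1) Qc(1) Nc(1) x by blast+
      have "q = x \<oplus>\<^bsub>M\<^esub> (\<ominus>\<^bsub>M\<^esub> p)"
        using pq c by (simp add: M.a_comm[of p q] M.a_assoc M.r_neg)
      then have "q \<in> N'' m"
        unfolding N''_def using pq x Pc(3) by blast
      then have "q \<in> N'' ?n"
        using n2[of m] n2[of ?n] m by auto
      then obtain p' y where y: "p' \<in> P" "y \<in> N ?n" "q = y \<oplus>\<^bsub>M\<^esub> p'"
        unfolding N''_def by blast
      then have c': "p' \<in> carrier M" "y \<in> carrier M"
        using Pc(1) Nc(1) by blast+
      \<comment> \<open>The difference of \<open>x\<close> and \<open>y\<close> lies in
        \<open>P\<close> and in \<open>N m\<close>, hence in the stationary trace on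
        \<open>P\<close>.\<close>
      have d: "x \<oplus>\<^bsub>M\<^esub> (\<ominus>\<^bsub>M\<^esub> y) = p \<oplus>\<^bsub>M\<^esub> p'"
        unfolding pq(1) y(3) using c c' by (simp add: M.a_ac M.r_neg M.minus_add)
      have "x \<oplus>\<^bsub>M\<^esub> (\<ominus>\<^bsub>M\<^esub> y) \<in> N m"
        using x y Nc(3,5) mono[OF m] by blast
      moreover have "x \<oplus>\<^bsub>M\<^esub> (\<ominus>\<^bsub>M\<^esub> y) \<in> P"
        unfolding d using pq y Pc(5) by blast
      ultimately have "x \<oplus>\<^bsub>M\<^esub> (\<ominus>\<^bsub>M\<^esub> y) \<in> N' ?n"
        using n1[of m] n1[of ?n] m unfolding N'_def by auto
      then have "(x \<oplus>\<^bsub>M\<^esub> (\<ominus>\<^bsub>M\<^esub> y)) \<oplus>\<^bsub>M\<^esub> y \<in> N ?n"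
        using y Nc(5) unfolding N'_def by blast
      then show "x \<in> N ?n"
        using c c' by (simp add: M.a_assoc M.l_neg)
    qed
  qed (use mono m in blast)
  then show "\<exists>n. \<forall>m\<ge>n. N m = N n" by blast
qed

text \<open>The generators are taken from \<open>Z\<close> itself, and \<open>Z\<close> is an
  arbitrary subset of \<open>P\<close>. Thus a set of homogeneous elements gets finitely many
  homogeneous generators. If none existed, choosing elements outside the span of the earlier ones
  would give a strictly increasing chain.\<close>

lemma acc_on_finite_subset:
  assumes P: "submodule P R M" "acc_on R M P" and Z: "Z \<subseteq> P"
  obtains S where "finite S" "S \<subseteq> Z" "Z \<subseteq> mod_span R M S"
proof -
  have "\<exists>S. finite S \<and> S \<subseteq> Z \<and> Z \<subseteq> mod_span R M S"
  proof (rule ccontr)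
    assume *: "\<nexists>S. finite S \<and> S \<subseteq> Z \<and> Z \<subseteq> mod_span R M S"
    have "\<exists>z. finite S \<and> S \<subseteq> Z \<longrightarrow> z \<in> Z \<and> z \<notin> mod_span R M S" for S
    proof (cases "finite S \<and> S \<subseteq> Z")
      case True
      with * have "\<not> Z \<subseteq> mod_span R M S" by meson
      then show ?thesis by (meson subsetI)
    qed blast
    then obtain g where g: "\<And>S. finite S \<Longrightarrow> S \<subseteq> Z \<Longrightarrow> g S \<in> Z \<and> g S \<notin> mod_span R M S"
      by metis
    define T where "T = rec_nat {} (\<lambda>_ S. insert (g S) S)"
    have TS: "T 0 = {}" "T (Suc k) = insert (g (T k)) (T k)" for k
      unfolding T_def by simp_all
    have T: "finite (T k) \<and> T k \<subseteq> Z" for k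
    proof (induction k)
      case (Suc k)
      then show ?case using g[of "T k"] by (simp add: TS)
    qed (simp add: TS)
    have Tc: "T k \<subseteq> carrier M" for k
      using T Z submoduleE(1)[OF P(1)] by blast
    have "T k \<subseteq> T (Suc k)" for k
      unfolding TS by blast
    then have inc: "mod_span R M (T k) \<subseteq> mod_span R M (T (Suc k))" for k
      by (rule mod_span_mono)
    have TP: "mod_span R M (T k) \<subseteq> P" for k
      by (rule mod_span_minimal[OF P(1)]) (use T Z in blast)
    obtain n where "\<forall>m\<ge>n. mod_span R M (T m) = mod_span R M (T n)"
      using acc_onD[where N = "\<lambda>k. mod_span R M (T k)", OF P(2) mod_span_submodule[OF Tc] TP inc] ..
    with le_SucI[OF order_refl, of n] have "mod_span R M (T (Suc n)) = mod_span R M (T n)"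
      by blast
    moreover have "g (T n) \<notin> mod_span R M (T n)" "g (T n) \<in> mod_span R M (T (Suc n))"
      using g[of "T n"] T[of n] mod_span_incl[of "T (Suc n)" R M] by (auto simp: TS)
    ultimately show False by simp
  qed
  then show thesis using that by blast
qed

end

text \<open>A chain below the image of \<open>P\<close> is pulled back to \<open>P\<close> and
  recovered as the image of its preimage.\<close>

lemma acc_on_image:
  assumes M: "Module.module R M" and N: "Module.module R N"
    and P: "submodule P R M" "acc_on R M P"
    and f: "\<And>x. x \<in> P \<Longrightarrow> f x \<in> carrier N"
    and f_add: "\<And>x y. x \<in> P \<Longrightarrow> y \<in> P \<Longrightarrow> f (x \<oplus>\<^bsub>M\<^esub> y) = f x \<oplus>\<^bsub>N\<^esub> f y"
    and f_smult: "\<And>r x. r \<in> carrier R \<Longrightarrow> x \<in> P \<Longrightarrow> f (r \<odot>\<^bsub>M\<^esub> x) = r \<odot>\<^bsub>N\<^esub> f x"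
  shows "submodule (f ` P) R N" and "acc_on R N (f ` P)"
proof -
  interpret M: Module.module R M by fact
  interpret N: Module.module R N by fact
  have P0: "P \<subseteq> carrier M" "\<zero>\<^bsub>M\<^esub> \<in> P" and Pa: "\<And>x y. x \<in> P \<Longrightarrow> y \<in> P \<Longrightarrow> x \<oplus>\<^bsub>M\<^esub> y \<in> P"
    and Ps: "\<And>r x. r \<in> carrier R \<Longrightarrow> x \<in> P \<Longrightarrow> r \<odot>\<^bsub>M\<^esub> x \<in> P"
    using P(1) unfolding M.submodule_iff by auto
  have "f \<zero>\<^bsub>M\<^esub> = f (\<zero>\<^bsub>R\<^esub> \<odot>\<^bsub>M\<^esub> \<zero>\<^bsub>M\<^esub>)" by simp
  also have "\<dots> = \<zero>\<^bsub>N\<^esub>" using f_smult f P0 by (simp del: M.smult_l_null M.smult_r_null)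
  finally have f0: "f \<zero>\<^bsub>M\<^esub> = \<zero>\<^bsub>N\<^esub>" .
  show "submodule (f ` P) R N"
    unfolding N.submodule_iff
  proof (intro conjI ballI)
    show "\<zero>\<^bsub>N\<^esub> \<in> f ` P" using f0 P0(2) by (metis imageI)
  qed (use f f_add[symmetric] f_smult[symmetric] Pa Ps in \<open>auto intro!: imageI\<close>)
  show "acc_on R N (f ` P)"
    unfolding acc_on_def
  proof (intro allI impI)
    fix K :: "nat \<Rightarrow> _ set"
    assume *: "\<forall>k. submodule (K k) R N \<and> K k \<subseteq> f ` P \<and> K k \<subseteq> K (Suc k)"
    define K' where "K' k = {x \<in> P. f x \<in> K k}" for k
    have K': "submodule (K' k) R M" for k
    proof -
      have "submodule (K k) R N" using * by blast
      then show ?thesis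
        unfolding M.submodule_iff N.submodule_iff K'_def using P0 f0 Pa Ps f_add f_smult by auto
    qed
    obtain n where "\<And>m. m \<ge> n \<Longrightarrow> K' m = K' n"
      using acc_onD[where N = K', OF P(2) K'] * unfolding K'_def by blast
    moreover have "K k = f ` K' k" for k
      using * unfolding K'_def by blast
    ultimately show "\<exists>n. \<forall>m\<ge>n. K m = K n" by metis
  qed
qed

lemma regular_module_sel [simp]:
  "carrier (regular_module R) = carrier R" "ring.zero (regular_module R) = ring.zero R"
  "ring.add (regular_module R) = ring.add R" "smult (regular_module R) = monoid.mult R"
  by (simp_all add: regular_module_def)

lemma regular_module: assumes "cring R" shows "Module.module R (regular_module R)"
proof -
  interpret cring R by fact
  have "abelian_group (regular_module R)"
  proof (rule abelian_groupI)
    fix x assume "x \<in> carrier (regular_module R)"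
    then show "\<exists>y\<in>carrier (regular_module R). y \<oplus>\<^bsub>regular_module R\<^esub> x = \<zero>\<^bsub>regular_module R\<^esub>"
      by (intro bexI[of _ "\<ominus>\<^bsub>R\<^esub> x"]) (auto simp: l_neg)
  qed (auto simp: a_ac)
  then show ?thesis
    by (intro moduleI) (auto simp: assms l_distr r_distr m_assoc)
qed

lemma submodule_regular_iff:
  assumes "cring R"
  shows "submodule I R (regular_module R) \<longleftrightarrow> ideal I R"
proof -
  interpret cring R by fact
  interpret M: Module.module R "regular_module R" by (rule regular_module) fact
  show ?thesis
  proof
    assume I: "submodule I R (regular_module R)"
    have a: "a_inv (regular_module R) a = \<ominus>\<^bsub>R\<^esub> a" for a
      by (simp add: a_inv_def m_inv_def)
    show "ideal I R"
    proof (rule idealI)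
      show "subgroup I (add_monoid R)"
        by (rule add.subgroupI)
          (use M.submoduleE[OF I] I a in \<open>auto simp: M.submodule_iff a_inv_def\<close>)
    next
      fix a x assume a: "a \<in> I" "x \<in> carrier R"
      then show "x \<otimes>\<^bsub>R\<^esub> a \<in> I"
        using M.submoduleE(4)[OF I] by simp
      moreover have "a \<in> carrier R"
        using a M.submoduleE(1)[OF I] by auto
      ultimately show "a \<otimes>\<^bsub>R\<^esub> x \<in> I"
        using m_comm a by metis
    qed (rule ring_axioms)
  next
    assume I: "ideal I R"
    then show "submodule I R (regular_module R)"
      unfolding M.submodule_iff
      using ideal.Icarr[OF I] additive_subgroup.a_closed[OF ideal.axioms(1)[OF I]]
        additive_subgroup.zero_closed[OF ideal.axioms(1)[OF I]] ideal.I_l_closed[OF I]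
      by auto
  qed
qed

lemma mod_span_regular:
  assumes "cring R"
  shows "mod_span R (regular_module R) S = genideal R S"
  unfolding mod_span_def genideal_def submodule_regular_iff[OF assms] ..

lemma acc_on_regular:
  assumes "cring R" "noetherian_ring R"
  shows "acc_on R (regular_module R) (carrier R)"
  unfolding acc_on_def submodule_regular_iff[OF assms(1)]
proof (intro allI impI)
  fix N :: "nat \<Rightarrow> _ set"
  assume *: "\<forall>k. ideal (N k) R \<and> N k \<subseteq> carrier R \<and> N k \<subseteq> N (Suc k)"
  have inc: "N k \<subseteq> N (Suc k)" for k
    using * by blast
  have mono: "k \<le> m \<Longrightarrow> N k \<subseteq> N m" for k m
    by (rule lift_Suc_mono_le[of N, OF inc])
  have "subset.chain {I. ideal I R} (range N)"
    unfolding subset_chain_def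
  proof (intro conjI ballI)
    fix I J assume "I \<in> range N" "J \<in> range N"
    then obtain k m where "I = N k" "J = N m" by blast
    then show "I \<subseteq> J \<or> J \<subseteq> I"
      using mono nat_le_linear[of k m] by blast
  qed (use * in blast)
  then have "\<Union>(range N) \<in> range N"
    using noetherian_ring.ideal_chain_is_trivial[OF assms(2)] by blast
  then obtain n where "\<Union>(range N) = N n" by blast
  have "N m = N n" if "n \<le> m" for m
    using mono[OF that] \<open>\<Union>(range N) = N n\<close> by blast
  then show "\<exists>n. \<forall>m\<ge>n. N m = N n" by blast
qed

lemma acc_on_fin_gen:
  assumes R: "cring R" "noetherian_ring R" and M: "fin_gen_module R M"
  shows "acc_on R M (carrier M)"
proof -
  interpret Module.module R M using M unfolding fin_gen_module_def by blast
  interpret RR: Module.module R "regular_module R" by (rule regular_module) fact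
  obtain S where S: "finite S" "S \<subseteq> carrier M" "\<And>N. submodule N R M \<Longrightarrow> S \<subseteq> N \<Longrightarrow> N = carrier M"
    using M unfolding fin_gen_module_def by blast
  have "\<exists>P. submodule P R M \<and> S \<subseteq> P \<and> acc_on R M P"
    using S(1,2)
  proof (induction S rule: finite_induct)
    case empty
    have "submodule {\<zero>\<^bsub>M\<^esub>} R M" unfolding submodule_iff by auto
    moreover have "acc_on R M {\<zero>\<^bsub>M\<^esub>}"
      unfolding acc_on_def
    proof (intro allI impI)
      fix N :: "nat \<Rightarrow> _ set"
      assume "\<forall>k. submodule (N k) R M \<and> N k \<subseteq> {\<zero>\<^bsub>M\<^esub>} \<and> N k \<subseteq> N (Suc k)"
      then have "\<zero>\<^bsub>M\<^esub> \<in> N k" "N k \<subseteq> {\<zero>\<^bsub>M\<^esub>}" for k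
        unfolding submodule_iff by simp_all
      then have "N k = {\<zero>\<^bsub>M\<^esub>}" for k
        using subset_singletonD[of "N k"] by (metis empty_iff)
      then show "\<exists>n. \<forall>m\<ge>n. N m = N n" by simp
    qed
    ultimately show ?case by blast
  next
    case (insert s S)
    then obtain P where P: "submodule P R M" "S \<subseteq> P" "acc_on R M P" by blast
    have s: "s \<in> carrier M" using insert by blast
    let ?f = "\<lambda>r. r \<odot>\<^bsub>M\<^esub> s"
    have car: "submodule (carrier R) R (regular_module R)"
      using RR.carrier_is_submodule by simp
    \<comment> \<open>The cyclic submodule spanned by \<open>s\<close> is an image of the regular
      module; generators are adjoined one at a time through sums of submodules.\<close>
    have f: "submodule (?f ` carrier R) R M" "acc_on R M (?f ` carrier R)"
      using acc_on_image[OF RR.module_axioms module_axioms car acc_on_regular[OF R], of ?f] s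
      by (auto simp: smult_l_distr smult_assoc1)
    let ?Q = "{p \<oplus>\<^bsub>M\<^esub> q | p q. p \<in> ?f ` carrier R \<and> q \<in> P}"
    have acc: "acc_on R M ?Q"
      by (rule acc_on_add[OF f P(1,3)])
    note Pc = P(1)[unfolded submodule_iff] and fc = f(1)[unfolded submodule_iff]
    have "submodule ?Q R M"
      unfolding submodule_iff
    proof (intro conjI ballI)
      show "?Q \<subseteq> carrier M" using Pc s by auto
      have "\<zero>\<^bsub>M\<^esub> = \<zero>\<^bsub>M\<^esub> \<oplus>\<^bsub>M\<^esub> \<zero>\<^bsub>M\<^esub>" by simp
      then show "\<zero>\<^bsub>M\<^esub> \<in> ?Q" using Pc fc by blast
    next
      fix a b assume "a \<in> ?Q" "b \<in> ?Q"
      then obtain p q p' q' where 1: "p \<in> ?f ` carrier R" "q \<in> P" "p' \<in> ?f ` carrier R" "q' \<in> P"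
        and ab: "a = p \<oplus>\<^bsub>M\<^esub> q" "b = p' \<oplus>\<^bsub>M\<^esub> q'" by blast
      then have "p \<in> carrier M" "q \<in> carrier M" "p' \<in> carrier M" "q' \<in> carrier M"
        using Pc fc by blast+
      then have "a \<oplus>\<^bsub>M\<^esub> b = (p \<oplus>\<^bsub>M\<^esub> p') \<oplus>\<^bsub>M\<^esub> (q \<oplus>\<^bsub>M\<^esub> q')"
        unfolding ab by (simp add: M.a_ac)
      moreover have "p \<oplus>\<^bsub>M\<^esub> p' \<in> ?f ` carrier R" "q \<oplus>\<^bsub>M\<^esub> q' \<in> P"
        using 1 Pc fc by blast+
      ultimately show "a \<oplus>\<^bsub>M\<^esub> b \<in> ?Q" by blast
    next
      fix r a assume r: "r \<in> carrier R" and "a \<in> ?Q"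
      then obtain p q where 1: "p \<in> ?f ` carrier R" "q \<in> P" and a: "a = p \<oplus>\<^bsub>M\<^esub> q" by blast
      then have "r \<odot>\<^bsub>M\<^esub> a = (r \<odot>\<^bsub>M\<^esub> p) \<oplus>\<^bsub>M\<^esub> (r \<odot>\<^bsub>M\<^esub> q)"
        using smult_r_distr[OF r] Pc fc by blast
      moreover have "r \<odot>\<^bsub>M\<^esub> p \<in> ?f ` carrier R" "r \<odot>\<^bsub>M\<^esub> q \<in> P"
        using 1 Pc fc r by blast+
      ultimately show "r \<odot>\<^bsub>M\<^esub> a \<in> ?Q" by blast
    qed
    moreover have "insert s S \<subseteq> ?Q"
    proof
      fix x assume "x \<in> insert s S"
      then consider "x = s" | "x \<in> P" "x \<in> carrier M" using P(2) Pc by blast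
      then show "x \<in> ?Q"
      proof cases
        case 1
        then have "x = (\<one>\<^bsub>R\<^esub> \<odot>\<^bsub>M\<^esub> s) \<oplus>\<^bsub>M\<^esub> \<zero>\<^bsub>M\<^esub>" using s by simp
        then show ?thesis using Pc R.one_closed by blast
      next
        case 2
        then have "x = (\<zero>\<^bsub>R\<^esub> \<odot>\<^bsub>M\<^esub> s) \<oplus>\<^bsub>M\<^esub> x" using s by simp
        then show ?thesis using 2 R.zero_closed by blast
      qed
    qed
    ultimately show ?case using acc by blast
  qed
  then show ?thesis using S(3) by blast
qed

lemma noetherian_finite_subset:
  assumes R: "cring R" "noetherian_ring R" and Z: "Z \<subseteq> carrier R"
  obtains S where "finite S" "S \<subseteq> Z" "Z \<subseteq> genideal R S"
proof -
  interpret RR: Module.module R "regular_module R" by (rule regular_module) fact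
  have car: "submodule (carrier R) R (regular_module R)"
    using RR.carrier_is_submodule by simp
  show thesis
    using RR.acc_on_finite_subset[OF car acc_on_regular[OF R] Z] that
    unfolding mod_span_regular[OF R(1)] by blast
qed

section \<open>Koszul complexes as iterated cones\<close>

context abelian_group
begin

lemma neg_zero [simp]: "\<ominus> \<zero> = \<zero>"
  using add.inv_one by (simp add: a_inv_def)

lemma minus_zero [simp]: "x \<in> carrier G \<Longrightarrow> x \<ominus> \<zero> = x"
  by (simp add: minus_eq)

lemma minus_self [simp]: "x \<in> carrier G \<Longrightarrow> x \<ominus> x = \<zero>"
  by (simp add: minus_eq r_neg)

lemma minus_eq_zero_iff:
  assumes "x \<in> carrier G" "y \<in> carrier G"
  shows "x \<ominus> y = \<zero> \<longleftrightarrow> x = y"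
proof
  assume "x \<ominus> y = \<zero>"
  then have "\<zero> \<oplus> y = (x \<ominus> y) \<oplus> y" by simp
  also have "\<dots> = x" using assms by (simp add: minus_eq a_assoc l_neg)
  finally show "x = y" using assms by simp
qed (use assms in simp)

lemma add_minus_cancel:
  assumes "x \<in> carrier G" "y \<in> carrier G"
  shows "(x \<oplus> y) \<ominus> y = x" "(x \<ominus> y) \<oplus> y = x" "y \<oplus> (x \<ominus> y) = x" "(y \<oplus> x) \<ominus> y = x"
proof -
  show 1: "(x \<oplus> y) \<ominus> y = x" and 2: "(x \<ominus> y) \<oplus> y = x"
    using assms by (simp_all add: minus_eq a_assoc r_neg l_neg)
  show "y \<oplus> (x \<ominus> y) = x"
    using 2 a_comm[of y "x \<ominus> y"] assms by simp
  show "(y \<oplus> x) \<ominus> y = x"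
    using 1 a_comm[of y x] assms by simp
qed

lemma minus_add_rearrange:
  assumes "a \<in> carrier G" "b \<in> carrier G" "c \<in> carrier G"
  shows "(a \<oplus> b) \<oplus> ((c \<ominus> b) \<ominus> a) = c" "((a \<oplus> b) \<ominus> c) \<ominus> a = b \<ominus> c"
proof -
  have "(a \<oplus> b) \<oplus> ((c \<ominus> b) \<ominus> a) = b \<oplus> (((c \<ominus> b) \<ominus> a) \<oplus> a)"
    using assms by (simp add: a_ac)
  then show "(a \<oplus> b) \<oplus> ((c \<ominus> b) \<ominus> a) = c"
    using assms by (simp add: add_minus_cancel)
  have "(a \<oplus> b) \<ominus> c = a \<oplus> (b \<ominus> c)"
    using assms by (simp add: minus_eq a_assoc)
  then show "((a \<oplus> b) \<ominus> c) \<ominus> a = b \<ominus> c"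
    using assms by (simp add: add_minus_cancel)
qed

lemma add4_rearrange:
  assumes "a \<in> carrier G" "b \<in> carrier G" "c \<in> carrier G" "d \<in> carrier G"
  shows "(a \<oplus> b) \<oplus> (c \<ominus> (\<ominus> d)) = (a \<oplus> c) \<oplus> (b \<oplus> d)"
    "(a \<oplus> b) \<ominus> (c \<oplus> d) = (a \<ominus> c) \<oplus> (b \<ominus> d)"
  using assms by (simp_all add: minus_eq minus_add a_ac)

end

text \<open>An element of a \<open>d\<close>-fold iterated cone over \<open>M\<close> is a full binary tree of depth \<open>d\<close> with
  leaves in \<open>M\<close>, so that all iterated cones live on a single type. In \<open>V i \<mu>\<close>, the index \<open>i\<close> is the
  cohomological and \<open>\<mu>\<close> the internal degree; \<open>Node a b\<close> belongs to the cone, shifted by \<open>-1\<close>, of a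
  map \<open>V \<rightarrow> V(1)\<close> of internal degree \<open>1\<close>.\<close>

datatype 'a tree = Leaf (leaf_val: 'a) | Node (lft: "'a tree") (rgt: "'a tree")

definition leaf_module :: "('r, 'm, 'q) module_scheme \<Rightarrow> ('r, 'm tree) module" where
  "leaf_module M = \<lparr>carrier = Leaf ` carrier M,
     monoid.mult = (\<lambda>_ _. Leaf \<zero>\<^bsub>M\<^esub>), one = Leaf \<zero>\<^bsub>M\<^esub>, ring.zero = Leaf \<zero>\<^bsub>M\<^esub>,
     ring.add = (\<lambda>s t. Leaf (leaf_val s \<oplus>\<^bsub>M\<^esub> leaf_val t)), smult = (\<lambda>r t. Leaf (r \<odot>\<^bsub>M\<^esub> leaf_val t))\<rparr>"

definition node_module :: "('r, 'm tree) module \<Rightarrow> ('r, 'm tree) module" where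
  "node_module N = \<lparr>carrier = {Node a b | a b. a \<in> carrier N \<and> b \<in> carrier N},
     monoid.mult = (\<lambda>_ _. Node \<zero>\<^bsub>N\<^esub> \<zero>\<^bsub>N\<^esub>), one = Node \<zero>\<^bsub>N\<^esub> \<zero>\<^bsub>N\<^esub>, ring.zero = Node \<zero>\<^bsub>N\<^esub> \<zero>\<^bsub>N\<^esub>,
     ring.add = (\<lambda>s t. Node (lft s \<oplus>\<^bsub>N\<^esub> lft t) (rgt s \<oplus>\<^bsub>N\<^esub> rgt t)),
     smult = (\<lambda>r t. Node (r \<odot>\<^bsub>N\<^esub> lft t) (r \<odot>\<^bsub>N\<^esub> rgt t))\<rparr>"

text \<open>The minus sign makes the square vanish: the second entry of the square at
  \<open>Node a b\<close> is \<open>y D a - D (y a - D b)\<close>, which is zero by linearity and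
  \<open>D D = 0\<close>.\<close>

definition cone_diff :: "('r, 'm tree) module \<Rightarrow> ('m tree \<Rightarrow> 'm tree) \<Rightarrow> 'r \<Rightarrow> 'm tree \<Rightarrow> 'm tree" where
  "cone_diff N D y t = Node (D (lft t)) (y \<odot>\<^bsub>N\<^esub> lft t \<ominus>\<^bsub>N\<^esub> D (rgt t))"

text \<open>The second entry carries \<open>i - 1\<close> and \<open>\<mu> + 1\<close> because
  \<open>y a\<close> and \<open>D b\<close> are added in the differential: both then have
  cohomological degree \<open>i\<close> and internal degree \<open>\<mu> + 1\<close>, as the second
  entry of a node of degree \<open>(i + 1, \<mu>)\<close> must.\<close>

definition cone_strand :: "(int \<Rightarrow> int \<Rightarrow> 'm tree set) \<Rightarrow> int \<Rightarrow> int \<Rightarrow> 'm tree set" where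
  "cone_strand V i \<mu> = {Node a b | a b. a \<in> V i \<mu> \<and> b \<in> V (i - 1) (\<mu> + 1)}"

primrec kos_module :: "('r, 'm, 'q) module_scheme \<Rightarrow> 'r list \<Rightarrow> ('r, 'm tree) module" where
  "kos_module M [] = leaf_module M"
| "kos_module M (y # ys) = node_module (kos_module M ys)"

text \<open>The total differential of the Koszul complex on \<open>ys\<close> with coefficients in
  the complex \<open>(M, D)\<close>. With \<open>D = 0\<close> it is the Koszul complex of a module;
  with the differential of an injective resolution it is the total complex of a double
  complex.\<close>

primrec kos_diff :: "('r, 'm, 'q) module_scheme \<Rightarrow> ('m \<Rightarrow> 'm) \<Rightarrow> 'r list \<Rightarrow> 'm tree \<Rightarrow> 'm tree" where
  "kos_diff M D [] = (\<lambda>t. Leaf (D (leaf_val t)))"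
| "kos_diff M D (y # ys) = cone_diff (kos_module M ys) (kos_diff M D ys) y"

primrec kos_strand :: "(int \<Rightarrow> int \<Rightarrow> 'm set) \<Rightarrow> 'r list \<Rightarrow> int \<Rightarrow> int \<Rightarrow> 'm tree set" where
  "kos_strand V [] = (\<lambda>i \<mu>. Leaf ` V i \<mu>)"
| "kos_strand V (y # ys) = cone_strand (kos_strand V ys)"

text \<open>A complex is one module with a square-zero endomorphism. Degrees are recorded separately
  by families of subsets, so a complex and its subcomplexes share the same module and the same
  differential.\<close>

locale diff_module = Module.module +
  fixes D
  assumes D_closed [simp]: "x \<in> carrier M \<Longrightarrow> D x \<in> carrier M"
    and D_add: "x \<in> carrier M \<Longrightarrow> y \<in> carrier M \<Longrightarrow> D (x \<oplus>\<^bsub>M\<^esub> y) = D x \<oplus>\<^bsub>M\<^esub> D y"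
    and D_smult: "r \<in> carrier R \<Longrightarrow> x \<in> carrier M \<Longrightarrow> D (r \<odot>\<^bsub>M\<^esub> x) = r \<odot>\<^bsub>M\<^esub> D x"
    and D_D [simp]: "x \<in> carrier M \<Longrightarrow> D (D x) = \<zero>\<^bsub>M\<^esub>"
begin

lemma D_zero [simp]: "D \<zero>\<^bsub>M\<^esub> = \<zero>\<^bsub>M\<^esub>"
  using D_smult[of "\<zero>\<^bsub>R\<^esub>" "\<zero>\<^bsub>M\<^esub>"] by simp

lemma D_neg: "x \<in> carrier M \<Longrightarrow> D (\<ominus>\<^bsub>M\<^esub> x) = \<ominus>\<^bsub>M\<^esub> D x"
  using D_smult[of "\<ominus>\<^bsub>R\<^esub> \<one>\<^bsub>R\<^esub>" x] smult_l_minus[of "\<one>\<^bsub>R\<^esub>"] by simp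

lemma D_minus: "x \<in> carrier M \<Longrightarrow> y \<in> carrier M \<Longrightarrow> D (x \<ominus>\<^bsub>M\<^esub> y) = D x \<ominus>\<^bsub>M\<^esub> D y"
  by (simp add: M.minus_eq D_add D_neg)

lemma smult_minus:
  "r \<in> carrier R \<Longrightarrow> x \<in> carrier M \<Longrightarrow> y \<in> carrier M \<Longrightarrow>
    r \<odot>\<^bsub>M\<^esub> (x \<ominus>\<^bsub>M\<^esub> y) = r \<odot>\<^bsub>M\<^esub> x \<ominus>\<^bsub>M\<^esub> r \<odot>\<^bsub>M\<^esub> y"
  by (simp add: M.minus_eq smult_r_distr smult_r_minus)

end

lemma diff_moduleI:
  assumes "Module.module R M"
    "\<And>x. x \<in> carrier M \<Longrightarrow> D x \<in> carrier M"
    "\<And>x y. x \<in> carrier M \<Longrightarrow> y \<in> carrier M \<Longrightarrow> D (x \<oplus>\<^bsub>M\<^esub> y) = D x \<oplus>\<^bsub>M\<^esub> D y"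
    "\<And>r x. r \<in> carrier R \<Longrightarrow> x \<in> carrier M \<Longrightarrow> D (r \<odot>\<^bsub>M\<^esub> x) = r \<odot>\<^bsub>M\<^esub> D x"
    "\<And>x. x \<in> carrier M \<Longrightarrow> D (D x) = \<zero>\<^bsub>M\<^esub>"
  shows "diff_module R M D"
  using assms by (simp add: diff_module_def diff_module_axioms_def)

lemma (in Module.module) leaf_module: "Module.module R (leaf_module M)"
proof -
  have "abelian_group (leaf_module M)"
  proof (rule abelian_groupI)
    fix x assume "x \<in> carrier (leaf_module M)"
    then obtain a where a: "a \<in> carrier M" "x = Leaf a" by (auto simp: leaf_module_def)
    show "\<exists>y\<in>carrier (leaf_module M). y \<oplus>\<^bsub>leaf_module M\<^esub> x = \<zero>\<^bsub>leaf_module M\<^esub>"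
      by (rule bexI[of _ "Leaf (\<ominus>\<^bsub>M\<^esub> a)"]) (use a in \<open>auto simp: leaf_module_def M.l_neg\<close>)
  qed (auto simp: leaf_module_def M.a_ac)
  then show ?thesis
    by (intro moduleI R.is_cring)
      (auto simp: leaf_module_def smult_l_distr smult_r_distr smult_assoc1)
qed

lemma node_module: 
  assumes "Module.module R N"
  shows "Module.module R (node_module N)"
proof -
  interpret Module.module R N by fact
  have "abelian_group (node_module N)"
  proof (rule abelian_groupI)
    fix x assume "x \<in> carrier (node_module N)"
    then obtain a b where a: "a \<in> carrier N" "b \<in> carrier N" "x = Node a b"
      by (auto simp: node_module_def)
    show "\<exists>y\<in>carrier (node_module N). y \<oplus>\<^bsub>node_module N\<^esub> x = \<zero>\<^bsub>node_module N\<^esub>"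
      by (rule bexI[of _ "Node (\<ominus>\<^bsub>N\<^esub> a) (\<ominus>\<^bsub>N\<^esub> b)"]) (use a in \<open>auto simp: node_module_def M.l_neg\<close>)
  qed (auto simp: node_module_def M.a_ac)
  then show ?thesis
    by (intro moduleI R.is_cring)
      (auto simp: node_module_def smult_l_distr smult_r_distr smult_assoc1)
qed

lemma leaf_module_sel [simp]:
  "carrier (leaf_module M) = Leaf ` carrier M" "\<zero>\<^bsub>leaf_module M\<^esub> = Leaf \<zero>\<^bsub>M\<^esub>"
  "s \<oplus>\<^bsub>leaf_module M\<^esub> t = Leaf (leaf_val s \<oplus>\<^bsub>M\<^esub> leaf_val t)"
  "r \<odot>\<^bsub>leaf_module M\<^esub> t = Leaf (r \<odot>\<^bsub>M\<^esub> leaf_val t)"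
  by (simp_all add: leaf_module_def)

lemma node_module_sel [simp]:
  "carrier (node_module N) = {Node a b | a b. a \<in> carrier N \<and> b \<in> carrier N}"
  "\<zero>\<^bsub>node_module N\<^esub> = Node \<zero>\<^bsub>N\<^esub> \<zero>\<^bsub>N\<^esub>"
  "s \<oplus>\<^bsub>node_module N\<^esub> t = Node (lft s \<oplus>\<^bsub>N\<^esub> lft t) (rgt s \<oplus>\<^bsub>N\<^esub> rgt t)"
  "r \<odot>\<^bsub>node_module N\<^esub> t = Node (r \<odot>\<^bsub>N\<^esub> lft t) (r \<odot>\<^bsub>N\<^esub> rgt t)"
  by (simp_all add: node_module_def)

lemma (in Module.module) leaf_module_neg:
  assumes "a \<in> carrier M"
  shows "\<ominus>\<^bsub>leaf_module M\<^esub> Leaf a = Leaf (\<ominus>\<^bsub>M\<^esub> a)"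
proof -
  interpret L: Module.module R "leaf_module M" by (rule leaf_module)
  show ?thesis by (rule L.minus_equality) (use assms in \<open>auto simp: M.l_neg\<close>)
qed

lemma node_module_neg:
  assumes "Module.module R N" "a \<in> carrier N" "b \<in> carrier N"
  shows "\<ominus>\<^bsub>node_module N\<^esub> Node a b = Node (\<ominus>\<^bsub>N\<^esub> a) (\<ominus>\<^bsub>N\<^esub> b)"
proof -
  interpret N: Module.module R N by fact
  interpret L: Module.module R "node_module N" by (rule node_module) fact
  show ?thesis by (rule L.minus_equality) (use assms in \<open>auto simp: N.M.l_neg\<close>)
qed

lemma cone_diff_module:
  assumes "diff_module R N D" and y: "y \<in> carrier R"
  shows "diff_module R (node_module N) (cone_diff N D y)"
proof -
  interpret diff_module R N D by fact
  show ?thesis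
  proof (rule diff_moduleI)
    show "Module.module R (node_module N)" by (rule node_module) unfold_locales
  next
    fix t assume "t \<in> carrier (node_module N)"
    then obtain a b where t: "t = Node a b" "a \<in> carrier N" "b \<in> carrier N" by auto
    show "cone_diff N D y t \<in> carrier (node_module N)"
      using t y by (simp add: cone_diff_def)
    show "cone_diff N D y (cone_diff N D y t) = \<zero>\<^bsub>node_module N\<^esub>"
      using t y by (simp add: cone_diff_def D_minus D_smult)
    fix r assume r: "r \<in> carrier R"
    have "y \<odot>\<^bsub>N\<^esub> (r \<odot>\<^bsub>N\<^esub> a) = r \<odot>\<^bsub>N\<^esub> (y \<odot>\<^bsub>N\<^esub> a)"
      using t y r by (metis smult_assoc1 R.m_comm)
    then show "cone_diff N D y (r \<odot>\<^bsub>node_module N\<^esub> t) = r \<odot>\<^bsub>node_module N\<^esub> cone_diff N D y t"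
      using t y r by (simp add: cone_diff_def D_smult smult_minus)
  next
    fix s t assume "s \<in> carrier (node_module N)" "t \<in> carrier (node_module N)"
    then obtain a b c d where t: "t = Node a b" "s = Node c d"
      "a \<in> carrier N" "b \<in> carrier N" "c \<in> carrier N" "d \<in> carrier N" by auto
    show "cone_diff N D y (s \<oplus>\<^bsub>node_module N\<^esub> t) =
        cone_diff N D y s \<oplus>\<^bsub>node_module N\<^esub> cone_diff N D y t"
      using t y by (simp add: cone_diff_def D_add smult_r_distr M.add4_rearrange)
  qed
qed

lemma kos_diff_module:
  assumes "diff_module R M D" "set ys \<subseteq> carrier R"
  shows "diff_module R (kos_module M ys) (kos_diff M D ys)"
  using assms(2)
proof (induction ys)
  case Nil
  interpret diff_module R M D by fact
  show ?case
    unfolding kos_module.simps kos_diff.simps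
    by (rule diff_moduleI[OF leaf_module]) (auto simp: D_add D_smult)
next
  case (Cons y ys)
  then show ?case
    unfolding kos_module.simps kos_diff.simps by (intro cone_diff_module) auto
qed

text \<open>A bigraded subcomplex in a weak sense: the pieces need be neither independent nor
  exhaustive. Torsion parts, single rows and images of strands therefore qualify. Elements of
  \<open>Y\<close> have internal degree 1, and scalars act on the pieces through \<open>Y\<close>
  only.\<close>

definition strand_family ::
  "('r, 'p) ring_scheme \<Rightarrow> ('r, 'm, 'q) module_scheme \<Rightarrow> ('m \<Rightarrow> 'm) \<Rightarrow> 'r set \<Rightarrow> (int \<Rightarrow> int \<Rightarrow> 'm set) \<Rightarrow> bool"
  where "strand_family R M D Y V \<longleftrightarrow> Y \<subseteq> carrier R \<and>
    (\<forall>i \<mu>. V i \<mu> \<subseteq> carrier M \<and> \<zero>\<^bsub>M\<^esub> \<in> V i \<mu> \<and>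
      (\<forall>a\<in>V i \<mu>. \<forall>b\<in>V i \<mu>. a \<oplus>\<^bsub>M\<^esub> b \<in> V i \<mu>) \<and> (\<forall>a\<in>V i \<mu>. \<ominus>\<^bsub>M\<^esub> a \<in> V i \<mu>) \<and>
      (\<forall>a\<in>V i \<mu>. D a \<in> V (i + 1) \<mu>) \<and> (\<forall>y\<in>Y. \<forall>a\<in>V i \<mu>. y \<odot>\<^bsub>M\<^esub> a \<in> V i (\<mu> + 1)))"

lemma strand_familyD:
  assumes "strand_family R M D Y V"
  shows "Y \<subseteq> carrier R" and "a \<in> V i \<mu> \<Longrightarrow> a \<in> carrier M" and "\<zero>\<^bsub>M\<^esub> \<in> V i \<mu>"
    and "a \<in> V i \<mu> \<Longrightarrow> b \<in> V i \<mu> \<Longrightarrow> a \<oplus>\<^bsub>M\<^esub> b \<in> V i \<mu>" and "a \<in> V i \<mu> \<Longrightarrow> \<ominus>\<^bsub>M\<^esub> a \<in> V i \<mu>"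
    and "a \<in> V i \<mu> \<Longrightarrow> D a \<in> V (i + 1) \<mu>" and "y \<in> Y \<Longrightarrow> a \<in> V i \<mu> \<Longrightarrow> y \<odot>\<^bsub>M\<^esub> a \<in> V i (\<mu> + 1)"
    and "a \<in> V (i - 1) \<mu> \<Longrightarrow> D a \<in> V i \<mu>"
  using assms unfolding strand_family_def apply (blast+)[7]
  using assms unfolding strand_family_def by (metis diff_add_cancel)

lemma strand_family_minus:
  assumes "strand_family R M D Y V" "a \<in> V i \<mu>" "b \<in> V i \<mu>"
  shows "a \<ominus>\<^bsub>M\<^esub> b \<in> V i \<mu>"
  unfolding a_minus_def using strand_familyD(4,5)[OF assms(1)] assms(2,3) by blast

lemma cone_strand_family:
  assumes N: "diff_module R N D" and V: "strand_family R N D Y V" and y: "y \<in> Y"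
  shows "strand_family R (node_module N) (cone_diff N D y) Y (cone_strand V)"
proof -
  interpret diff_module R N D by fact
  note VD = strand_familyD[OF V]
  note Vm = strand_family_minus[OF V]
  have neg: "\<ominus>\<^bsub>node_module N\<^esub> Node a b = Node (\<ominus>\<^bsub>N\<^esub> a) (\<ominus>\<^bsub>N\<^esub> b)"
    if "a \<in> carrier N" "b \<in> carrier N" for a b
    by (rule node_module_neg[OF module_axioms that])
  have d: "y \<odot>\<^bsub>N\<^esub> a \<ominus>\<^bsub>N\<^esub> D b \<in> V i (\<mu> + 1)" if "a \<in> V i \<mu>" "b \<in> V (i - 1) (\<mu> + 1)" for a b i \<mu>
    using VD(7)[OF y that(1)] VD(8)[OF that(2)] by (rule Vm)
  show ?thesis
    unfolding strand_family_def
  proof (intro conjI allI ballI)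
    fix i \<mu>
    show "Y \<subseteq> carrier R" "cone_strand V i \<mu> \<subseteq> carrier (node_module N)"
      "\<zero>\<^bsub>node_module N\<^esub> \<in> cone_strand V i \<mu>"
      using VD(1,2,3) unfolding cone_strand_def by auto
    fix a assume "a \<in> cone_strand V i \<mu>"
    then obtain a1 a2 where a: "a = Node a1 a2" "a1 \<in> V i \<mu>" "a2 \<in> V (i - 1) (\<mu> + 1)"
      unfolding cone_strand_def by blast
    show "\<ominus>\<^bsub>node_module N\<^esub> a \<in> cone_strand V i \<mu>"
      using a neg[OF VD(2)[OF a(2)] VD(2)[OF a(3)]] VD(5) unfolding cone_strand_def by simp
    show "cone_diff N D y a \<in> cone_strand V (i + 1) \<mu>"
      using a d VD(6) unfolding cone_strand_def cone_diff_def by simp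
    show "\<And>z. z \<in> Y \<Longrightarrow> z \<odot>\<^bsub>node_module N\<^esub> a \<in> cone_strand V i (\<mu> + 1)"
      using a(1) VD(7)[OF _ a(2)] VD(7)[OF _ a(3)] unfolding cone_strand_def by simp
    fix b assume "b \<in> cone_strand V i \<mu>"
    then obtain b1 b2 where b: "b = Node b1 b2" "b1 \<in> V i \<mu>" "b2 \<in> V (i - 1) (\<mu> + 1)"
      unfolding cone_strand_def by blast
    show "a \<oplus>\<^bsub>node_module N\<^esub> b \<in> cone_strand V i \<mu>"
      using a b VD(4) unfolding cone_strand_def by simp
  qed
qed

lemma kos_strand_family:
  assumes "diff_module R M D" "strand_family R M D Y V" "set ys \<subseteq> Y"
  shows "strand_family R (kos_module M ys) (kos_diff M D ys) Y (kos_strand V ys)"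
  using assms(3)
proof (induction ys)
  case Nil
  interpret diff_module R M D by fact
  note VD = strand_familyD[OF assms(2)]
  show ?case
    unfolding strand_family_def kos_module.simps kos_diff.simps kos_strand.simps
    using VD leaf_module_neg by auto
next
  case (Cons y ys)
  have "set ys \<subseteq> carrier R" using Cons.prems strand_familyD(1)[OF assms(2)] by auto
  from kos_diff_module[OF assms(1) this] show ?case
    unfolding kos_module.simps kos_diff.simps kos_strand.simps
    using Cons by (intro cone_strand_family) auto
qed

subsection \<open>Subcomplexes with the same cohomology\<close>

text \<open>The two conditions beyond inclusion say, in terms of elements, that the inclusion of
  \<open>E\<close> into \<open>V\<close> is surjective and injective on cohomology.\<close>

definition quasi_iso_sub ::
  "('r, 'm, 'q) module_scheme \<Rightarrow> ('m \<Rightarrow> 'm) \<Rightarrow> (int \<Rightarrow> int \<Rightarrow> 'm set) \<Rightarrow> (int \<Rightarrow> int \<Rightarrow> 'm set) \<Rightarrow> bool"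
  where "quasi_iso_sub M D E V \<longleftrightarrow> (\<forall>i \<mu>. E i \<mu> \<subseteq> V i \<mu> \<and>
    (\<forall>z\<in>V i \<mu>. D z = \<zero>\<^bsub>M\<^esub> \<longrightarrow> (\<exists>e\<in>E i \<mu>. \<exists>w\<in>V (i - 1) \<mu>. D e = \<zero>\<^bsub>M\<^esub> \<and> z = e \<oplus>\<^bsub>M\<^esub> D w)) \<and>
    (\<forall>w\<in>V (i - 1) \<mu>. D w \<in> E i \<mu> \<longrightarrow> (\<exists>v\<in>E (i - 1) \<mu>. D v = D w)))"

text \<open>The five lemma for the long exact sequence of the cone, carried out on elements because
  no quotients are available. In both halves the first entry is corrected first, and the defect this
  leaves in the second entry is then corrected in turn.\<close>

lemma cone_quasi_iso_sub:
  assumes N: "diff_module R N D" and V: "strand_family R N D Y V" and E: "strand_family R N D Y E"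
    and y: "y \<in> Y" and q: "quasi_iso_sub N D E V"
  shows "quasi_iso_sub (node_module N) (cone_diff N D y) (cone_strand E) (cone_strand V)"
proof -
  interpret diff_module R N D by fact
  note VD = strand_familyD[OF V] and ED = strand_familyD[OF E]
  have sub: "E i \<mu> \<subseteq> V i \<mu>" for i \<mu> using q unfolding quasi_iso_sub_def by blast
  have q1: "\<exists>e\<in>E i \<mu>. \<exists>w\<in>V (i - 1) \<mu>. D e = \<zero>\<^bsub>N\<^esub> \<and> z = e \<oplus>\<^bsub>N\<^esub> D w"
    if "z \<in> V i \<mu>" "D z = \<zero>\<^bsub>N\<^esub>" for z i \<mu>
    using q that unfolding quasi_iso_sub_def by blast
  have q2: "\<exists>v\<in>E (i - 1) \<mu>. D v = D w" if "w \<in> V (i - 1) \<mu>" "D w \<in> E i \<mu>" for w i \<mu>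
    using q that unfolding quasi_iso_sub_def by blast
  have yR: "y \<in> carrier R" using y VD(1) by blast
  note m1 = M.minus_eq and sx = strand_family_minus[OF V] and se = strand_family_minus[OF E]
  show ?thesis
    unfolding quasi_iso_sub_def
  proof (intro allI conjI ballI impI)
    fix i \<mu>
    show "cone_strand E i \<mu> \<subseteq> cone_strand V i \<mu>"
      using sub unfolding cone_strand_def by blast
  next
    fix i \<mu> z assume z: "z \<in> cone_strand V i \<mu>" "cone_diff N D y z = \<zero>\<^bsub>node_module N\<^esub>"
    then obtain a b where ab: "z = Node a b" "a \<in> V i \<mu>" "b \<in> V (i - 1) (\<mu> + 1)"
      unfolding cone_strand_def by blast
    note c = VD(2)[OF ab(2)] VD(2)[OF ab(3)]
    have 1: "D a = \<zero>\<^bsub>N\<^esub>" "y \<odot>\<^bsub>N\<^esub> a = D b"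
      using z(2) c yR unfolding ab cone_diff_def by (auto simp: M.minus_eq_zero_iff)
    obtain e w where e: "e \<in> E i \<mu>" "w \<in> V (i - 1) \<mu>" "D e = \<zero>\<^bsub>N\<^esub>" "a = e \<oplus>\<^bsub>N\<^esub> D w"
      using q1[OF ab(2) 1(1)] by blast
    note c = c VD(2)[OF e(2)] ED(2)[OF e(1)]
    have bw: "b \<ominus>\<^bsub>N\<^esub> y \<odot>\<^bsub>N\<^esub> w \<in> V (i - 1) (\<mu> + 1)"
      using sx ab(3) VD(7)[OF y e(2)] by blast
    \<comment> \<open>Subtracting \<open>y w\<close> moves the coboundary of \<open>b\<close> into
      \<open>E\<close>, where injectivity on cohomology supplies a preimage \<open>v\<close> in
      \<open>E\<close>.\<close>
    have "D (b \<ominus>\<^bsub>N\<^esub> y \<odot>\<^bsub>N\<^esub> w) = y \<odot>\<^bsub>N\<^esub> a \<ominus>\<^bsub>N\<^esub> y \<odot>\<^bsub>N\<^esub> D w"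
      using c yR 1 by (simp add: D_minus D_smult)
    also have "\<dots> = y \<odot>\<^bsub>N\<^esub> e"
      unfolding e(4) using c yR by (simp add: smult_r_distr M.add_minus_cancel)
    finally have Dbw: "D (b \<ominus>\<^bsub>N\<^esub> y \<odot>\<^bsub>N\<^esub> w) = y \<odot>\<^bsub>N\<^esub> e" .
    obtain v where v: "v \<in> E (i - 1) (\<mu> + 1)" "D v = y \<odot>\<^bsub>N\<^esub> e"
      using q2[OF bw] Dbw ED(7)[OF y e(1)] by auto
    have vX: "v \<in> V (i - 1) (\<mu> + 1)" using v sub by blast
    note c = c ED(2)[OF v(1)]
    have b3: "(b \<ominus>\<^bsub>N\<^esub> y \<odot>\<^bsub>N\<^esub> w) \<ominus>\<^bsub>N\<^esub> v \<in> V (i - 1) (\<mu> + 1)"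
      using sx bw vX by blast
    have "D ((b \<ominus>\<^bsub>N\<^esub> y \<odot>\<^bsub>N\<^esub> w) \<ominus>\<^bsub>N\<^esub> v) = \<zero>\<^bsub>N\<^esub>"
      using c yR Dbw v(2) D_minus[of "b \<ominus>\<^bsub>N\<^esub> y \<odot>\<^bsub>N\<^esub> w" v] by simp
    then obtain e' w' where e': "e' \<in> E (i - 1) (\<mu> + 1)" "w' \<in> V (i - 1 - 1) (\<mu> + 1)" "D e' = \<zero>\<^bsub>N\<^esub>"
      "(b \<ominus>\<^bsub>N\<^esub> y \<odot>\<^bsub>N\<^esub> w) \<ominus>\<^bsub>N\<^esub> v = e' \<oplus>\<^bsub>N\<^esub> D w'"
      using q1[OF b3] by blast
    note c = c ED(2)[OF e'(1)] VD(2)[OF e'(2)]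
    have "b = (v \<oplus>\<^bsub>N\<^esub> y \<odot>\<^bsub>N\<^esub> w) \<oplus>\<^bsub>N\<^esub> ((b \<ominus>\<^bsub>N\<^esub> y \<odot>\<^bsub>N\<^esub> w) \<ominus>\<^bsub>N\<^esub> v)"
      using c yR by (simp add: M.minus_add_rearrange)
    then have b: "b = (v \<oplus>\<^bsub>N\<^esub> y \<odot>\<^bsub>N\<^esub> w) \<oplus>\<^bsub>N\<^esub> (e' \<oplus>\<^bsub>N\<^esub> D w')"
      unfolding e'(4) .
    have "Node e (v \<oplus>\<^bsub>N\<^esub> e') \<in> cone_strand E i \<mu>"
      using e(1) ED(4)[OF v(1) e'(1)] unfolding cone_strand_def by blast
    \<comment> \<open>The sign in front of \<open>w'\<close> cancels the sign of \<open>D\<close> on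
      the second entry of the cone.\<close>
    moreover have "Node w (\<ominus>\<^bsub>N\<^esub> w') \<in> cone_strand V (i - 1) \<mu>"
      using e(2) VD(5)[OF e'(2)] unfolding cone_strand_def by blast
    moreover have "cone_diff N D y (Node e (v \<oplus>\<^bsub>N\<^esub> e')) = \<zero>\<^bsub>node_module N\<^esub>"
      using c e v e' yR by (simp add: cone_diff_def D_add)
    moreover have "z = Node e (v \<oplus>\<^bsub>N\<^esub> e') \<oplus>\<^bsub>node_module N\<^esub> cone_diff N D y (Node w (\<ominus>\<^bsub>N\<^esub> w'))"
      using c yR unfolding ab(1) cone_diff_def e(4) b by (simp add: D_neg M.add4_rearrange)
    ultimately show "\<exists>e\<in>cone_strand E i \<mu>. \<exists>w\<in>cone_strand V (i - 1) \<mu>.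
        cone_diff N D y e = \<zero>\<^bsub>node_module N\<^esub> \<and> z = e \<oplus>\<^bsub>node_module N\<^esub> cone_diff N D y w"
      by blast
  next
    fix i \<mu> w assume w: "w \<in> cone_strand V (i - 1) \<mu>" "cone_diff N D y w \<in> cone_strand E i \<mu>"
    then obtain w1 w2 where ww: "w = Node w1 w2" "w1 \<in> V (i - 1) \<mu>" "w2 \<in> V (i - 1 - 1) (\<mu> + 1)"
      unfolding cone_strand_def by blast
    define e2 where "e2 = y \<odot>\<^bsub>N\<^esub> w1 \<ominus>\<^bsub>N\<^esub> D w2"
    have e: "D w1 \<in> E i \<mu>" "e2 \<in> E (i - 1) (\<mu> + 1)"
      using w(2) unfolding ww e2_def cone_diff_def cone_strand_def by auto
    obtain v1 where v1: "v1 \<in> E (i - 1) \<mu>" "D v1 = D w1"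
      using q2[OF ww(2) e(1)] by blast
    have v1X: "v1 \<in> V (i - 1) \<mu>" using v1 sub by blast
    note c = VD(2)[OF ww(2)] VD(2)[OF ww(3)] ED(2)[OF v1(1)]
    have "D (w1 \<ominus>\<^bsub>N\<^esub> v1) = \<zero>\<^bsub>N\<^esub>"
      using c v1(2) by (simp add: D_minus)
    then obtain e' w' where e': "e' \<in> E (i - 1) \<mu>" "w' \<in> V (i - 1 - 1) \<mu>" "D e' = \<zero>\<^bsub>N\<^esub>"
      "w1 \<ominus>\<^bsub>N\<^esub> v1 = e' \<oplus>\<^bsub>N\<^esub> D w'"
      using q1[OF sx[OF ww(2) v1X]] by blast
    note c = c ED(2)[OF e'(1)] VD(2)[OF e'(2)]
    have "w1 = v1 \<oplus>\<^bsub>N\<^esub> (w1 \<ominus>\<^bsub>N\<^esub> v1)"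
      using c by (simp add: M.add_minus_cancel)
    then have w1: "w1 = v1 \<oplus>\<^bsub>N\<^esub> (e' \<oplus>\<^bsub>N\<^esub> D w')" unfolding e'(4) .
    have yve: "y \<odot>\<^bsub>N\<^esub> (v1 \<oplus>\<^bsub>N\<^esub> e') \<in> E (i - 1) (\<mu> + 1)"
      using ED(4)[OF v1(1) e'(1)] ED(7)[OF y] by blast
    \<comment> \<open>After \<open>w1\<close> is replaced by \<open>v1 + e'\<close>, the error in
      the second entry is the coboundary of \<open>y w' - w2\<close> and lies in \<open>E\<close>; a
      preimage in \<open>E\<close> exists by injectivity on cohomology.\<close>
    have eq: "D (y \<odot>\<^bsub>N\<^esub> w' \<ominus>\<^bsub>N\<^esub> w2) = e2 \<ominus>\<^bsub>N\<^esub> y \<odot>\<^bsub>N\<^esub> (v1 \<oplus>\<^bsub>N\<^esub> e')"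
    proof -
      have "e2 \<ominus>\<^bsub>N\<^esub> y \<odot>\<^bsub>N\<^esub> (v1 \<oplus>\<^bsub>N\<^esub> e') =
          (y \<odot>\<^bsub>N\<^esub> (v1 \<oplus>\<^bsub>N\<^esub> e') \<oplus>\<^bsub>N\<^esub> y \<odot>\<^bsub>N\<^esub> D w' \<ominus>\<^bsub>N\<^esub> D w2) \<ominus>\<^bsub>N\<^esub> y \<odot>\<^bsub>N\<^esub> (v1 \<oplus>\<^bsub>N\<^esub> e')"
        unfolding e2_def w1 using c yR by (simp add: smult_r_distr M.a_assoc)
      also have "\<dots> = y \<odot>\<^bsub>N\<^esub> D w' \<ominus>\<^bsub>N\<^esub> D w2"
        using c yR by (simp add: M.minus_add_rearrange)
      finally show ?thesis using c yR by (simp add: D_minus D_smult)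
    qed
    have "y \<odot>\<^bsub>N\<^esub> w' \<ominus>\<^bsub>N\<^esub> w2 \<in> V (i - 1 - 1) (\<mu> + 1)"
      using sx VD(7)[OF y e'(2)] ww(3) by blast
    then obtain v2 where v2: "v2 \<in> E (i - 1 - 1) (\<mu> + 1)" "D v2 = e2 \<ominus>\<^bsub>N\<^esub> y \<odot>\<^bsub>N\<^esub> (v1 \<oplus>\<^bsub>N\<^esub> e')"
      using q2[of "y \<odot>\<^bsub>N\<^esub> w' \<ominus>\<^bsub>N\<^esub> w2" "i - 1" "\<mu> + 1"] se[OF e(2) yve] unfolding eq by metis
    note c = c ED(2)[OF v2(1)] ED(2)[OF e(2)] ED(2)[OF yve]
    have "Node (v1 \<oplus>\<^bsub>N\<^esub> e') (\<ominus>\<^bsub>N\<^esub> v2) \<in> cone_strand E (i - 1) \<mu>"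
      using ED(4)[OF v1(1) e'(1)] ED(5)[OF v2(1)] unfolding cone_strand_def by blast
    moreover have "y \<odot>\<^bsub>N\<^esub> (v1 \<oplus>\<^bsub>N\<^esub> e') \<ominus>\<^bsub>N\<^esub> D (\<ominus>\<^bsub>N\<^esub> v2) = e2"
    proof -
      have "y \<odot>\<^bsub>N\<^esub> (v1 \<oplus>\<^bsub>N\<^esub> e') \<ominus>\<^bsub>N\<^esub> D (\<ominus>\<^bsub>N\<^esub> v2) =
          y \<odot>\<^bsub>N\<^esub> (v1 \<oplus>\<^bsub>N\<^esub> e') \<oplus>\<^bsub>N\<^esub> (e2 \<ominus>\<^bsub>N\<^esub> y \<odot>\<^bsub>N\<^esub> (v1 \<oplus>\<^bsub>N\<^esub> e'))"
        using c yR by (simp add: D_neg v2(2) m1)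
      also have "\<dots> = e2"
        using c yR by (intro M.add_minus_cancel) auto
      finally show ?thesis .
    qed
    then have "cone_diff N D y (Node (v1 \<oplus>\<^bsub>N\<^esub> e') (\<ominus>\<^bsub>N\<^esub> v2)) = cone_diff N D y w"
      unfolding ww(1) cone_diff_def using c v1 e' yR
      by (simp add: D_add e2_def[symmetric])
    ultimately show "\<exists>v\<in>cone_strand E (i - 1) \<mu>. cone_diff N D y v = cone_diff N D y w"
      by blast
  qed
qed

lemma kos_quasi_iso_sub:
  assumes M: "diff_module R M D" and V: "strand_family R M D Y V" and E: "strand_family R M D Y E"
    and q: "quasi_iso_sub M D E V" and ys: "set ys \<subseteq> Y"
  shows "quasi_iso_sub (kos_module M ys) (kos_diff M D ys) (kos_strand E ys) (kos_strand V ys)"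
  using ys
proof (induction ys)
  case Nil
  show ?case
    using q unfolding quasi_iso_sub_def kos_module.simps kos_diff.simps kos_strand.simps
    by (auto 0 4)
next
  case (Cons y ys)
  then have s: "set ys \<subseteq> Y" "set ys \<subseteq> carrier R" "y \<in> Y"
    using strand_familyD(1)[OF V] by auto
  show ?case
    unfolding kos_module.simps kos_diff.simps kos_strand.simps
    by (rule cone_quasi_iso_sub[OF kos_diff_module[OF M s(2)] kos_strand_family[OF M V s(1)]
          kos_strand_family[OF M E s(1)] s(3) Cons.IH[OF s(1)]])
qed

definition exact_at :: "('r, 'm, 'q) module_scheme \<Rightarrow> ('m \<Rightarrow> 'm) \<Rightarrow> (int \<Rightarrow> int \<Rightarrow> 'm set) \<Rightarrow> int \<Rightarrow> int \<Rightarrow> bool"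
  where "exact_at M D V i \<mu> \<longleftrightarrow> (\<forall>z\<in>V i \<mu>. D z = \<zero>\<^bsub>M\<^esub> \<longrightarrow> (\<exists>w\<in>V (i - 1) \<mu>. D w = z))"

lemma quasi_iso_sub_exact_at:
  assumes M: "diff_module R M D" and V: "strand_family R M D Y V"
    and q: "quasi_iso_sub M D E V" and E: "exact_at M D E i \<mu>"
  shows "exact_at M D V i \<mu>"
  unfolding exact_at_def
proof (intro ballI impI)
  interpret diff_module R M D by fact
  note VD = strand_familyD[OF V]
  fix z assume "z \<in> V i \<mu>" "D z = \<zero>\<^bsub>M\<^esub>"
  then obtain e w where e: "e \<in> E i \<mu>" "w \<in> V (i - 1) \<mu>" "D e = \<zero>\<^bsub>M\<^esub>" "z = e \<oplus>\<^bsub>M\<^esub> D w"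
    using q unfolding quasi_iso_sub_def by blast
  then obtain v where v: "v \<in> E (i - 1) \<mu>" "D v = e"
    using E unfolding exact_at_def by blast
  have v': "v \<in> V (i - 1) \<mu>" using v q unfolding quasi_iso_sub_def by blast
  have "D (v \<oplus>\<^bsub>M\<^esub> w) = z"
    using v e VD(2)[OF v'] VD(2)[OF e(2)] by (simp add: D_add)
  then show "\<exists>w\<in>V (i - 1) \<mu>. D w = z"
    using VD(4)[OF v' e(2)] by blast
qed

subsection \<open>Passing to torsion submodules\<close>

definition tor_strand ::
  "('r, 'p) ring_scheme \<Rightarrow> ('r, 'm, 'q) module_scheme \<Rightarrow> 'r \<Rightarrow> (int \<Rightarrow> int \<Rightarrow> 'm set) \<Rightarrow> int \<Rightarrow> int \<Rightarrow> 'm set"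
  where "tor_strand R M y V i \<mu> = {u \<in> V i \<mu>. \<exists>k::nat. (y [^]\<^bsub>R\<^esub> k) \<odot>\<^bsub>M\<^esub> u = \<zero>\<^bsub>M\<^esub>}"

text \<open>Torsion is taken one element at a time, to match the removal of one cone at a time. The
  order in the list does not affect the result, by \<open>tor_list_iff\<close>.\<close>

primrec tor_list ::
  "('r, 'p) ring_scheme \<Rightarrow> ('r, 'm, 'q) module_scheme \<Rightarrow> 'r list \<Rightarrow> (int \<Rightarrow> int \<Rightarrow> 'm set) \<Rightarrow> int \<Rightarrow> int \<Rightarrow> 'm set"
  where "tor_list R M [] V = V"
| "tor_list R M (z # zs) V = tor_strand R M z (tor_list R M zs V)"

text \<open>Equivalently, \<open>V\<close> maps onto its localisation at \<open>y\<close>.\<close>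

definition divisible_mod_torsion ::
  "('r, 'p) ring_scheme \<Rightarrow> ('r, 'm, 'q) module_scheme \<Rightarrow> 'r \<Rightarrow> (int \<Rightarrow> int \<Rightarrow> 'm set) \<Rightarrow> bool"
  where "divisible_mod_torsion R M y V \<longleftrightarrow> (\<forall>i \<mu>. \<forall>k::nat. \<forall>u\<in>V i (\<mu> + int k).
    \<exists>u'\<in>V i \<mu>. \<exists>l::nat. (y [^]\<^bsub>R\<^esub> l) \<odot>\<^bsub>M\<^esub> (u \<ominus>\<^bsub>M\<^esub> (y [^]\<^bsub>R\<^esub> k) \<odot>\<^bsub>M\<^esub> u') = \<zero>\<^bsub>M\<^esub>)"

lemma (in Module.module) pow_torsion_mono:
  assumes y: "y \<in> carrier R" and x: "x \<in> carrier M"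
    and k: "(y [^]\<^bsub>R\<^esub> (k::nat)) \<odot>\<^bsub>M\<^esub> x = \<zero>\<^bsub>M\<^esub>" and m: "k \<le> m"
  shows "(y [^]\<^bsub>R\<^esub> m) \<odot>\<^bsub>M\<^esub> x = \<zero>\<^bsub>M\<^esub>"
proof -
  have "y [^]\<^bsub>R\<^esub> m = (y [^]\<^bsub>R\<^esub> (m - k)) \<otimes>\<^bsub>R\<^esub> (y [^]\<^bsub>R\<^esub> k)"
    using R.nat_pow_mult[OF y, of "m - k" k] m by simp
  then show ?thesis
    using y x k by (simp add: smult_assoc1)
qed

lemma (in Module.module) leaf_module_minus:
  "a \<in> carrier M \<Longrightarrow> b \<in> carrier M \<Longrightarrow> Leaf a \<ominus>\<^bsub>leaf_module M\<^esub> Leaf b = Leaf (a \<ominus>\<^bsub>M\<^esub> b)"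
  by (simp add: a_minus_def leaf_module_neg)

lemma node_module_minus:
  assumes "Module.module R N" "a \<in> carrier N" "b \<in> carrier N" "c \<in> carrier N" "d \<in> carrier N"
  shows "Node a b \<ominus>\<^bsub>node_module N\<^esub> Node c d = Node (a \<ominus>\<^bsub>N\<^esub> c) (b \<ominus>\<^bsub>N\<^esub> d)"
  using assms node_module_neg[OF assms(1,4,5)]
  by (simp add: a_minus_def)

lemma kos_module_module:
  assumes "Module.module R M"
  shows "Module.module R (kos_module M ys)"
  by (induction ys) (use assms in \<open>auto intro: node_module module.leaf_module\<close>)

lemma kos_strand_carrier:
  assumes "\<And>i \<mu>. V i \<mu> \<subseteq> carrier M"
  shows "kos_strand V ys i \<mu> \<subseteq> carrier (kos_module M ys)"
proof (induction ys arbitrary: i \<mu>)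
  case (Cons y ys)
  then show ?case unfolding kos_strand.simps cone_strand_def by auto (blast+)
qed (use assms in auto)

text \<open>Scalars act leafwise, so a tree is killed by a power of \<open>y\<close> exactly if each
  of its finitely many leaves is. Torsion with respect to \<open>y\<close> thus commutes with
  forming cones on other elements.\<close>

lemma kos_strand_tor:
  assumes M: "Module.module R M" and V: "\<And>i \<mu>. V i \<mu> \<subseteq> carrier M" and y: "y \<in> carrier R"
  shows "t \<in> kos_strand (tor_strand R M y V) ys i \<mu> \<longleftrightarrow>
    t \<in> kos_strand V ys i \<mu> \<and> (\<exists>k::nat. (y [^]\<^bsub>R\<^esub> k) \<odot>\<^bsub>kos_module M ys\<^esub> t = \<zero>\<^bsub>kos_module M ys\<^esub>)"
proof (induction ys arbitrary: t i \<mu>)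
  case Nil
  then show ?case by (auto simp: tor_strand_def image_iff)
next
  case (Cons z ys)
  interpret N: Module.module R "kos_module M ys" by (rule kos_module_module[OF M])
  note c = kos_strand_carrier[where V = V, OF V]
  show ?case (is "?l \<longleftrightarrow> ?r")
  proof
    assume ?l
    then obtain a b where t: "t = Node a b" "a \<in> kos_strand (tor_strand R M y V) ys i \<mu>"
      "b \<in> kos_strand (tor_strand R M y V) ys (i - 1) (\<mu> + 1)"
      by (auto simp: cone_strand_def)
    then obtain k l :: nat where a: "a \<in> kos_strand V ys i \<mu>" "b \<in> kos_strand V ys (i - 1) (\<mu> + 1)"
      and kl: "(y [^]\<^bsub>R\<^esub> k) \<odot>\<^bsub>kos_module M ys\<^esub> a = \<zero>\<^bsub>kos_module M ys\<^esub>"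
      "(y [^]\<^bsub>R\<^esub> l) \<odot>\<^bsub>kos_module M ys\<^esub> b = \<zero>\<^bsub>kos_module M ys\<^esub>"
      using Cons.IH by blast
    have ac: "a \<in> carrier (kos_module M ys)" "b \<in> carrier (kos_module M ys)"
      using a c by blast+
    have "(y [^]\<^bsub>R\<^esub> (max k l)) \<odot>\<^bsub>kos_module M (z # ys)\<^esub> t = \<zero>\<^bsub>kos_module M (z # ys)\<^esub>"
      using N.pow_torsion_mono[OF y ac(1) kl(1)] N.pow_torsion_mono[OF y ac(2) kl(2)] t(1)
      by simp
    moreover have "t \<in> kos_strand V (z # ys) i \<mu>"
      using t(1) a by (simp add: cone_strand_def)
    ultimately show ?r by blast
  next
    assume ?r
    then obtain a b k where "t = Node a b" "a \<in> kos_strand V ys i \<mu>"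
      "b \<in> kos_strand V ys (i - 1) (\<mu> + 1)"
      "(y [^]\<^bsub>R\<^esub> (k::nat)) \<odot>\<^bsub>kos_module M (z # ys)\<^esub> t = \<zero>\<^bsub>kos_module M (z # ys)\<^esub>"
      by (auto simp: cone_strand_def)
    then show ?l
      using Cons.IH by (auto simp: cone_strand_def)
  qed
qed

text \<open>The condition holds leaf by leaf; the torsion exponents of the two subtrees are replaced
  by their maximum.\<close>

lemma kos_divisible_mod_torsion:
  assumes M: "Module.module R M" and V: "\<And>i \<mu>. V i \<mu> \<subseteq> carrier M" and y: "y \<in> carrier R"
    and d: "divisible_mod_torsion R M y V"
  shows "divisible_mod_torsion R (kos_module M ys) y (kos_strand V ys)"
proof (induction ys)
  case Nil
  interpret M: Module.module R M by fact
  show ?case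
    unfolding divisible_mod_torsion_def
  proof (intro allI ballI)
    fix i \<mu> and k :: nat and u assume "u \<in> kos_strand V [] i (\<mu> + int k)"
    then obtain a where a: "u = Leaf a" "a \<in> V i (\<mu> + int k)" by auto
    then obtain a' and l :: nat where a': "a' \<in> V i \<mu>"
      "(y [^]\<^bsub>R\<^esub> l) \<odot>\<^bsub>M\<^esub> (a \<ominus>\<^bsub>M\<^esub> (y [^]\<^bsub>R\<^esub> k) \<odot>\<^bsub>M\<^esub> a') = \<zero>\<^bsub>M\<^esub>"
      using d unfolding divisible_mod_torsion_def by blast
    have c: "a \<in> carrier M" "a' \<in> carrier M" using a a' V by blast+
    have "(y [^]\<^bsub>R\<^esub> l) \<odot>\<^bsub>leaf_module M\<^esub> (u \<ominus>\<^bsub>leaf_module M\<^esub> (y [^]\<^bsub>R\<^esub> k) \<odot>\<^bsub>leaf_module M\<^esub> Leaf a') = \<zero>\<^bsub>leaf_module M\<^esub>"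
      using a' c y by (simp add: a(1) M.leaf_module_minus)
    then show "\<exists>u'\<in>kos_strand V [] i \<mu>. \<exists>l::nat. (y [^]\<^bsub>R\<^esub> l) \<odot>\<^bsub>kos_module M []\<^esub>
        (u \<ominus>\<^bsub>kos_module M []\<^esub> (y [^]\<^bsub>R\<^esub> k) \<odot>\<^bsub>kos_module M []\<^esub> u') = \<zero>\<^bsub>kos_module M []\<^esub>"
      using a'(1) unfolding kos_module.simps kos_strand.simps by blast
  qed
next
  case (Cons z ys)
  let ?N = "kos_module M ys"
  interpret N: Module.module R ?N by (rule kos_module_module[OF M])
  have c: "\<And>i \<mu> a. a \<in> kos_strand V ys i \<mu> \<Longrightarrow> a \<in> carrier ?N"
    using kos_strand_carrier[where V = V, OF V] by blast
  show ?case
    unfolding divisible_mod_torsion_def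
  proof (intro allI ballI)
    fix i \<mu> and k :: nat and u assume "u \<in> kos_strand V (z # ys) i (\<mu> + int k)"
    then obtain a b where u: "u = Node a b" "a \<in> kos_strand V ys i (\<mu> + int k)"
      "b \<in> kos_strand V ys (i - 1) ((\<mu> + 1) + int k)"
      by (auto simp: cone_strand_def algebra_simps)
    obtain a' and l :: nat where a': "a' \<in> kos_strand V ys i \<mu>"
      "(y [^]\<^bsub>R\<^esub> l) \<odot>\<^bsub>?N\<^esub> (a \<ominus>\<^bsub>?N\<^esub> (y [^]\<^bsub>R\<^esub> k) \<odot>\<^bsub>?N\<^esub> a') = \<zero>\<^bsub>?N\<^esub>"
      using Cons.IH u(2) unfolding divisible_mod_torsion_def by blast
    obtain b' and m :: nat where b': "b' \<in> kos_strand V ys (i - 1) (\<mu> + 1)"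
      "(y [^]\<^bsub>R\<^esub> m) \<odot>\<^bsub>?N\<^esub> (b \<ominus>\<^bsub>?N\<^esub> (y [^]\<^bsub>R\<^esub> k) \<odot>\<^bsub>?N\<^esub> b') = \<zero>\<^bsub>?N\<^esub>"
      using Cons.IH u(3) unfolding divisible_mod_torsion_def by blast
    note cc = c[OF u(2)] c[OF u(3)] c[OF a'(1)] c[OF b'(1)]
    have "a \<ominus>\<^bsub>?N\<^esub> (y [^]\<^bsub>R\<^esub> k) \<odot>\<^bsub>?N\<^esub> a' \<in> carrier ?N" "b \<ominus>\<^bsub>?N\<^esub> (y [^]\<^bsub>R\<^esub> k) \<odot>\<^bsub>?N\<^esub> b' \<in> carrier ?N"
      using cc y by simp_all
    note N.pow_torsion_mono[OF y this(1) a'(2), of "max l m"]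
      N.pow_torsion_mono[OF y this(2) b'(2), of "max l m"]
    then have "(y [^]\<^bsub>R\<^esub> (max l m)) \<odot>\<^bsub>node_module ?N\<^esub>
        (u \<ominus>\<^bsub>node_module ?N\<^esub> (y [^]\<^bsub>R\<^esub> k) \<odot>\<^bsub>node_module ?N\<^esub> Node a' b') = \<zero>\<^bsub>node_module ?N\<^esub>"
      using cc y by (simp add: u(1) node_module_minus[OF N.module_axioms])
    moreover have "Node a' b' \<in> kos_strand V (z # ys) i \<mu>"
      using a' b' by (simp add: cone_strand_def)
    ultimately show "\<exists>u'\<in>kos_strand V (z # ys) i \<mu>. \<exists>l::nat. (y [^]\<^bsub>R\<^esub> l) \<odot>\<^bsub>kos_module M (z # ys)\<^esub>
        (u \<ominus>\<^bsub>kos_module M (z # ys)\<^esub> (y [^]\<^bsub>R\<^esub> k) \<odot>\<^bsub>kos_module M (z # ys)\<^esub> u') = \<zero>\<^bsub>kos_module M (z # ys)\<^esub>"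
      unfolding kos_module.simps by blast
  qed
qed

text \<open>Exactness of the cone of \<open>y\<close> passes to the cone of \<open>y^k\<close>,
  which is filtered by \<open>k\<close> shifted copies of the former. The copies sit in the internal
  degrees from \<open>\<mu>\<close> to \<open>\<mu> + k - 1\<close>, which is why exactness is
  assumed on a whole half-line. The cycle \<open>(a, b)\<close> becomes the boundary of
  \<open>(a', -c)\<close>.\<close>

lemma cone_exact_pow:
  assumes N: "diff_module R N D" and V: "strand_family R N D Y V" and y: "y \<in> Y"
    and ex: "\<And>\<mu>. \<mu> \<ge> \<mu>0 \<Longrightarrow> exact_at (node_module N) (cone_diff N D y) (cone_strand V) i \<mu>"
    and \<mu>: "\<mu> \<ge> \<mu>0" and a: "a \<in> V i \<mu>" "D a = \<zero>\<^bsub>N\<^esub>" and b: "b \<in> V (i - 1) (\<mu> + int k)"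
    and ab: "(y [^]\<^bsub>R\<^esub> k) \<odot>\<^bsub>N\<^esub> a = D b"
  shows "\<exists>a'\<in>V (i - 1) \<mu>. \<exists>c\<in>V (i - 1 - 1) (\<mu> + int k). D a' = a \<and> b = (y [^]\<^bsub>R\<^esub> k) \<odot>\<^bsub>N\<^esub> a' \<oplus>\<^bsub>N\<^esub> D c"
  using \<mu> a b ab
proof (induction k arbitrary: \<mu> a b)
  interpret diff_module R N D by fact
  note VD = strand_familyD[OF V]
  case 0
  note c = VD(2)[OF 0(2)] VD(2)[OF 0(4)]
  have "D b = a" "b = (y [^]\<^bsub>R\<^esub> (0::nat)) \<odot>\<^bsub>N\<^esub> b \<oplus>\<^bsub>N\<^esub> D \<zero>\<^bsub>N\<^esub>"
    using 0 c by simp_all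
  moreover have "b \<in> V (i - 1) \<mu>" using 0 by simp
  moreover have "\<zero>\<^bsub>N\<^esub> \<in> V (i - 1 - 1) (\<mu> + int 0)" using VD(3) .
  ultimately show ?case by blast
next
  interpret diff_module R N D by fact
  note VD = strand_familyD[OF V]
  have yR: "y \<in> carrier R" using y VD(1) by blast
  case (Suc k)
  note c = VD(2)[OF Suc.prems(2)] VD(2)[OF Suc.prems(4)]
  have pow: "(y [^]\<^bsub>R\<^esub> Suc k) \<odot>\<^bsub>N\<^esub> x = (y [^]\<^bsub>R\<^esub> k) \<odot>\<^bsub>N\<^esub> (y \<odot>\<^bsub>N\<^esub> x)" if "x \<in> carrier N" for x
    using that yR by (simp add: smult_assoc1)
  have b: "b \<in> V (i - 1) (\<mu> + 1 + int k)"
    using Suc.prems(4) by (simp add: algebra_simps)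
  have "D (y \<odot>\<^bsub>N\<^esub> a) = \<zero>\<^bsub>N\<^esub>"
    using c yR Suc.prems(3) by (simp add: D_smult)
  moreover have "(y [^]\<^bsub>R\<^esub> k) \<odot>\<^bsub>N\<^esub> (y \<odot>\<^bsub>N\<^esub> a) = D b"
    using Suc.prems(5) pow c by simp
  ultimately obtain a1 b1 where 1: "a1 \<in> V (i - 1) (\<mu> + 1)" "b1 \<in> V (i - 1 - 1) (\<mu> + 1 + int k)"
    "D a1 = y \<odot>\<^bsub>N\<^esub> a" "b = (y [^]\<^bsub>R\<^esub> k) \<odot>\<^bsub>N\<^esub> a1 \<oplus>\<^bsub>N\<^esub> D b1"
    \<comment> \<open>The induction hypothesis is applied to \<open>y a\<close>, one internal degree
      higher and with exponent \<open>k\<close>.\<close>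
    using Suc.IH[of "\<mu> + 1" "y \<odot>\<^bsub>N\<^esub> a" b] Suc.prems(1) VD(7)[OF y Suc.prems(2)] b by auto
  note c = c VD(2)[OF 1(1)] VD(2)[OF 1(2)]
  \<comment> \<open>The primitive \<open>a1\<close> of \<open>y a\<close> turns \<open>a\<close>
    into the first entry of a cycle in the cone of \<open>y\<close> itself, where exactness in
    degree \<open>\<mu>\<close> applies.\<close>
  have "Node a a1 \<in> cone_strand V i \<mu>"
    using Suc.prems(2) 1(1) by (simp add: cone_strand_def)
  moreover have "cone_diff N D y (Node a a1) = \<zero>\<^bsub>node_module N\<^esub>"
    using Suc.prems(3) 1(3) c yR by (simp add: cone_diff_def)
  ultimately obtain w where "w \<in> cone_strand V (i - 1) \<mu>" "cone_diff N D y w = Node a a1"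
    using ex[OF Suc.prems(1)] unfolding exact_at_def by blast
  then obtain a' c' where w: "a' \<in> V (i - 1) \<mu>" "c' \<in> V (i - 1 - 1) (\<mu> + 1)" "D a' = a"
    "a1 = y \<odot>\<^bsub>N\<^esub> a' \<ominus>\<^bsub>N\<^esub> D c'"
    by (auto simp: cone_strand_def cone_diff_def)
  note c = c VD(2)[OF w(1)] VD(2)[OF w(2)]
  have pc: "(y [^]\<^bsub>R\<^esub> j) \<odot>\<^bsub>N\<^esub> x \<in> V j' (\<nu> + int j)" if "x \<in> V j' \<nu>" for x j' \<nu> and j :: nat
    using that
  proof (induction j arbitrary: x \<nu>)
    case 0 then show ?case using VD(2)[OF 0] by simp
  next
    case (Suc j)
    show ?case
      using Suc.IH[OF VD(7)[OF y Suc.prems]] VD(2)[OF Suc.prems] yR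
      by (simp add: smult_assoc1 algebra_simps)
  qed
  let ?d = "b1 \<ominus>\<^bsub>N\<^esub> (y [^]\<^bsub>R\<^esub> k) \<odot>\<^bsub>N\<^esub> c'"
  have "?d \<in> V (i - 1 - 1) (\<mu> + 1 + int k)"
    by (rule strand_family_minus[OF V 1(2) pc[OF w(2)]])
  then have d: "?d \<in> V (i - 1 - 1) (\<mu> + int (Suc k))"
    by (simp add: algebra_simps)
  have "b = ((y [^]\<^bsub>R\<^esub> k) \<odot>\<^bsub>N\<^esub> (y \<odot>\<^bsub>N\<^esub> a') \<ominus>\<^bsub>N\<^esub> (y [^]\<^bsub>R\<^esub> k) \<odot>\<^bsub>N\<^esub> D c') \<oplus>\<^bsub>N\<^esub> D b1"
    unfolding 1(4) w(4) using c yR by (simp add: smult_minus)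
  also have "\<dots> = (y [^]\<^bsub>R\<^esub> Suc k) \<odot>\<^bsub>N\<^esub> a' \<oplus>\<^bsub>N\<^esub> D ?d"
    unfolding pow[OF VD(2)[OF w(1)]] using c yR by (simp add: D_minus D_smult) (simp add: M.minus_eq M.a_ac)
  finally show ?case
    using w(1,3) d by blast
qed

text \<open>A cycle \<open>z\<close> killed by \<open>y^k\<close> gives the cycle
  \<open>(z, 0)\<close> in the cone of \<open>y^k\<close>, hence a primitive \<open>a\<close> for
  which \<open>y^k a\<close> is a coboundary \<open>D u\<close>. Writing \<open>u\<close> as
  \<open>y^k u'\<close> up to torsion, the primitive \<open>a - D u'\<close> is itself
  torsion.\<close>

lemma cone_exact_torsion:
  assumes N: "diff_module R N D" and V: "strand_family R N D Y V" and y: "y \<in> Y"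
    and ex: "\<And>\<mu>. \<mu> \<ge> \<mu>0 \<Longrightarrow> exact_at (node_module N) (cone_diff N D y) (cone_strand V) i \<mu>"
    and dv: "divisible_mod_torsion R N y V"
    and \<mu>: "\<mu> \<ge> \<mu>0" and z: "z \<in> V i \<mu>" "D z = \<zero>\<^bsub>N\<^esub>" "(y [^]\<^bsub>R\<^esub> (k::nat)) \<odot>\<^bsub>N\<^esub> z = \<zero>\<^bsub>N\<^esub>"
  shows "\<exists>w\<in>V (i - 1) \<mu>. D w = z \<and> (\<exists>m::nat. (y [^]\<^bsub>R\<^esub> m) \<odot>\<^bsub>N\<^esub> w = \<zero>\<^bsub>N\<^esub>)"
proof -
  interpret diff_module R N D by fact
  note VD = strand_familyD[OF V]
  have yR: "y \<in> carrier R" using y VD(1) by blast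
  obtain a c where a: "a \<in> V (i - 1) \<mu>" "c \<in> V (i - 1 - 1) (\<mu> + int k)" "D a = z"
    "\<zero>\<^bsub>N\<^esub> = (y [^]\<^bsub>R\<^esub> k) \<odot>\<^bsub>N\<^esub> a \<oplus>\<^bsub>N\<^esub> D c"
    using cone_exact_pow[OF N V y ex \<mu> z(1,2) VD(3), of k] z(3) by auto
  let ?u = "\<ominus>\<^bsub>N\<^esub> c"
  have u: "?u \<in> V (i - 1 - 1) (\<mu> + int k)" using VD(5)[OF a(2)] .
  obtain u' and l :: nat where u': "u' \<in> V (i - 1 - 1) \<mu>"
    "(y [^]\<^bsub>R\<^esub> l) \<odot>\<^bsub>N\<^esub> (?u \<ominus>\<^bsub>N\<^esub> (y [^]\<^bsub>R\<^esub> k) \<odot>\<^bsub>N\<^esub> u') = \<zero>\<^bsub>N\<^esub>"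
    using dv u unfolding divisible_mod_torsion_def by blast
  note cc = VD(2)[OF a(1)] VD(2)[OF a(2)] VD(2)[OF u'(1)]
  have Du: "D ?u = (y [^]\<^bsub>R\<^esub> k) \<odot>\<^bsub>N\<^esub> a"
    using a(4) cc yR by (simp add: D_neg) (metis M.minus_equality M.a_comm D_closed smult_closed R.nat_pow_closed)
  let ?w = "a \<ominus>\<^bsub>N\<^esub> D u'"
  have "?w \<in> V (i - 1) \<mu>"
    by (rule strand_family_minus[OF V a(1) VD(8)[OF u'(1)]])
  moreover have "D ?w = z"
    using cc a(3) by (auto simp: D_minus)
  \<comment> \<open>Multiplication by \<open>y^k\<close> turns the new primitive into
    \<open>D (u - y^k u')\<close>, and \<open>y^l\<close> kills the argument of
    \<open>D\<close>.\<close>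
  moreover have "(y [^]\<^bsub>R\<^esub> (l + k)) \<odot>\<^bsub>N\<^esub> ?w = \<zero>\<^bsub>N\<^esub>"
  proof -
    have "(y [^]\<^bsub>R\<^esub> (l + k)) \<odot>\<^bsub>N\<^esub> ?w = (y [^]\<^bsub>R\<^esub> l) \<odot>\<^bsub>N\<^esub> ((y [^]\<^bsub>R\<^esub> k) \<odot>\<^bsub>N\<^esub> ?w)"
      using cc yR by (simp add: R.nat_pow_mult[symmetric] smult_assoc1)
    also have "(y [^]\<^bsub>R\<^esub> k) \<odot>\<^bsub>N\<^esub> ?w = D (?u \<ominus>\<^bsub>N\<^esub> (y [^]\<^bsub>R\<^esub> k) \<odot>\<^bsub>N\<^esub> u')"
      using cc yR Du by (simp add: smult_minus D_minus D_smult)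
    also have "(y [^]\<^bsub>R\<^esub> l) \<odot>\<^bsub>N\<^esub> \<dots> = D ((y [^]\<^bsub>R\<^esub> l) \<odot>\<^bsub>N\<^esub> (?u \<ominus>\<^bsub>N\<^esub> (y [^]\<^bsub>R\<^esub> k) \<odot>\<^bsub>N\<^esub> u'))"
      using cc yR by (simp add: D_smult)
    finally show ?thesis using u'(2) by simp
  qed
  ultimately show ?thesis by blast
qed

lemma tor_strand_family:
  assumes M: "diff_module R M D" and V: "strand_family R M D Y V" and y: "y \<in> carrier R"
  shows "strand_family R M D Y (tor_strand R M y V)"
proof -
  interpret diff_module R M D by fact
  note VD = strand_familyD[OF V]
  show ?thesis
    unfolding strand_family_def
  proof (intro conjI allI ballI)
    fix i \<mu>
    show "Y \<subseteq> carrier R" "tor_strand R M y V i \<mu> \<subseteq> carrier M" "\<zero>\<^bsub>M\<^esub> \<in> tor_strand R M y V i \<mu>"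
      using VD(1,2,3) y unfolding tor_strand_def by auto
    fix a assume "a \<in> tor_strand R M y V i \<mu>"
    then obtain k :: nat where a: "a \<in> V i \<mu>" "(y [^]\<^bsub>R\<^esub> k) \<odot>\<^bsub>M\<^esub> a = \<zero>\<^bsub>M\<^esub>"
      unfolding tor_strand_def by blast
    note c = VD(2)[OF a(1)]
    have "(y [^]\<^bsub>R\<^esub> k) \<odot>\<^bsub>M\<^esub> (\<ominus>\<^bsub>M\<^esub> a) = \<zero>\<^bsub>M\<^esub>"
      using c y a(2) by (simp add: smult_r_minus)
    then show "\<ominus>\<^bsub>M\<^esub> a \<in> tor_strand R M y V i \<mu>"
      using VD(5)[OF a(1)] unfolding tor_strand_def by blast
    have "(y [^]\<^bsub>R\<^esub> k) \<odot>\<^bsub>M\<^esub> D a = \<zero>\<^bsub>M\<^esub>"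
      using c y a(2) D_smult[of "y [^]\<^bsub>R\<^esub> k" a] by simp
    then show "D a \<in> tor_strand R M y V (i + 1) \<mu>"
      using VD(6)[OF a(1)] unfolding tor_strand_def by blast
    fix b assume "b \<in> tor_strand R M y V i \<mu>"
    then obtain l :: nat where b: "b \<in> V i \<mu>" "(y [^]\<^bsub>R\<^esub> l) \<odot>\<^bsub>M\<^esub> b = \<zero>\<^bsub>M\<^esub>"
      unfolding tor_strand_def by blast
    note c = c VD(2)[OF b(1)]
    have "(y [^]\<^bsub>R\<^esub> (max k l)) \<odot>\<^bsub>M\<^esub> (a \<oplus>\<^bsub>M\<^esub> b) = \<zero>\<^bsub>M\<^esub>"
      using c y pow_torsion_mono[OF y c(1) a(2), of "max k l"] pow_torsion_mono[OF y c(2) b(2), of "max k l"]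
      by (simp add: smult_r_distr)
    then show "a \<oplus>\<^bsub>M\<^esub> b \<in> tor_strand R M y V i \<mu>"
      using VD(4)[OF a(1) b(1)] unfolding tor_strand_def by blast
  next
    fix i \<mu> z a assume z: "z \<in> Y" and "a \<in> tor_strand R M y V i \<mu>"
    then obtain k :: nat where a: "a \<in> V i \<mu>" "(y [^]\<^bsub>R\<^esub> k) \<odot>\<^bsub>M\<^esub> a = \<zero>\<^bsub>M\<^esub>"
      unfolding tor_strand_def by blast
    note c = VD(2)[OF a(1)]
    have zR: "z \<in> carrier R" using z VD(1) by blast
    have "(y [^]\<^bsub>R\<^esub> k) \<odot>\<^bsub>M\<^esub> (z \<odot>\<^bsub>M\<^esub> a) = z \<odot>\<^bsub>M\<^esub> ((y [^]\<^bsub>R\<^esub> k) \<odot>\<^bsub>M\<^esub> a)"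
      using smult_assoc1[OF _ zR c] smult_assoc1[OF zR _ c] R.m_comm[OF zR] y by (metis R.nat_pow_closed)
    then have "(y [^]\<^bsub>R\<^esub> k) \<odot>\<^bsub>M\<^esub> (z \<odot>\<^bsub>M\<^esub> a) = \<zero>\<^bsub>M\<^esub>"
      using a(2) zR by simp
    then show "z \<odot>\<^bsub>M\<^esub> a \<in> tor_strand R M y V i (\<mu> + 1)"
      using VD(7)[OF z a(1)] unfolding tor_strand_def by blast
  qed
qed

lemma tor_list_family:
  assumes M: "diff_module R M D" and V: "strand_family R M D Y V" and zs: "set zs \<subseteq> carrier R"
  shows "strand_family R M D Y (tor_list R M zs V)"
  using zs by (induction zs) (auto intro: tor_strand_family[OF M] V)

lemma tor_list_iff:
  "u \<in> tor_list R M zs V i \<mu> \<longleftrightarrow>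
    u \<in> V i \<mu> \<and> (\<forall>z\<in>set zs. \<exists>k::nat. (z [^]\<^bsub>R\<^esub> k) \<odot>\<^bsub>M\<^esub> u = \<zero>\<^bsub>M\<^esub>)"
  by (induction zs) (auto simp: tor_strand_def)

text \<open>The hypothesis and the claim are the two ends of one exchange process: \<open>ys\<close>
  lists the cones still present, \<open>zs\<close> the elements whose torsion has been taken.
  Divisibility is required for every list of earlier torsion elements, since it is applied to
  partially torsion complexes. Neither \<open>i\<close> nor \<open>\<mu>0\<close> changes during the
  process.\<close>

theorem exact_at_tor_list:
  assumes M: "diff_module R M D" and V: "strand_family R M D Y V"
    and dv: "\<And>y zs. y \<in> Y \<Longrightarrow> set zs \<subseteq> Y \<Longrightarrow> divisible_mod_torsion R M y (tor_list R M zs V)"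
    and "set ys \<subseteq> Y" "set zs \<subseteq> Y"
    and "\<And>\<mu>. \<mu> \<ge> \<mu>0 \<Longrightarrow>
      exact_at (kos_module M ys) (kos_diff M D ys) (kos_strand (tor_list R M zs V) ys) i \<mu>"
    and \<mu>: "\<mu> \<ge> \<mu>0"
  shows "exact_at M D (tor_list R M (rev ys @ zs) V) i \<mu>"
  using assms(4-6)
proof (induction ys arbitrary: zs)
  case Nil
  from Nil.prems(3)[OF \<mu>] show ?case
    unfolding exact_at_def kos_module.simps kos_diff.simps kos_strand.simps by auto
next
  case (Cons y ys)
  have YR: "Y \<subseteq> carrier R" using strand_familyD(1)[OF V] .
  have s: "set ys \<subseteq> Y" "set (y # zs) \<subseteq> Y" "y \<in> Y" "set ys \<subseteq> carrier R" "set zs \<subseteq> carrier R" "y \<in> carrier R"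
    using Cons.prems YR by auto
  let ?W = "tor_list R M zs V"
  have W: "strand_family R M D Y ?W"
    by (rule tor_list_family[OF M V s(5)])
  have Wc: "\<And>i \<mu>. ?W i \<mu> \<subseteq> carrier M"
    using strand_familyD(2)[OF W] by blast
  have Mm: "Module.module R M" using M by (simp add: diff_module_def)
  note N = kos_diff_module[OF M s(4)] and NW = kos_strand_family[OF M W s(1)]
  \<comment> \<open>The outermost cone, that of \<open>y\<close>, is given up. The complex below it
    is the Koszul complex on \<open>ys\<close>, whose \<open>y\<close>-torsion consists of the trees
    with \<open>y\<close>-torsion leaves.\<close>
  have "exact_at (kos_module M ys) (kos_diff M D ys) (kos_strand (tor_list R M (y # zs) V) ys) i \<mu>"
    if \<mu>: "\<mu> \<ge> \<mu>0" for \<mu>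
    unfolding exact_at_def
  proof (intro ballI impI)
    fix z assume "z \<in> kos_strand (tor_list R M (y # zs) V) ys i \<mu>"
      and z: "kos_diff M D ys z = \<zero>\<^bsub>kos_module M ys\<^esub>"
    then obtain k :: nat where k: "z \<in> kos_strand ?W ys i \<mu>"
      "(y [^]\<^bsub>R\<^esub> k) \<odot>\<^bsub>kos_module M ys\<^esub> z = \<zero>\<^bsub>kos_module M ys\<^esub>"
      using kos_strand_tor[where V = ?W, OF Mm Wc s(6)] by auto
    have "\<exists>w\<in>kos_strand ?W ys (i - 1) \<mu>. kos_diff M D ys w = z \<and>
        (\<exists>m::nat. (y [^]\<^bsub>R\<^esub> m) \<odot>\<^bsub>kos_module M ys\<^esub> w = \<zero>\<^bsub>kos_module M ys\<^esub>)"
      using cone_exact_torsion[OF N NW s(3) Cons.prems(3)[unfolded kos_module.simps kos_diff.simps kos_strand.simps]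
          kos_divisible_mod_torsion[where V = ?W, OF Mm Wc s(6) dv[OF s(3)]] \<mu> k(1) z k(2)] s(2)
      by simp
    then show "\<exists>w\<in>kos_strand (tor_list R M (y # zs) V) ys (i - 1) \<mu>. kos_diff M D ys w = z"
      unfolding tor_list.simps using kos_strand_tor[where V = ?W, OF Mm Wc s(6)] by blast
  qed
  from Cons.IH[OF s(1,2) this] show ?case by simp
qed

subsection \<open>Koszul homology of a Noetherian module\<close>

text \<open>Multiplication by \<open>y\<close> is homotopic to zero through an
  \<open>R\<close>-linear homotopy, so that \<open>y\<close> annihilates the cohomology. The
  homotopy lives on the whole module, without reference to degrees.\<close>

definition null_homotopic ::
  "('r, 'p) ring_scheme \<Rightarrow> ('r, 'm, 'q) module_scheme \<Rightarrow> ('m \<Rightarrow> 'm) \<Rightarrow> 'r \<Rightarrow> bool"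
  where "null_homotopic R N D y \<longleftrightarrow> (\<exists>h. (\<forall>t\<in>carrier N. h t \<in> carrier N) \<and>
    (\<forall>s\<in>carrier N. \<forall>t\<in>carrier N. h (s \<oplus>\<^bsub>N\<^esub> t) = h s \<oplus>\<^bsub>N\<^esub> h t) \<and>
    (\<forall>r\<in>carrier R. \<forall>t\<in>carrier N. h (r \<odot>\<^bsub>N\<^esub> t) = r \<odot>\<^bsub>N\<^esub> h t) \<and>
    (\<forall>t\<in>carrier N. D (h t) \<oplus>\<^bsub>N\<^esub> h (D t) = y \<odot>\<^bsub>N\<^esub> t))"

text \<open>The homotopy moves the second entry to the first place: \<open>(a, b)\<close> goes to
  \<open>(b, 0)\<close>.\<close>

lemma cone_null_homotopic_self:
  assumes "diff_module R N D" "y \<in> carrier R"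
  shows "null_homotopic R (node_module N) (cone_diff N D y) y"
proof -
  interpret diff_module R N D by fact
  show ?thesis
    unfolding null_homotopic_def
  proof (intro exI[of _ "\<lambda>t. Node (rgt t) \<zero>\<^bsub>N\<^esub>"] conjI ballI)
    fix t assume "t \<in> carrier (node_module N)"
    then obtain a b where t: "t = Node a b" "a \<in> carrier N" "b \<in> carrier N" by auto
    show "cone_diff N D y (Node (rgt t) \<zero>\<^bsub>N\<^esub>) \<oplus>\<^bsub>node_module N\<^esub> Node (rgt (cone_diff N D y t)) \<zero>\<^bsub>N\<^esub> =
        y \<odot>\<^bsub>node_module N\<^esub> t"
      using t assms(2) by (simp add: cone_diff_def M.add_minus_cancel)
  qed auto
qed

text \<open>An existing homotopy \<open>h\<close> extends to the cone by \<open>(a, b)\<close> to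
  \<open>(h a, -h b)\<close>. The sign reflects that \<open>D\<close> acts on the second entry with
  a minus sign, and it cancels the two terms \<open>y h a\<close>.\<close>

lemma cone_null_homotopic:
  assumes "diff_module R N D" "y \<in> carrier R" and z: "z \<in> carrier R" "null_homotopic R N D z"
  shows "null_homotopic R (node_module N) (cone_diff N D y) z"
proof -
  interpret diff_module R N D by fact
  obtain h where h: "\<And>t. t \<in> carrier N \<Longrightarrow> h t \<in> carrier N"
    "\<And>s t. s \<in> carrier N \<Longrightarrow> t \<in> carrier N \<Longrightarrow> h (s \<oplus>\<^bsub>N\<^esub> t) = h s \<oplus>\<^bsub>N\<^esub> h t"
    "\<And>r t. r \<in> carrier R \<Longrightarrow> t \<in> carrier N \<Longrightarrow> h (r \<odot>\<^bsub>N\<^esub> t) = r \<odot>\<^bsub>N\<^esub> h t"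
    "\<And>t. t \<in> carrier N \<Longrightarrow> D (h t) \<oplus>\<^bsub>N\<^esub> h (D t) = z \<odot>\<^bsub>N\<^esub> t"
    using z(2) unfolding null_homotopic_def by blast
  have h_neg: "h (\<ominus>\<^bsub>N\<^esub> t) = \<ominus>\<^bsub>N\<^esub> h t" if "t \<in> carrier N" for t
    using h(3)[of "\<ominus>\<^bsub>R\<^esub> \<one>\<^bsub>R\<^esub>" t] that h(1) smult_l_minus[of "\<one>\<^bsub>R\<^esub>"] by simp
  show ?thesis
    unfolding null_homotopic_def
  proof (intro exI[of _ "\<lambda>t. Node (h (lft t)) (\<ominus>\<^bsub>N\<^esub> h (rgt t))"] conjI ballI)
    fix t assume "t \<in> carrier (node_module N)"
    then obtain a b where t: "t = Node a b" "a \<in> carrier N" "b \<in> carrier N" by auto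
    show "Node (h (lft t)) (\<ominus>\<^bsub>N\<^esub> h (rgt t)) \<in> carrier (node_module N)"
      using t h(1) by simp
    have "(y \<odot>\<^bsub>N\<^esub> h a \<ominus>\<^bsub>N\<^esub> D (\<ominus>\<^bsub>N\<^esub> h b)) \<oplus>\<^bsub>N\<^esub> (\<ominus>\<^bsub>N\<^esub> h (y \<odot>\<^bsub>N\<^esub> a \<ominus>\<^bsub>N\<^esub> D b)) = D (h b) \<oplus>\<^bsub>N\<^esub> h (D b)"
    proof -
      have "h (y \<odot>\<^bsub>N\<^esub> a \<ominus>\<^bsub>N\<^esub> D b) = y \<odot>\<^bsub>N\<^esub> h a \<ominus>\<^bsub>N\<^esub> h (D b)"
        using t assms(2) h(1,2,3) h_neg by (simp add: M.minus_eq)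
      moreover have "(p \<ominus>\<^bsub>N\<^esub> (\<ominus>\<^bsub>N\<^esub> q)) \<oplus>\<^bsub>N\<^esub> (\<ominus>\<^bsub>N\<^esub> (p \<ominus>\<^bsub>N\<^esub> s)) = q \<oplus>\<^bsub>N\<^esub> s"
        if "p \<in> carrier N" "q \<in> carrier N" "s \<in> carrier N" for p q s
      proof -
        have "(p \<ominus>\<^bsub>N\<^esub> (\<ominus>\<^bsub>N\<^esub> q)) \<oplus>\<^bsub>N\<^esub> (\<ominus>\<^bsub>N\<^esub> (p \<ominus>\<^bsub>N\<^esub> s)) = (q \<oplus>\<^bsub>N\<^esub> s) \<oplus>\<^bsub>N\<^esub> (p \<ominus>\<^bsub>N\<^esub> p)"
          using that unfolding M.minus_eq by (simp add: M.minus_add M.a_ac del: M.minus_self)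
        then show ?thesis using that by simp
      qed
      ultimately show ?thesis
        using t assms(2) h(1) by (simp add: D_neg)
    qed
    then show "cone_diff N D y (Node (h (lft t)) (\<ominus>\<^bsub>N\<^esub> h (rgt t))) \<oplus>\<^bsub>node_module N\<^esub>
        Node (h (lft (cone_diff N D y t))) (\<ominus>\<^bsub>N\<^esub> h (rgt (cone_diff N D y t))) = z \<odot>\<^bsub>node_module N\<^esub> t"
      using t h(1,4) by (simp add: cone_diff_def)
    fix r assume r: "r \<in> carrier R"
    show "Node (h (lft (r \<odot>\<^bsub>node_module N\<^esub> t))) (\<ominus>\<^bsub>N\<^esub> h (rgt (r \<odot>\<^bsub>node_module N\<^esub> t))) =
        r \<odot>\<^bsub>node_module N\<^esub> Node (h (lft t)) (\<ominus>\<^bsub>N\<^esub> h (rgt t))"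
      using t r h(1,3) by (simp add: smult_r_minus)
  next
    fix s t assume "s \<in> carrier (node_module N)" "t \<in> carrier (node_module N)"
    then obtain a b c d where t: "t = Node a b" "s = Node c d"
      "a \<in> carrier N" "b \<in> carrier N" "c \<in> carrier N" "d \<in> carrier N" by auto
    show "Node (h (lft (s \<oplus>\<^bsub>node_module N\<^esub> t))) (\<ominus>\<^bsub>N\<^esub> h (rgt (s \<oplus>\<^bsub>node_module N\<^esub> t))) =
        Node (h (lft s)) (\<ominus>\<^bsub>N\<^esub> h (rgt s)) \<oplus>\<^bsub>node_module N\<^esub> Node (h (lft t)) (\<ominus>\<^bsub>N\<^esub> h (rgt t))"
      using t h(1,2) by (simp add: M.minus_add)
  qed
qed

lemma kos_null_homotopic:
  assumes M: "diff_module R M D" and ys: "set ys \<subseteq> carrier R" and y: "y \<in> set ys"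
  shows "null_homotopic R (kos_module M ys) (kos_diff M D ys) y"
  using ys y
proof (induction ys)
  case (Cons z ys)
  then have N: "diff_module R (kos_module M ys) (kos_diff M D ys)"
    using kos_diff_module[OF M] by simp
  show ?case
    unfolding kos_module.simps kos_diff.simps
    using Cons cone_null_homotopic_self[OF N] cone_null_homotopic[OF N] by auto
qed simp

lemma null_homotopic_boundary:
  assumes "diff_module R N D" "null_homotopic R N D y" "z \<in> carrier N" "D z = \<zero>\<^bsub>N\<^esub>"
  shows "y \<odot>\<^bsub>N\<^esub> z \<in> D ` carrier N"
proof -
  interpret diff_module R N D by fact
  obtain h where h: "\<And>t. t \<in> carrier N \<Longrightarrow> h t \<in> carrier N"
    "\<And>r t. r \<in> carrier R \<Longrightarrow> t \<in> carrier N \<Longrightarrow> h (r \<odot>\<^bsub>N\<^esub> t) = r \<odot>\<^bsub>N\<^esub> h t"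
    "\<And>t. t \<in> carrier N \<Longrightarrow> D (h t) \<oplus>\<^bsub>N\<^esub> h (D t) = y \<odot>\<^bsub>N\<^esub> t"
    using assms(2) unfolding null_homotopic_def by blast
  have "h \<zero>\<^bsub>N\<^esub> = \<zero>\<^bsub>N\<^esub>"
    using h(2)[of "\<zero>\<^bsub>R\<^esub>" "\<zero>\<^bsub>N\<^esub>"] h(1) by simp
  then have "D (h z) = y \<odot>\<^bsub>N\<^esub> z"
    using h(3)[OF assms(3)] assms(3,4) h(1) by simp
  then show ?thesis using h(1)[OF assms(3)] by (metis imageI)
qed

text \<open>A cone is, as a module, the sum of two copies of the module below it.\<close>

lemma acc_on_kos_module:
  assumes M: "Module.module R M" and acc: "acc_on R M (carrier M)"
  shows "acc_on R (kos_module M ys) (carrier (kos_module M ys))"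
proof (induction ys)
  case Nil
  interpret Module.module R M by fact
  have "acc_on R (leaf_module M) (Leaf ` carrier M)"
    by (rule acc_on_image(2)[OF M leaf_module carrier_is_submodule acc]) auto
  then show ?case by simp
next
  case (Cons y ys)
  let ?N = "kos_module M ys"
  interpret N: Module.module R ?N by (rule kos_module_module[OF M])
  interpret N2: Module.module R "node_module ?N" by (rule node_module[OF N.module_axioms])
  let ?f = "\<lambda>a. Node a \<zero>\<^bsub>?N\<^esub>" and ?g = "\<lambda>a. Node \<zero>\<^bsub>?N\<^esub> a"
  have f: "submodule (?f ` carrier ?N) R (node_module ?N)" "acc_on R (node_module ?N) (?f ` carrier ?N)"
    by (rule acc_on_image[OF N.module_axioms N2.module_axioms N.carrier_is_submodule Cons.IH]; auto)+
  have g: "submodule (?g ` carrier ?N) R (node_module ?N)" "acc_on R (node_module ?N) (?g ` carrier ?N)"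
    by (rule acc_on_image[OF N.module_axioms N2.module_axioms N.carrier_is_submodule Cons.IH]; auto)+
  have "carrier (node_module ?N) \<subseteq>
      {p \<oplus>\<^bsub>node_module ?N\<^esub> q | p q. p \<in> ?f ` carrier ?N \<and> q \<in> ?g ` carrier ?N}"
  proof
    fix t assume "t \<in> carrier (node_module ?N)"
    then obtain a b where t: "t = Node a b" "a \<in> carrier ?N" "b \<in> carrier ?N" by auto
    then have "t = ?f a \<oplus>\<^bsub>node_module ?N\<^esub> ?g b" by simp
    then show "t \<in> {p \<oplus>\<^bsub>node_module ?N\<^esub> q | p q. p \<in> ?f ` carrier ?N \<and> q \<in> ?g ` carrier ?N}"
      using t by blast
  qed
  then show ?case
    unfolding kos_module.simps using acc_on_mono[OF N2.acc_on_add[OF f g]] by blast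
qed

section \<open>Homogeneous projections on iterated cones\<close>

primrec kos_proj :: "(int \<Rightarrow> int \<Rightarrow> 'm \<Rightarrow> 'm) \<Rightarrow> 'r list \<Rightarrow> int \<Rightarrow> int \<Rightarrow> 'm tree \<Rightarrow> 'm tree" where
  "kos_proj p [] = (\<lambda>i \<mu> t. Leaf (p i \<mu> (leaf_val t)))"
| "kos_proj p (y # ys) =
    (\<lambda>i \<mu> t. Node (kos_proj p ys i \<mu> (lft t)) (kos_proj p ys (i - 1) (\<mu> + 1) (rgt t)))"

lemma kos_proj_strand:
  assumes "\<And>i \<mu> x. x \<in> carrier M \<Longrightarrow> p i \<mu> x \<in> V i \<mu>" "t \<in> carrier (kos_module M ys)"
  shows "kos_proj p ys i \<mu> t \<in> kos_strand V ys i \<mu>"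
  using assms(2) by (induction ys arbitrary: i \<mu> t) (auto simp: cone_strand_def assms(1))

lemma kos_proj_id:
  assumes "\<And>i \<mu> x. x \<in> V i \<mu> \<Longrightarrow> p i \<mu> x = x" "t \<in> kos_strand V ys i \<mu>"
  shows "kos_proj p ys i \<mu> t = t"
  using assms(2) by (induction ys arbitrary: i \<mu> t) (auto simp: cone_strand_def assms(1))

lemma kos_proj_add:
  assumes "\<And>i \<mu> x y. x \<in> carrier M \<Longrightarrow> y \<in> carrier M \<Longrightarrow> p i \<mu> (x \<oplus>\<^bsub>M\<^esub> y) = p i \<mu> x \<oplus>\<^bsub>M\<^esub> p i \<mu> y"
    and "s \<in> carrier (kos_module M ys)" "t \<in> carrier (kos_module M ys)"
  shows "kos_proj p ys i \<mu> (s \<oplus>\<^bsub>kos_module M ys\<^esub> t) =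
    kos_proj p ys i \<mu> s \<oplus>\<^bsub>kos_module M ys\<^esub> kos_proj p ys i \<mu> t"
  using assms(2,3) by (induction ys arbitrary: i \<mu> s t) (auto simp: assms(1))

lemma kos_proj_shift:
  assumes "\<And>i \<mu> x. x \<in> carrier M \<Longrightarrow> p i (\<mu> + 1) (y \<odot>\<^bsub>M\<^esub> x) = y \<odot>\<^bsub>M\<^esub> p i \<mu> x"
    and "t \<in> carrier (kos_module M ys)"
  shows "kos_proj p ys i (\<mu> + 1) (y \<odot>\<^bsub>kos_module M ys\<^esub> t) = y \<odot>\<^bsub>kos_module M ys\<^esub> kos_proj p ys i \<mu> t"
  using assms(2)
proof (induction ys arbitrary: i \<mu> t)
  case (Cons z ys)
  then obtain a b where t: "t = Node a b" "a \<in> carrier (kos_module M ys)" "b \<in> carrier (kos_module M ys)"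
    by auto
  show ?case
    using Cons.IH[OF t(2), of i \<mu>] Cons.IH[OF t(3), of "i - 1" "\<mu> + 1"] by (simp add: t(1))
qed (auto simp: assms(1))

text \<open>The degrees of the leaves differ from those of the tree, but the factor depends only on
  differences of degrees, and the shifts by \<open>-1\<close> and \<open>1\<close> cancel there. One
  and the same scalar thus acts on all leaves, and the projection of \<open>r t\<close> is again a
  multiple of \<open>t\<close>.\<close>

lemma kos_proj_act:
  assumes "\<And>i \<mu> i' \<mu>' x. x \<in> W i' \<mu>' \<Longrightarrow> p i \<mu> (r \<odot>\<^bsub>M\<^esub> x) = c (i - i') (\<mu> - \<mu>') \<odot>\<^bsub>M\<^esub> x"
    and "t \<in> kos_strand W ys i' \<mu>'"
  shows "kos_proj p ys i \<mu> (r \<odot>\<^bsub>kos_module M ys\<^esub> t) = c (i - i') (\<mu> - \<mu>') \<odot>\<^bsub>kos_module M ys\<^esub> t"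
  using assms(2)
proof (induction ys arbitrary: i \<mu> i' \<mu>' t)
  case (Cons y ys)
  then obtain a b where t: "t = Node a b" "a \<in> kos_strand W ys i' \<mu>'" "b \<in> kos_strand W ys (i' - 1) (\<mu>' + 1)"
    by (auto simp: cone_strand_def)
  show ?case
    using Cons.IH[OF t(2), of i \<mu>] Cons.IH[OF t(3), of "i - 1" "\<mu> + 1"] by (simp add: t(1))
qed (auto simp: assms(1))

text \<open>Over the zero differential the Koszul differential only multiplies by elements of
  \<open>ys\<close>, which raise internal degree by 1. The projections are compatible with that, so
  a primitive of a homogeneous cycle may be replaced by its homogeneous part.\<close>

lemma kos_proj_diff:
  assumes M: "Module.module R M" and ys: "set ys \<subseteq> carrier R"
    and p_car: "\<And>i \<mu> x. x \<in> carrier M \<Longrightarrow> p i \<mu> x \<in> carrier M"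
    and p_add: "\<And>i \<mu> x y. x \<in> carrier M \<Longrightarrow> y \<in> carrier M \<Longrightarrow> p i \<mu> (x \<oplus>\<^bsub>M\<^esub> y) = p i \<mu> x \<oplus>\<^bsub>M\<^esub> p i \<mu> y"
    and p_shift: "\<And>i \<mu> x y. y \<in> set ys \<Longrightarrow> x \<in> carrier M \<Longrightarrow> p i (\<mu> + 1) (y \<odot>\<^bsub>M\<^esub> x) = y \<odot>\<^bsub>M\<^esub> p i \<mu> x"
    and t: "t \<in> carrier (kos_module M ys)"
  shows "kos_proj p ys i \<mu> (kos_diff M (\<lambda>_. \<zero>\<^bsub>M\<^esub>) ys t) = kos_diff M (\<lambda>_. \<zero>\<^bsub>M\<^esub>) ys (kos_proj p ys (i - 1) \<mu> t)"
  using ys p_shift t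
proof (induction ys arbitrary: i \<mu> t)
  interpret M: Module.module R M by fact
  have D0: "diff_module R M (\<lambda>_. \<zero>\<^bsub>M\<^esub>)" by (rule diff_moduleI[OF M]) simp_all
  case Nil
  have "p i \<mu> \<zero>\<^bsub>M\<^esub> \<oplus>\<^bsub>M\<^esub> p i \<mu> \<zero>\<^bsub>M\<^esub> = p i \<mu> \<zero>\<^bsub>M\<^esub>"
    using p_add[of "\<zero>\<^bsub>M\<^esub>" "\<zero>\<^bsub>M\<^esub>" i \<mu>] by simp
  then have "p i \<mu> \<zero>\<^bsub>M\<^esub> = \<zero>\<^bsub>M\<^esub>"
    using p_car[of "\<zero>\<^bsub>M\<^esub>" i \<mu>] M.add.l_cancel_one' by auto
  then show ?case by simp
next
  interpret M: Module.module R M by fact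
  have D0: "diff_module R M (\<lambda>_. \<zero>\<^bsub>M\<^esub>)" by (rule diff_moduleI[OF M]) simp_all
  case (Cons y ys)
  let ?N = "kos_module M ys" and ?D = "kos_diff M (\<lambda>_. \<zero>\<^bsub>M\<^esub>) ys"
  have ys: "set ys \<subseteq> carrier R" "y \<in> carrier R" using Cons.prems(1) by auto
  interpret N: diff_module R ?N ?D by (rule kos_diff_module[OF D0 ys(1)])
  obtain a b where t: "t = Node a b" "a \<in> carrier ?N" "b \<in> carrier ?N"
    using Cons.prems(3) by auto
  have IH: "kos_proj p ys i \<mu> (?D s) = ?D (kos_proj p ys (i - 1) \<mu> s)" if "s \<in> carrier ?N" for i \<mu> s
    by (rule Cons.IH[OF ys(1) _ that]) (use Cons.prems(2) in auto)
  have pc: "kos_proj p ys i \<mu> s \<in> carrier ?N" if "s \<in> carrier ?N" for s i \<mu>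
    using kos_proj_strand[where V = "\<lambda>_ _. carrier M" and p = p, OF p_car that]
      kos_strand_carrier[where V = "\<lambda>_ _. carrier M" and M = M] by blast
  have padd: "kos_proj p ys i \<mu> (s \<oplus>\<^bsub>?N\<^esub> s') = kos_proj p ys i \<mu> s \<oplus>\<^bsub>?N\<^esub> kos_proj p ys i \<mu> s'"
    if "s \<in> carrier ?N" "s' \<in> carrier ?N" for s s' i \<mu>
    by (rule kos_proj_add[OF p_add that])
  have pminus: "kos_proj p ys i \<mu> (s \<ominus>\<^bsub>?N\<^esub> s') = kos_proj p ys i \<mu> s \<ominus>\<^bsub>?N\<^esub> kos_proj p ys i \<mu> s'"
    if s: "s \<in> carrier ?N" "s' \<in> carrier ?N" for s s' i \<mu>
  proof -
    have "kos_proj p ys i \<mu> s = kos_proj p ys i \<mu> (s \<ominus>\<^bsub>?N\<^esub> s') \<oplus>\<^bsub>?N\<^esub> kos_proj p ys i \<mu> s'"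
      using padd[of "s \<ominus>\<^bsub>?N\<^esub> s'" s' i \<mu>] s by (simp add: N.M.add_minus_cancel)
    then show ?thesis using pc s by (simp add: N.M.add_minus_cancel)
  qed
  have psh: "kos_proj p ys i (\<mu> + 1) (y \<odot>\<^bsub>?N\<^esub> s) = y \<odot>\<^bsub>?N\<^esub> kos_proj p ys i \<mu> s" if "s \<in> carrier ?N" for s i \<mu>
    by (rule kos_proj_shift[OF _ that]) (use Cons.prems(2) in auto)
  show ?case
    using t ys pminus[of "y \<odot>\<^bsub>?N\<^esub> a" "?D b"] IH psh[OF t(2), of "i - 1" \<mu>]
    by (simp add: cone_diff_def)
qed

text \<open>The Koszul homology is a finitely generated \<open>R\<close>-module annihilated by \<open>ys\<close>. A coefficient
  that carries a homogeneous generator to a sufficiently high degree lies in the ideal generated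
  by \<open>ys\<close>, whence the homology vanishes there.\<close>

theorem kos_exact_at_large_degree:
  fixes V :: "'n \<Rightarrow> int \<Rightarrow> int \<Rightarrow> 'm set"
  assumes M: "Module.module R M" and acc: "acc_on R M (carrier M)" and ys: "set ys \<subseteq> carrier R"
    and V_car: "\<And>n i \<mu>. V n i \<mu> \<subseteq> carrier M"
    and p_strand: "\<And>n i \<mu> x. x \<in> carrier M \<Longrightarrow> p n i \<mu> x \<in> V n i \<mu>"
    and p_id: "\<And>n i \<mu> x. x \<in> V n i \<mu> \<Longrightarrow> p n i \<mu> x = x"
    and p_add: "\<And>n i \<mu> x y. x \<in> carrier M \<Longrightarrow> y \<in> carrier M \<Longrightarrow> p n i \<mu> (x \<oplus>\<^bsub>M\<^esub> y) = p n i \<mu> x \<oplus>\<^bsub>M\<^esub> p n i \<mu> y"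
    and p_shift: "\<And>n i \<mu> x y. y \<in> set ys \<Longrightarrow> x \<in> carrier M \<Longrightarrow> p n i (\<mu> + 1) (y \<odot>\<^bsub>M\<^esub> x) = y \<odot>\<^bsub>M\<^esub> p n i \<mu> x"
    and p_act: "\<And>n n' i \<mu> i' \<mu>' r x. r \<in> carrier R \<Longrightarrow> x \<in> V n' i' \<mu>' \<Longrightarrow>
      p n i \<mu> (r \<odot>\<^bsub>M\<^esub> x) = c n n' r (i - i') (\<mu> - \<mu>') \<odot>\<^bsub>M\<^esub> x"
    and c_ideal: "\<And>n n' r i \<mu>. r \<in> carrier R \<Longrightarrow> \<mu> > bd n \<Longrightarrow> c n n' r i \<mu> \<in> genideal R (set ys)"
  shows "\<exists>k0. \<forall>n i \<mu>. \<mu> > bd n + k0 \<longrightarrow>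
    exact_at (kos_module M ys) (kos_diff M (\<lambda>_. \<zero>\<^bsub>M\<^esub>) ys) (kos_strand (V n) ys) i \<mu>"
proof -
  interpret M: Module.module R M by fact
  have D0: "diff_module R M (\<lambda>_. \<zero>\<^bsub>M\<^esub>)" by (rule diff_moduleI[OF M]) simp_all
  let ?N = "kos_module M ys" and ?D = "kos_diff M (\<lambda>_. \<zero>\<^bsub>M\<^esub>) ys"
  interpret N: diff_module R ?N ?D by (rule kos_diff_module[OF D0 ys])
  have acN: "acc_on R ?N (carrier ?N)" by (rule acc_on_kos_module[OF M acc])
  have strc: "kos_strand (V n) ys i \<mu> \<subseteq> carrier ?N" for n i \<mu>
    by (rule kos_strand_carrier[OF V_car])
  define B where "B = ?D ` carrier ?N"
  have B: "submodule B R ?N"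
    unfolding N.submodule_iff
  proof (intro conjI ballI)
    show "B \<subseteq> carrier ?N" unfolding B_def by auto
    have "\<zero>\<^bsub>?N\<^esub> = ?D \<zero>\<^bsub>?N\<^esub>" by simp
    then show "\<zero>\<^bsub>?N\<^esub> \<in> B" unfolding B_def using N.M.zero_closed by blast
    fix a assume "a \<in> B"
    then obtain a' where a: "a = ?D a'" "a' \<in> carrier ?N" unfolding B_def by blast
    { fix b assume "b \<in> B"
      then obtain b' where b: "b = ?D b'" "b' \<in> carrier ?N" unfolding B_def by blast
      have "a \<oplus>\<^bsub>?N\<^esub> b = ?D (a' \<oplus>\<^bsub>?N\<^esub> b')" using a b N.D_add by simp
      then show "a \<oplus>\<^bsub>?N\<^esub> b \<in> B" unfolding B_def using a b by blast }
    { fix r assume r: "r \<in> carrier R"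
      have "r \<odot>\<^bsub>?N\<^esub> a = ?D (r \<odot>\<^bsub>?N\<^esub> a')" using a r N.D_smult by simp
      then show "r \<odot>\<^bsub>?N\<^esub> a \<in> B" unfolding B_def using a r by blast }
  qed
  note Bm = B[unfolded N.submodule_iff]
  have proj_B: "kos_proj (p n) ys i \<mu> t \<in> carrier ?N" if "t \<in> carrier ?N" for n i \<mu> t
    using kos_proj_strand[where V = "V n" and p = "p n", OF p_strand that] strc by blast
  have p_car: "p n i \<mu> x \<in> carrier M" if "x \<in> carrier M" for n i \<mu> x
    using p_strand[OF that] V_car by blast
  \<comment> \<open>The homogeneous cycles of all rows and degrees are collected in one set, so that
    a single finite set of generators, and hence one constant \<open>k0\<close>, serves every
    \<open>n\<close>.\<close>
  define Z where "Z = (\<Union>n i \<mu>. {z \<in> kos_strand (V n) ys i \<mu>. ?D z = \<zero>\<^bsub>?N\<^esub>})"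
  have "Z \<subseteq> carrier ?N" unfolding Z_def using strc by blast
  then obtain S where S: "finite S" "S \<subseteq> Z" "Z \<subseteq> mod_span R ?N S"
    using N.acc_on_finite_subset[OF N.carrier_is_submodule acN] by blast
  have "\<forall>s\<in>S. \<exists>n i \<mu>. s \<in> kos_strand (V n) ys i \<mu>" using S(2) unfolding Z_def by blast
  then obtain nS iS \<mu>S where dS: "\<And>s. s \<in> S \<Longrightarrow> s \<in> kos_strand (V (nS s)) ys (iS s) (\<mu>S s)"
    by metis
  \<comment> \<open>The largest internal degree of a generator; \<open>0\<close> is inserted so that
    the maximum exists when there is no generator.\<close>
  define k0 where "k0 = Max (insert 0 (\<mu>S ` S))"
  have k0: "\<mu>S s \<le> k0" if "s \<in> S" for s
    unfolding k0_def by (rule Max_ge) (use S(1) that in auto)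
  have ideal_B: "r \<odot>\<^bsub>?N\<^esub> s \<in> B" if s: "s \<in> S" and r: "r \<in> genideal R (set ys)" for r s
  proof -
    have s': "s \<in> carrier ?N" "?D s = \<zero>\<^bsub>?N\<^esub>" using s S(2) strc unfolding Z_def by blast+
    \<comment> \<open>The scalars taking the cycle \<open>s\<close> to a boundary form an ideal. It
      contains \<open>ys\<close> by null homotopy, hence the ideal they generate.\<close>
    define I where "I = {r \<in> carrier R. r \<odot>\<^bsub>?N\<^esub> s \<in> B}"
    have "submodule I R (regular_module R)"
    proof -
      interpret RR: Module.module R "regular_module R" by (rule regular_module) (rule M.R.is_cring)
      show ?thesis
        unfolding RR.submodule_iff I_def
        using Bm s' by (auto simp: N.smult_l_distr N.smult_assoc1)
    qed
    then have "ideal I R" using submodule_regular_iff[OF M.R.is_cring] by blast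
    moreover have "set ys \<subseteq> I"
      unfolding I_def B_def
      using null_homotopic_boundary[OF N.diff_module_axioms kos_null_homotopic[OF D0 ys] s'] ys by auto
    ultimately have "genideal R (set ys) \<subseteq> I" by (rule M.R.genideal_minimal)
    then show ?thesis using r unfolding I_def by blast
  qed
  \<comment> \<open>The projections are not \<open>R\<close>-linear. Quantifying over all multiples
    \<open>r t\<close> makes the condition stable under scalars, so that \<open>Q\<close> is a
    submodule and may be tested on generators.\<close>
  define Q where "Q = {t \<in> carrier ?N. \<forall>r\<in>carrier R. \<forall>n i \<mu>. \<mu> > bd n + k0 \<longrightarrow>
      kos_proj (p n) ys i \<mu> (r \<odot>\<^bsub>?N\<^esub> t) \<in> B}"
  have "submodule Q R ?N"
    unfolding N.submodule_iff
  proof (intro conjI ballI)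
    show "Q \<subseteq> carrier ?N" unfolding Q_def by blast
    have "kos_proj (p n) ys i \<mu> \<zero>\<^bsub>?N\<^esub> = \<zero>\<^bsub>?N\<^esub>" for n i \<mu>
    proof -
      have "kos_proj (p n) ys i \<mu> \<zero>\<^bsub>?N\<^esub> = kos_proj (p n) ys i \<mu> \<zero>\<^bsub>?N\<^esub> \<oplus>\<^bsub>?N\<^esub> kos_proj (p n) ys i \<mu> \<zero>\<^bsub>?N\<^esub>"
        using kos_proj_add[where p = "p n", OF p_add N.M.zero_closed N.M.zero_closed] by simp
      then show ?thesis using proj_B[of "\<zero>\<^bsub>?N\<^esub>" n i \<mu>] N.M.add.l_cancel_one' by auto
    qed
    then show "\<zero>\<^bsub>?N\<^esub> \<in> Q" unfolding Q_def using Bm by simp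
  next
    fix a b assume "a \<in> Q" "b \<in> Q"
    then show "a \<oplus>\<^bsub>?N\<^esub> b \<in> Q"
      unfolding Q_def using Bm
      by (auto simp: N.smult_r_distr kos_proj_add[where p = "p n" for n, OF p_add])
  next
    fix r a assume r: "r \<in> carrier R" and a: "a \<in> Q"
    have "r' \<odot>\<^bsub>?N\<^esub> (r \<odot>\<^bsub>?N\<^esub> a) = (r' \<otimes>\<^bsub>R\<^esub> r) \<odot>\<^bsub>?N\<^esub> a" if "r' \<in> carrier R" for r'
      using that r a unfolding Q_def by (simp add: N.smult_assoc1)
    then show "r \<odot>\<^bsub>?N\<^esub> a \<in> Q"
      using r a unfolding Q_def by auto
  qed
  moreover have "S \<subseteq> Q"
  proof
    fix s assume s: "s \<in> S"
    have "kos_proj (p n) ys i \<mu> (r \<odot>\<^bsub>?N\<^esub> s) \<in> B" if r: "r \<in> carrier R" and \<mu>: "\<mu> > bd n + k0" for r n i \<mu>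
    proof -
      have "kos_proj (p n) ys i \<mu> (r \<odot>\<^bsub>?N\<^esub> s) = c n (nS s) r (i - iS s) (\<mu> - \<mu>S s) \<odot>\<^bsub>?N\<^esub> s"
        using dS[OF s]
        by (rule kos_proj_act[where W = "V (nS s)" and c = "c n (nS s) r" and p = "p n", rotated])
          (rule p_act[OF r])
      \<comment> \<open>Since the generator has degree at most \<open>k0\<close>, the scalar
        carrying it to degree \<open>\<mu>\<close> has internal degree above
        \<open>bd n\<close>.\<close>
      moreover have "c n (nS s) r (i - iS s) (\<mu> - \<mu>S s) \<in> genideal R (set ys)"
        by (rule c_ideal[OF r]) (use \<mu> k0[OF s] in linarith)
      ultimately show ?thesis using ideal_B[OF s] by simp
    qed
    then show "s \<in> Q" unfolding Q_def using dS[OF s] strc by blast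
  qed
  ultimately have ZQ: "Z \<subseteq> Q" using mod_span_minimal S(3) by blast
  have "exact_at ?N ?D (kos_strand (V n) ys) i \<mu>" if \<mu>: "\<mu> > bd n + k0" for n i \<mu>
    unfolding exact_at_def
  proof (intro ballI impI)
    fix z assume z: "z \<in> kos_strand (V n) ys i \<mu>" "?D z = \<zero>\<^bsub>?N\<^esub>"
    then have "z \<in> Q" using ZQ unfolding Z_def by blast
    \<comment> \<open>With \<open>r\<close> equal to one, membership in \<open>Q\<close> says that
      \<open>z\<close>, which is its own projection, is a boundary.\<close>
    then have "kos_proj (p n) ys i \<mu> (\<one>\<^bsub>R\<^esub> \<odot>\<^bsub>?N\<^esub> z) \<in> B" "z \<in> carrier ?N"
      unfolding Q_def using \<mu> M.R.one_closed by blast+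
    then have "z \<in> B"
      using kos_proj_id[where p = "p n" and V = "V n", OF p_id z(1)] by simp
    then obtain w where w: "w \<in> carrier ?N" "z = ?D w" unfolding B_def by blast
    have "?D (kos_proj (p n) ys (i - 1) \<mu> w) = kos_proj (p n) ys i \<mu> z"
      unfolding w(2)
      by (rule kos_proj_diff[where p = "p n", symmetric, OF M ys p_car p_add p_shift w(1)])
    also have "\<dots> = z" by (rule kos_proj_id[where p = "p n" and V = "V n", OF p_id z(1)])
    finally show "\<exists>w\<in>kos_strand (V n) ys (i - 1) \<mu>. ?D w = z"
      using kos_proj_strand[where V = "V n" and p = "p n", OF p_strand w(1)] by blast
  qed
  then show ?thesis by blast
qed

text \<open>The modules lie over different rings and \<open>f\<close> is controlled on strands only:
  in the application a row of the \<open>R\<close>-module \<open>L\<close> is embedded into an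
  \<open>A\<close>-module. The induced map on trees commutes with the Koszul differentials and is
  injective, so exactness transfers. Compatibility with subtraction is the form of additivity that
  the cone differential uses.\<close>

lemma exact_at_kos_image:
  assumes M: "Module.module R M" and M': "Module.module S M'"
    and V: "strand_family R M (\<lambda>_. \<zero>\<^bsub>M\<^esub>) Y V" and ys: "set ys \<subseteq> Y"
    and f_car: "\<And>i \<mu> x. x \<in> V i \<mu> \<Longrightarrow> f x \<in> carrier M'"
    and f_minus: "\<And>i \<mu> x y. x \<in> V i \<mu> \<Longrightarrow> y \<in> V i \<mu> \<Longrightarrow> f (x \<ominus>\<^bsub>M\<^esub> y) = f x \<ominus>\<^bsub>M'\<^esub> f y"
    and f_smult: "\<And>i \<mu> x y. y \<in> Y \<Longrightarrow> x \<in> V i \<mu> \<Longrightarrow> f (y \<odot>\<^bsub>M\<^esub> x) = y \<odot>\<^bsub>M'\<^esub> f x"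
    and f_zero: "f \<zero>\<^bsub>M\<^esub> = \<zero>\<^bsub>M'\<^esub>"
    and f_inj: "\<And>i \<mu> x. x \<in> V i \<mu> \<Longrightarrow> f x = \<zero>\<^bsub>M'\<^esub> \<Longrightarrow> x = \<zero>\<^bsub>M\<^esub>"
    and D': "\<And>i \<mu> x. x \<in> V i \<mu> \<Longrightarrow> D' (f x) = \<zero>\<^bsub>M'\<^esub>"
    and ex: "exact_at (kos_module M ys) (kos_diff M (\<lambda>_. \<zero>\<^bsub>M\<^esub>) ys) (kos_strand V ys) i \<mu>"
  shows "exact_at (kos_module M' ys) (kos_diff M' D' ys) (kos_strand (\<lambda>i \<mu>. f ` V i \<mu>) ys) i \<mu>"
proof -
  interpret M: Module.module R M by fact
  interpret M': Module.module S M' by fact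
  let ?f = "map_tree f"
  have D0: "diff_module R M (\<lambda>_. \<zero>\<^bsub>M\<^esub>)" by (rule diff_moduleI[OF M]) simp_all
  note YR = strand_familyD(1)[OF V]
  have Vc: "V i \<mu> \<subseteq> carrier M" for i \<mu> using strand_familyD(2)[OF V] by blast
  have c: "t \<in> carrier (kos_module M zs)" if "t \<in> kos_strand V zs i \<mu>" for t zs i \<mu>
    using kos_strand_carrier[where V = V, OF Vc] that by blast
  have c': "?f t \<in> carrier (kos_module M' zs)" if "t \<in> kos_strand V zs i \<mu>" for t zs i \<mu>
    using that by (induction zs arbitrary: i \<mu> t) (auto simp: cone_strand_def f_car)
  have zero: "?f \<zero>\<^bsub>kos_module M zs\<^esub> = \<zero>\<^bsub>kos_module M' zs\<^esub>" for zs
    by (induction zs) (auto simp: f_zero)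
  have smult: "?f (y \<odot>\<^bsub>kos_module M zs\<^esub> t) = y \<odot>\<^bsub>kos_module M' zs\<^esub> ?f t"
    if "t \<in> kos_strand V zs i \<mu>" "y \<in> Y" for t y zs i \<mu>
    using that by (induction zs arbitrary: i \<mu> t) (auto simp: cone_strand_def f_smult)
  have inj: "t = \<zero>\<^bsub>kos_module M zs\<^esub>" if "t \<in> kos_strand V zs i \<mu>" "?f t = \<zero>\<^bsub>kos_module M' zs\<^esub>" for t zs i \<mu>
    using that
  proof (induction zs arbitrary: i \<mu> t)
    case (Cons y zs)
    then obtain a b where t: "t = Node a b" "a \<in> kos_strand V zs i \<mu>" "b \<in> kos_strand V zs (i - 1) (\<mu> + 1)"
      unfolding kos_strand.simps cone_strand_def by blast
    show ?case
      using Cons.IH[OF t(2)] Cons.IH[OF t(3)] Cons.prems(2) by (simp add: t(1))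
  qed (auto simp: f_inj)
  have img: "kos_strand (\<lambda>i \<mu>. f ` V i \<mu>) zs i \<mu> = ?f ` kos_strand V zs i \<mu>" for zs i \<mu>
  proof (induction zs arbitrary: i \<mu>)
    case Nil
    then show ?case by (simp add: image_image)
  next
    case (Cons y zs)
    show ?case
      unfolding kos_strand.simps cone_strand_def Cons.IH by (auto simp: image_iff) (metis tree.map(2))
  qed
  have minus: "?f (s \<ominus>\<^bsub>kos_module M zs\<^esub> t) = ?f s \<ominus>\<^bsub>kos_module M' zs\<^esub> ?f t"
    if "s \<in> kos_strand V zs i \<mu>" "t \<in> kos_strand V zs i \<mu>" for s t zs i \<mu>
    using that
  proof (induction zs arbitrary: i \<mu> s t)
    case Nil
    then obtain a b where st: "s = Leaf a" "t = Leaf b" and a: "a \<in> V i \<mu>" "b \<in> V i \<mu>"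
      by auto
    then have "a \<in> carrier M" "b \<in> carrier M" using Vc by blast+
    then show ?case
      using f_minus[OF a] f_car[OF a(1)] f_car[OF a(2)]
      by (simp add: st M.leaf_module_minus M'.leaf_module_minus)
  next
    case (Cons y zs)
    then obtain a1 a2 b1 b2 where
      st: "s = Node a1 a2" "t = Node b1 b2" and a: "a1 \<in> kos_strand V zs i \<mu>" "a2 \<in> kos_strand V zs (i - 1) (\<mu> + 1)"
        "b1 \<in> kos_strand V zs i \<mu>" "b2 \<in> kos_strand V zs (i - 1) (\<mu> + 1)"
      unfolding kos_strand.simps cone_strand_def by blast
    show ?case
      using Cons.IH[OF a(1,3)] Cons.IH[OF a(2,4)]
        node_module_minus[OF kos_module_module[OF M] c[OF a(1)] c[OF a(2)] c[OF a(3)] c[OF a(4)]]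
        node_module_minus[OF kos_module_module[OF M'] c'[OF a(1)] c'[OF a(2)] c'[OF a(3)] c'[OF a(4)]]
      by (simp add: st)
  qed
  have diff: "kos_diff M' D' zs (?f t) = ?f (kos_diff M (\<lambda>_. \<zero>\<^bsub>M\<^esub>) zs t)"
    if "set zs \<subseteq> Y" "t \<in> kos_strand V zs i \<mu>" for zs t i \<mu>
    using that
  proof (induction zs arbitrary: i \<mu> t)
    case Nil
    then show ?case by (auto simp: D' f_zero)
  next
    case (Cons y zs)
    then have zs: "set zs \<subseteq> Y" "y \<in> Y" by auto
    from Cons.prems obtain a b where t: "t = Node a b" "a \<in> kos_strand V zs i \<mu>" "b \<in> kos_strand V zs (i - 1) (\<mu> + 1)"
      unfolding kos_strand.simps cone_strand_def by blast
    note F = strand_familyD[OF kos_strand_family[OF D0 V zs(1)]]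
    have "kos_diff M (\<lambda>_. \<zero>\<^bsub>M\<^esub>) zs b \<in> kos_strand V zs i (\<mu> + 1)"
      using F(8)[OF t(3)] .
    moreover have "y \<odot>\<^bsub>kos_module M zs\<^esub> a \<in> kos_strand V zs i (\<mu> + 1)"
      using F(7)[OF zs(2) t(2)] .
    ultimately show ?case
      using Cons.IH[OF zs(1) t(2)] Cons.IH[OF zs(1) t(3)] minus smult[OF t(2) zs(2)]
      by (simp add: t(1) cone_diff_def)
  qed
  show ?thesis
    unfolding exact_at_def
  proof (intro ballI impI)
    fix z' assume z': "z' \<in> kos_strand (\<lambda>i \<mu>. f ` V i \<mu>) ys i \<mu>" "kos_diff M' D' ys z' = \<zero>\<^bsub>kos_module M' ys\<^esub>"
    then obtain z where z: "z \<in> kos_strand V ys i \<mu>" "z' = ?f z"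
      unfolding img by blast
    have "kos_diff M (\<lambda>_. \<zero>\<^bsub>M\<^esub>) ys z \<in> kos_strand V ys (i + 1) \<mu>"
      using strand_familyD(6)[OF kos_strand_family[OF D0 V ys] z(1)] .
    then have "kos_diff M (\<lambda>_. \<zero>\<^bsub>M\<^esub>) ys z = \<zero>\<^bsub>kos_module M ys\<^esub>"
      using inj z'(2) diff[OF ys z(1)] z(2) by simp
    then obtain w where w: "w \<in> kos_strand V ys (i - 1) \<mu>" "kos_diff M (\<lambda>_. \<zero>\<^bsub>M\<^esub>) ys w = z"
      using ex z(1) unfolding exact_at_def by blast
    then have "kos_diff M' D' ys (?f w) = z'"
      using diff[OF ys w(1)] z(2) by simp
    then show "\<exists>w\<in>kos_strand (\<lambda>i \<mu>. f ` V i \<mu>) ys (i - 1) \<mu>. kos_diff M' D' ys w = z'"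
      unfolding img using w(1) by blast
  qed
qed

text \<open>Each cone lowers the cohomological degree of one entry by 1, so after
  \<open>length ys\<close> cones every leaf still has positive degree.\<close>

lemma kos_strand_trivial:
  assumes "\<And>i \<mu>. i > 0 \<Longrightarrow> V i \<mu> \<subseteq> {\<zero>\<^bsub>M\<^esub>}" "i > int (length ys)"
  shows "kos_strand V ys i \<mu> \<subseteq> {\<zero>\<^bsub>kos_module M ys\<^esub>}"
  using assms(2)
proof (induction ys arbitrary: i \<mu>)
  case Nil
  then show ?case using assms(1) by auto
next
  case (Cons y ys)
  have "kos_strand V ys i \<mu> \<subseteq> {\<zero>\<^bsub>kos_module M ys\<^esub>}" "kos_strand V ys (i - 1) (\<mu> + 1) \<subseteq> {\<zero>\<^bsub>kos_module M ys\<^esub>}"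
    using Cons.prems by (auto intro!: Cons.IH)
  then show ?case by (auto simp: cone_strand_def)
qed

section \<open>Bigraded rings\<close>

definition total_degree :: "nat ^ 't \<Rightarrow> nat" where
  "total_degree m = (\<Sum>j\<in>UNIV. m $ j)"

lemma total_degree_add: "total_degree (m + n) = total_degree m + total_degree n"
  by (simp add: total_degree_def sum.distrib)

lemma total_degree_zero [simp]: "total_degree 0 = 0"
  by (simp add: total_degree_def)

lemma total_degree_axis [simp]: "total_degree (axis j (Suc 0)) = Suc 0"
  by (simp add: total_degree_def axis_def)

text \<open>Sums of homogeneous elements of degree \<open>(m, c)\<close> that satisfy
  \<open>c \<le> b |m|\<close> or lie in \<open>I\<close>. For an ideal \<open>I\<close> they form a
  subring, so it suffices to place ring generators in it.\<close>

inductive_set bounded_span ::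
  "('r, 'p) ring_scheme \<Rightarrow> ((nat ^ 't) \<times> nat \<Rightarrow> 'r set) \<Rightarrow> 'r set \<Rightarrow> nat \<Rightarrow> 'r set"
  for R G I b where
    zero: "\<zero>\<^bsub>R\<^esub> \<in> bounded_span R G I b"
  | add: "r \<in> G (m, c) \<Longrightarrow> (b * total_degree m < c \<Longrightarrow> r \<in> I) \<Longrightarrow> s \<in> bounded_span R G I b \<Longrightarrow>
      r \<oplus>\<^bsub>R\<^esub> s \<in> bounded_span R G I b"

locale bigraded_ring =
  fixes R :: "'r ring" and RG :: "(nat ^ 't) \<times> nat \<Rightarrow> 'r set"
  assumes noeth: "noetherian_ring R" and gr: "graded_ring R RG"
begin

abbreviation "A \<equiv> row_ring R RG"
abbreviation "AG \<equiv> row_grading RG 0"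
abbreviation "rc \<equiv> grade_comp R RG"

lemma R_cring: "cring R"
  using gr by (simp add: graded_ring_def)

sublocale R: cring R by (rule R_cring)

sublocale RG: grading R RG
  by unfold_locales (use gr in \<open>simp add: graded_ring_def\<close>)

lemma one_RG: "\<one>\<^bsub>R\<^esub> \<in> RG (0, 0)"
  using gr by (simp add: graded_ring_def zero_prod_def)

lemma mult_RG: "a \<in> RG i \<Longrightarrow> b \<in> RG j \<Longrightarrow> a \<otimes>\<^bsub>R\<^esub> b \<in> RG (i + j)"
  using gr unfolding graded_ring_def by blast

section \<open>The row of degree zero as a ring\<close>

lemma A_sel [simp]: "carrier A = partial_sum R RG ({0} \<times> UNIV)" "monoid.mult A = monoid.mult R"
    "one A = one R" "ring.zero A = ring.zero R" "ring.add A = ring.add R"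
  by (simp_all add: row_ring_def graded_row_def)

lemma AG_eq [simp]: "AG i = RG (0, i)"
  by (simp add: row_grading_def)

lemma A_carrier: "a \<in> carrier A \<Longrightarrow> a \<in> carrier R"
  using RG.partial_sum_carrier by simp

lemma AG_carrier: "a \<in> RG (0, i) \<Longrightarrow> a \<in> carrier A"
  using RG.partial_sum_incl[of "(0, i)" "{0} \<times> UNIV"] by simp

lemma A_mult: "a \<in> carrier A \<Longrightarrow> b \<in> carrier A \<Longrightarrow> a \<otimes>\<^bsub>R\<^esub> b \<in> carrier A"
  unfolding A_sel
proof (induction a rule: RG.partial_sum_induct)
  case zero
  then show ?case using RG.partial_sum_carrier RG.partial_sum_zero by simp
next
  case (incl i a)
  note a = incl(1,2)
  from incl(3) show ?case
  proof (induction b rule: RG.partial_sum_induct)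
    case zero
    then show ?case using RG.H_carrier[OF a(2)] RG.partial_sum_zero by simp
  next
    case (incl j b)
    have "i + j \<in> {0} \<times> UNIV" using a(1) incl(1) by (cases i; cases j) auto
    from RG.partial_sum_incl[OF this mult_RG[OF a(2) incl(2)]] show ?case .
  next
    case (add j b c)
    have "a \<otimes>\<^bsub>R\<^esub> (b \<oplus>\<^bsub>R\<^esub> c) = a \<otimes>\<^bsub>R\<^esub> b \<oplus>\<^bsub>R\<^esub> a \<otimes>\<^bsub>R\<^esub> c"
      by (rule R.r_distr[OF RG.H_carrier[OF add(2)] add(4) RG.H_carrier[OF a(2)]])
    then show ?case using RG.partial_sum_add[OF add(5,6)] by simp
  qed
next
  case (add i a c)
  have "b \<in> carrier R" using add(7) by (rule RG.partial_sum_carrier)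
  from R.l_distr[OF RG.H_carrier[OF add(2)] add(4) this]
  show ?case using RG.partial_sum_add[OF add(5)[OF add(7)] add(6)[OF add(7)]] by simp
qed

lemma A_subcring: "subcring (carrier A) R"
proof (rule R.subcringI)
  have sub: "carrier A \<subseteq> carrier R" using A_carrier by blast
  show "subring (carrier A) R"
  proof (rule R.subringI[OF sub])
    show "\<one>\<^bsub>R\<^esub> \<in> carrier A" by (rule AG_carrier[OF one_RG])
  qed (use A_mult RG.partial_sum_add RG.partial_sum_neg in simp_all)
  show "h1 \<otimes>\<^bsub>R\<^esub> h2 = h2 \<otimes>\<^bsub>R\<^esub> h1" if "h1 \<in> carrier A" "h2 \<in> carrier A" for h1 h2
    using R.m_comm that sub by blast
qed

lemma A_cring: "cring A"
proof -
  have "carrier A \<subseteq> carrier R" using A_carrier by blast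
  then have "cring (R\<lparr>carrier := carrier A\<rparr>)"
    using R.subcring_iff A_subcring by blast
  moreover have "R\<lparr>carrier := carrier A\<rparr> = A"
    by (simp add: row_ring_def graded_row_def)
  ultimately show ?thesis by metis
qed

sublocale A: cring A by (rule A_cring)

lemma A_neg: "a \<in> carrier A \<Longrightarrow> \<ominus>\<^bsub>A\<^esub> a = \<ominus>\<^bsub>R\<^esub> a"
  using A.minus_equality[of "\<ominus>\<^bsub>R\<^esub> a" a] RG.partial_sum_neg[of a] A_carrier[of a] R.l_neg by simp

text \<open>Multiplication by a homogeneous element shifts components. Degrees cannot be subtracted
  in a monoid of natural numbers, whence the separate claim for degrees that are not of the form
  \<open>g + \<nu>\<close>.\<close>

lemma rc_mult:
  assumes "s \<in> RG \<nu>" "r \<in> carrier R"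
  shows "rc (r \<otimes>\<^bsub>R\<^esub> s) (g + \<nu>) = rc r g \<otimes>\<^bsub>R\<^esub> s"
    and "(\<And>g. h \<noteq> g + \<nu>) \<Longrightarrow> rc (r \<otimes>\<^bsub>R\<^esub> s) h = \<zero>\<^bsub>R\<^esub>"
proof -
  have s: "s \<in> carrier R" using RG.H_carrier assms(1) .
  note * = grade_comp_image[OF RG.grading_axioms RG.grading_axioms, where f = "\<lambda>r. r \<otimes>\<^bsub>R\<^esub> s"
      and s = "\<lambda>g. g + \<nu>" and I = UNIV]
  show "rc (r \<otimes>\<^bsub>R\<^esub> s) (g + \<nu>) = rc r g \<otimes>\<^bsub>R\<^esub> s"
    by (rule *(1)) (use s assms mult_RG RG.partial_sum_UNIV in \<open>auto simp: R.l_distr inj_on_def\<close>)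
  assume "\<And>g. h \<noteq> g + \<nu>"
  then show "rc (r \<otimes>\<^bsub>R\<^esub> s) h = \<zero>\<^bsub>R\<^esub>"
    by (intro *(2)) (use s assms mult_RG RG.partial_sum_UNIV in \<open>auto simp: R.l_distr inj_on_def\<close>)
qed

lemma rc_RG: "r \<in> carrier R \<Longrightarrow> rc r g \<in> RG g"
  by (rule RG.grade_comp_props)

section \<open>Sums of homogeneous elements of linearly bounded degree, modulo an ideal\<close>

lemma bounded_span_carrier:
  assumes "r \<in> bounded_span R RG I b"
  shows "r \<in> carrier R"
  using assms by induction (auto dest: RG.H_carrier)

lemma bounded_span_add:
  assumes "r \<in> bounded_span R RG I b" "s \<in> bounded_span R RG I b"
  shows "r \<oplus>\<^bsub>R\<^esub> s \<in> bounded_span R RG I b"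
  using assms(1)
proof induction
  case zero
  then show ?case using assms(2) bounded_span_carrier by simp
next
  case (add r m c s')
  have "r \<oplus>\<^bsub>R\<^esub> s' \<oplus>\<^bsub>R\<^esub> s = r \<oplus>\<^bsub>R\<^esub> (s' \<oplus>\<^bsub>R\<^esub> s)"
    using RG.H_carrier[OF add(1)] bounded_span_carrier add assms(2) by (intro R.a_assoc) auto
  then show ?case
    using bounded_span.add[OF add(1,2) add(4)] by simp
qed

lemma bounded_span_incl:
  assumes "r \<in> RG (m, c)" "b * total_degree m < c \<Longrightarrow> r \<in> I"
  shows "r \<in> bounded_span R RG I b"
  using bounded_span.add[where R = R and b = b and G = RG, OF assms bounded_span.zero] RG.H_carrier[OF assms(1)]
  by simp

context
  fixes I assumes I: "ideal I R"
begin

lemma bounded_span_neg: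
  assumes "r \<in> bounded_span R RG I b"
  shows "\<ominus>\<^bsub>R\<^esub> r \<in> bounded_span R RG I b"
  using assms
proof induction
  case zero
  then show ?case by (simp add: bounded_span.zero)
next
  case (add r m c s)
  have "\<ominus>\<^bsub>R\<^esub> r \<oplus>\<^bsub>R\<^esub> (\<ominus>\<^bsub>R\<^esub> s) \<in> bounded_span R RG I b"
  proof (rule bounded_span.add)
    show "\<ominus>\<^bsub>R\<^esub> r \<in> RG (m, c)" using RG.H_neg add(1) .
    show "b * total_degree m < c \<Longrightarrow> \<ominus>\<^bsub>R\<^esub> r \<in> I"
      using add(2) additive_subgroup.a_inv_closed[OF ideal.axioms(1)[OF I]] by blast
  qed (rule add(4))
  then show ?case
    using RG.H_carrier[OF add(1)] bounded_span_carrier[OF add(3)] by (simp add: R.minus_add)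
qed

lemma bounded_span_mult1:
  assumes r: "r \<in> RG (m, c)" "b * total_degree m < c \<Longrightarrow> r \<in> I"
    and "s \<in> bounded_span R RG I b"
  shows "r \<otimes>\<^bsub>R\<^esub> s \<in> bounded_span R RG I b"
  using assms(3)
proof induction
  case zero
  then show ?case using RG.H_carrier[OF r(1)] bounded_span.zero[of R RG I b] by simp
next
  case (add s m' c' t)
  have car: "r \<in> carrier R" "s \<in> carrier R" "t \<in> carrier R"
    using RG.H_carrier[OF r(1)] RG.H_carrier[OF add(1)] bounded_span_carrier[OF add(3)] by auto
  have "r \<otimes>\<^bsub>R\<^esub> s \<in> bounded_span R RG I b"
  proof (rule bounded_span_incl)
    show "r \<otimes>\<^bsub>R\<^esub> s \<in> RG (m + m', c + c')" using mult_RG[OF r(1) add(1)] by simp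
    assume "b * total_degree (m + m') < c + c'"
    \<comment> \<open>The bound is additive in the degree, so a product can exceed it only if one of
      its factors does; that factor lies in \<open>I\<close>.\<close>
    then have "b * total_degree m < c \<or> b * total_degree m' < c'"
      by (auto simp: total_degree_add algebra_simps)
    then show "r \<otimes>\<^bsub>R\<^esub> s \<in> I"
      using r(2) add(2) ideal.I_l_closed[OF I] ideal.I_r_closed[OF I] car by blast
  qed
  then show ?case
    using bounded_span_add add(4) car by (simp add: R.r_distr)
qed

lemma bounded_span_mult:
  assumes "r \<in> bounded_span R RG I b" "s \<in> bounded_span R RG I b"
  shows "r \<otimes>\<^bsub>R\<^esub> s \<in> bounded_span R RG I b"
  using assms(1)
proof induction
  case zero
  then show ?case using bounded_span_carrier[OF assms(2)] bounded_span.zero[of R RG I b] by simp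
next
  case (add r m c t)
  have "(r \<oplus>\<^bsub>R\<^esub> t) \<otimes>\<^bsub>R\<^esub> s = r \<otimes>\<^bsub>R\<^esub> s \<oplus>\<^bsub>R\<^esub> t \<otimes>\<^bsub>R\<^esub> s"
    using RG.H_carrier[OF add(1)] bounded_span_carrier[OF add(3)] bounded_span_carrier[OF assms(2)]
    by (rule R.l_distr)
  then show ?case
    using bounded_span_add bounded_span_mult1[OF add(1,2) assms(2)] add(4) by simp
qed

lemma bounded_span_comp:
  assumes "r \<in> bounded_span R RG I b" "b * total_degree m < c"
  shows "rc r (m, c) \<in> I"
  using assms(1)
proof induction
  case zero
  then show ?case using additive_subgroup.zero_closed[OF ideal.axioms(1)[OF I]] by simp
next
  case (add r m' c' s)
  have "rc r (m, c) \<in> I"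
  proof (cases "(m, c) = (m', c')")
    case True
    then show ?thesis
      using add(2) assms(2) by (simp add: RG.grade_comp_hom_elt[OF add(1)])
  next
    case False
    then show ?thesis
      using additive_subgroup.zero_closed[OF ideal.axioms(1)[OF I]]
      by (simp only: RG.grade_comp_hom_elt[OF add(1)] if_False)
  qed
  then show ?case
    using add additive_subgroup.a_closed[OF ideal.axioms(1)[OF I]]
      RG.H_carrier[OF add(1)] bounded_span_carrier[OF add(3)]
    by (simp add: RG.grade_comp_add)
qed

lemma generate_ring_bounded_span:
  assumes "T \<subseteq> bounded_span R RG I b"
  shows "generate_ring R T \<subseteq> bounded_span R RG I b"
proof
  fix r assume "r \<in> generate_ring R T"
  then show "r \<in> bounded_span R RG I b"
  proof induction
    case one
    then show ?case using bounded_span_incl[OF one_RG] by simp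
  qed (use assms bounded_span_neg bounded_span_add bounded_span_mult in blast)+
qed

end

text \<open>Taking components is not linear over \<open>R\<close>, but the condition on all
  multiples \<open>s r\<close> cuts out an ideal. Inclusions of generated ideals can then be checked
  on generators. The set \<open>I\<close> is only required to be additive, so that an ideal of
  \<open>A\<close> can be used inside \<open>R\<close>.\<close>

lemma component_ideal:
  assumes I: "\<zero>\<^bsub>R\<^esub> \<in> I" "\<And>a b. a \<in> I \<Longrightarrow> b \<in> I \<Longrightarrow> a \<oplus>\<^bsub>R\<^esub> b \<in> I"
  shows "ideal {r \<in> carrier R. \<forall>s\<in>carrier R. \<forall>g\<in>\<Gamma>. rc (s \<otimes>\<^bsub>R\<^esub> r) g \<in> I} R" (is "ideal ?Q R")
proof -
  interpret RR: Module.module R "regular_module R" by (rule regular_module) (rule R_cring)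
  have "submodule ?Q R (regular_module R)"
    unfolding RR.submodule_iff
  proof (intro conjI ballI)
    show "?Q \<subseteq> carrier (regular_module R)" "\<zero>\<^bsub>regular_module R\<^esub> \<in> ?Q"
      using I(1) by auto
  next
    fix a b assume "a \<in> ?Q" "b \<in> ?Q"
    then show "a \<oplus>\<^bsub>regular_module R\<^esub> b \<in> ?Q"
      using I(2) by (auto simp: R.r_distr RG.grade_comp_add)
  next
    fix r a assume r: "r \<in> carrier R" and a: "a \<in> ?Q"
    have "s \<otimes>\<^bsub>R\<^esub> (r \<otimes>\<^bsub>R\<^esub> a) = (s \<otimes>\<^bsub>R\<^esub> r) \<otimes>\<^bsub>R\<^esub> a" if "s \<in> carrier R" for s
      using that r a by (simp add: R.m_assoc)
    then show "r \<odot>\<^bsub>regular_module R\<^esub> a \<in> ?Q"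
      using r a by auto
  qed
  then show ?thesis using submodule_regular_iff[OF R_cring] by blast
qed

text \<open>\<open>A\<close> is a direct summand of \<open>R\<close> as an \<open>A\<close>-module,
  the projection being that onto the row of degree zero. Hence extending an ideal of
  \<open>A\<close> to \<open>R\<close> adds no new element of \<open>A\<close>; the claim is its
  form for homogeneous elements.\<close>

lemma genideal_contraction:
  assumes I: "ideal I A" and T: "T \<subseteq> I \<inter> (\<Union>j. RG (0, j))"
    and a: "a \<in> RG (0, i)" "a \<in> genideal R T"
  shows "a \<in> I"
proof -
  interpret I: ideal I A by fact
  define Q where "Q = {r \<in> carrier R. \<forall>s\<in>carrier R. \<forall>g\<in>range (Pair 0). rc (s \<otimes>\<^bsub>R\<^esub> r) g \<in> I}"
  have Q: "ideal Q R"
    unfolding Q_def by (rule component_ideal) (use I.zero_closed I.a_closed in simp_all)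
  have "T \<subseteq> Q"
  proof
    fix t assume "t \<in> T"
    then obtain j where t: "t \<in> I" "t \<in> RG (0, j)" using T by blast
    have "rc (s \<otimes>\<^bsub>R\<^esub> t) (0, i) \<in> I" if s: "s \<in> carrier R" for s i
    proof (cases "j \<le> i")
      case True
      have "rc (s \<otimes>\<^bsub>R\<^esub> t) (0, i) = rc s (0, i - j) \<otimes>\<^bsub>R\<^esub> t"
        using rc_mult(1)[OF t(2) s, of "(0, i - j)"] True by simp
      moreover have "rc s (0, i - j) \<in> carrier A"
        by (rule AG_carrier[OF rc_RG[OF s]])
      ultimately show ?thesis using I.I_l_closed[OF t(1)] by simp
    next
      case False
      have "rc (s \<otimes>\<^bsub>R\<^esub> t) (0, i) = \<zero>\<^bsub>R\<^esub>"
        by (rule rc_mult(2)[OF t(2) s]) (use False in \<open>auto simp: prod_eq_iff\<close>)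
      then show ?thesis using I.zero_closed by simp
    qed
    then show "t \<in> Q" unfolding Q_def using RG.H_carrier[OF t(2)] by blast
  qed
  then have "a \<in> Q" using R.genideal_minimal[OF Q] a(2) by blast
  then have "rc (\<one>\<^bsub>R\<^esub> \<otimes>\<^bsub>R\<^esub> a) (0, i) \<in> I" unfolding Q_def using R.one_closed by blast
  then show ?thesis
    using RG.H_carrier[OF a(1)] by (simp add: RG.grade_comp_hom_elt[OF a(1)])
qed

text \<open>The ideals generated in \<open>R\<close> by the homogeneous elements of the
  \<open>I k\<close> become stationary, and contraction brings this back to \<open>A\<close>. The
  ideals need not be homogeneous, so the conclusion concerns their homogeneous elements.\<close>

lemma A_ideal_chain:
  assumes I: "\<And>k. ideal (I k) A" and inc: "\<And>k. I k \<subseteq> I (Suc k)"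
  shows "\<exists>n. \<forall>m\<ge>n. \<forall>i. I m \<inter> RG (0, i) \<subseteq> I n"
proof -
  define J where "J k = genideal R (I k \<inter> (\<Union>j. RG (0, j)))" for k
  have sub: "I k \<inter> (\<Union>j. RG (0, j)) \<subseteq> carrier R" for k
    using RG.H_carrier by blast
  have JI: "ideal (J k) R" for k
    unfolding J_def by (rule R.genideal_ideal[OF sub])
  then have J: "submodule (J k) R (regular_module R)" for k
    unfolding submodule_regular_iff[OF R_cring] .
  have Jc: "J k \<subseteq> carrier R" for k
    by (rule subsetI) (rule ideal.Icarr[OF JI])
  have "J k \<subseteq> J (Suc k)" for k
    unfolding J_def mod_span_regular[OF R_cring, symmetric] by (rule mod_span_mono) (use inc in blast)
  then obtain n where n: "\<forall>m\<ge>n. J m = J n"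
    using acc_onD[where N = J, OF acc_on_regular[OF R_cring noeth] J Jc] by blast
  have "a \<in> I n" if "m \<ge> n" "a \<in> I m" "a \<in> RG (0, i)" for m a i
  proof -
    have "a \<in> J m"
      unfolding J_def using R.genideal_self[OF sub] that(2,3) by blast
    then have "a \<in> genideal R (I n \<inter> (\<Union>j. RG (0, j)))"
      using n that(1) unfolding J_def by blast
    then show ?thesis by (rule genideal_contraction[OF I order_refl that(3)])
  qed
  then show ?thesis by blast
qed

end

locale standard_bigraded_ring = bigraded_ring +
  assumes gen_R: "generate_ring R (graded_row R RG 0 \<union> (\<Union>j. graded_row R RG (axis j 1))) = carrier R"
    and gen_A: "generate_ring A (AG 0 \<union> AG 1) = carrier A"
begin

text \<open>The last property says that \<open>R\<close> modulo the ideal of \<open>xs\<close> lives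
  in degrees with \<open>c \<le> b |m|\<close>. The list \<open>xs\<close> generates the ideal
  spanned by \<open>R_(0,1)\<close>, and \<open>b\<close> bounds the degrees of finitely many
  generators of the ideals spanned by the rows \<open>e_j\<close>.\<close>

lemma exists_generators:
  obtains xs b where "set xs \<subseteq> RG (0, 1)"
    and "\<And>i. i > 0 \<Longrightarrow> RG (0, i) \<subseteq> genideal A (set xs)"
    and "\<And>r m c. r \<in> carrier R \<Longrightarrow> b * total_degree m < c \<Longrightarrow> rc r (m, c) \<in> genideal R (set xs)"
proof -
  have "RG (0, 1) \<subseteq> carrier R" using RG.H_carrier by blast
  then obtain S where S: "finite S" "S \<subseteq> RG (0, 1)" "RG (0, 1) \<subseteq> genideal R S"
    using noetherian_finite_subset[OF R_cring noeth] by blast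
  obtain xs where xs: "set xs = S" using finite_list[OF S(1)] by blast
  have SR: "S \<subseteq> carrier R" and SA: "S \<subseteq> carrier A"
    using S(2) RG.H_carrier AG_carrier by blast+
  define I where "I = genideal R S"
  have I: "ideal I R" unfolding I_def by (rule R.genideal_ideal[OF SR])
  \<comment> \<open>In the row of degree zero the bound is \<open>c \<le> 0\<close> whatever
    \<open>b\<close> is: elements of degree 0 satisfy it, and those of degree 1 lie in
    \<open>I\<close>.\<close>
  have A_span: "carrier A \<subseteq> bounded_span R RG I b" for b
  proof
    fix a assume "a \<in> carrier A"
    then have "a \<in> generate_ring A (AG 0 \<union> AG 1)" using gen_A by simp
    then have "a \<in> bounded_span R RG I b \<and> a \<in> carrier A"
    proof induction
      case one
      then show ?case using bounded_span_incl[OF one_RG] A.one_closed by simp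
    next
      case (incl h)
      then consider "h \<in> RG (0, 0)" | "h \<in> RG (0, 1)" by auto
      then show ?case
        using bounded_span_incl[of h 0 0 b I] bounded_span_incl[of h 0 1 b I] S(3) AG_carrier
        unfolding I_def by cases (auto simp del: A_sel)
    next
      case (a_inv h)
      then show ?case using bounded_span_neg[OF I] A.a_inv_closed[of h] A_neg[of h] by metis
    next
      case (eng_add g h)
      then show ?case using bounded_span_add[of g I b h] A.add.m_closed[of g h] by simp
    next
      case (eng_mult g h)
      then show ?case using bounded_span_mult[OF I, of g b h] A.m_closed[of g h] by simp
    qed
    then show "a \<in> bounded_span R RG I b" ..
  qed
  have AI: "RG (0, i) \<subseteq> I" if "i > 0" for i
  proof
    fix a assume a: "a \<in> RG (0, i)"
    then have "a \<in> bounded_span R RG I 0" using A_span AG_carrier by blast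
    from bounded_span_comp[OF I this, of 0 i] show "a \<in> I"
      using that by (simp add: RG.grade_comp_hom_elt[OF a])
  qed
  have "\<exists>b. \<forall>c>b. RG (axis j 1, c) \<subseteq> I" for j
  proof -
    let ?Z = "\<Union>c. RG (axis j 1, c)"
    have "?Z \<subseteq> carrier R" using RG.H_carrier by blast
    then obtain T where T: "finite T" "T \<subseteq> ?Z" "?Z \<subseteq> genideal R T"
      using noetherian_finite_subset[OF R_cring noeth] by blast
    then have "\<forall>t\<in>T. \<exists>c. t \<in> RG (axis j 1, c)" by blast
    then obtain d where d: "\<And>t. t \<in> T \<Longrightarrow> t \<in> RG (axis j 1, d t)" by metis
    \<comment> \<open>Beyond the largest generator degree, an element of row \<open>e_j\<close> is a
      combination of generators from the same row with cofactors from \<open>R_(0, c - d t)\<close>.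
      The cofactors have positive degree and lie in \<open>I\<close>.\<close>
    have "RG (axis j 1, c) \<subseteq> I" if c: "c > Max (insert 0 (d ` T))" for c
    proof
      fix a assume a: "a \<in> RG (axis j 1, c)"
      interpret I: ideal I R by fact
      define Q where "Q = {r \<in> carrier R. \<forall>s\<in>carrier R. \<forall>g\<in>{(axis j 1, c)}. rc (s \<otimes>\<^bsub>R\<^esub> r) g \<in> I}"
      have Q: "ideal Q R"
        unfolding Q_def by (rule component_ideal[OF I.zero_closed I.a_closed])
      have "T \<subseteq> Q"
      proof
        fix t assume t: "t \<in> T"
        have "d t < c" using c T(1) t by simp
        have "rc (s \<otimes>\<^bsub>R\<^esub> t) (axis j 1, c) \<in> I" if s: "s \<in> carrier R" for s
        proof -
          have "rc (s \<otimes>\<^bsub>R\<^esub> t) (axis j 1, c) = rc s (0, c - d t) \<otimes>\<^bsub>R\<^esub> t"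
            using rc_mult(1)[OF d[OF t] s, of "(0, c - d t)"] \<open>d t < c\<close> by simp
          moreover have "rc s (0, c - d t) \<in> I"
            using AI[of "c - d t"] rc_RG[OF s, of "(0, c - d t)"] \<open>d t < c\<close> by auto
          ultimately show ?thesis using I.I_r_closed RG.H_carrier[OF d[OF t]] by simp
        qed
        then show "t \<in> Q" unfolding Q_def using RG.H_carrier[OF d[OF t]] by blast
      qed
      then have "a \<in> Q" using R.genideal_minimal[OF Q] T(3) a by blast
      then have "rc (\<one>\<^bsub>R\<^esub> \<otimes>\<^bsub>R\<^esub> a) (axis j 1, c) \<in> I" unfolding Q_def using R.one_closed by blast
      then show "a \<in> I"
        using RG.H_carrier[OF a] by (simp add: RG.grade_comp_hom_elt[OF a])
    qed
    then show ?thesis by blast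
  qed
  then obtain bj where bj: "\<And>j c. c > bj j \<Longrightarrow> RG (axis j 1, c) \<subseteq> I" by metis
  define b where "b = Max (range bj)"
  have b: "bj j \<le> b" for j unfolding b_def by simp
  have row: "graded_row R RG (axis j 1) \<subseteq> bounded_span R RG I b" for j
  proof
    fix r assume "r \<in> graded_row R RG (axis j 1)"
    then show "r \<in> bounded_span R RG I b"
      unfolding graded_row_def
    proof (induction rule: RG.partial_sum_induct)
      case zero then show ?case by (rule bounded_span.zero)
    next
      case (incl i y)
      then obtain c where i: "i = (axis j 1, c)" by auto
      have "b * total_degree (axis j 1 :: nat ^ _) < c \<Longrightarrow> y \<in> I"
        using bj[of j c] b[of j] incl(2) unfolding i by auto
      with incl(2) show ?case unfolding i by (rule bounded_span_incl)
    next
      case (add i y z) then show ?case using bounded_span_add by blast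
    qed
  qed
  have "graded_row R RG 0 \<subseteq> bounded_span R RG I b"
    using A_span[of b] by (simp add: graded_row_def)
  then have "generate_ring R (graded_row R RG 0 \<union> (\<Union>j. graded_row R RG (axis j 1))) \<subseteq> bounded_span R RG I b"
    using row by (intro generate_ring_bounded_span[OF I]) blast
  then have R_span: "carrier R \<subseteq> bounded_span R RG I b" using gen_R by simp
  show thesis
  proof (rule that[of xs b])
    show "set xs \<subseteq> RG (0, 1)" using xs S by simp
    show "RG (0, i) \<subseteq> genideal A (set xs)" if "i > 0" for i
    proof
      fix a assume a: "a \<in> RG (0, i)"
      \<comment> \<open>So far positive degrees of \<open>A\<close> lie in the ideal generated over
        \<open>R\<close>; contraction gives the ideal generated over \<open>A\<close>.\<close>
      have "S \<subseteq> genideal A S \<inter> (\<Union>j. RG (0, j))"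
        using A.genideal_self[OF SA] S(2) by blast
      then show "a \<in> genideal A (set xs)"
        unfolding xs using genideal_contraction[OF A.genideal_ideal[OF SA] _ a] AI[OF that] a
        unfolding I_def by blast
    qed
    show "rc r (m, c) \<in> genideal R (set xs)" if "r \<in> carrier R" "b * total_degree m < c" for r m c
      using bounded_span_comp[OF I _ that(2)] R_span that(1) unfolding xs I_def by blast
  qed
qed

end

subsection \<open>Koszul homology of a bigraded module\<close>

locale bigraded_module = standard_bigraded_ring R RG
  for R :: "'r ring" and RG :: "(nat ^ 't) \<times> nat \<Rightarrow> 'r set" +
  fixes L :: "('r, 'm) module" and LG :: "(nat ^ 't) \<times> nat \<Rightarrow> 'm set"
  assumes gm: "graded_module R RG L LG" and fg: "fin_gen_module R L"
begin

lemma L_module: "Module.module R L"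
  using gm by (simp add: graded_module_def)

sublocale L: Module.module R L by (rule L_module)

sublocale LG: grading L LG
  by unfold_locales (use gm in \<open>simp add: graded_module_def\<close>)

lemma smult_LG: "a \<in> RG i \<Longrightarrow> x \<in> LG j \<Longrightarrow> a \<odot>\<^bsub>L\<^esub> x \<in> LG (i + j)"
  using gm unfolding graded_module_def by blast

text \<open>The row as a complex concentrated in cohomological degree 0; negative internal degrees
  are zero.\<close>

definition row_strand :: "nat ^ 't \<Rightarrow> int \<Rightarrow> int \<Rightarrow> 'm set" where
  "row_strand n i \<mu> = (if i = 0 then int_grading L (row_grading LG n) \<mu> else {\<zero>\<^bsub>L\<^esub>})"

definition row_proj :: "nat ^ 't \<Rightarrow> int \<Rightarrow> int \<Rightarrow> 'm \<Rightarrow> 'm" where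
  "row_proj n i \<mu> x = (if i = 0 \<and> 0 \<le> \<mu> then grade_comp L LG x (n, nat \<mu>) else \<zero>\<^bsub>L\<^esub>)"

lemma row_strand_cases:
  assumes "x \<in> row_strand n i \<mu>"
  obtains "x = \<zero>\<^bsub>L\<^esub>" | "i = 0" "0 \<le> \<mu>" "x \<in> LG (n, nat \<mu>)"
  using assms by (auto simp: row_strand_def int_grading_def row_grading_def split: if_splits)

lemma row_strandI: "x \<in> LG (n, nat \<mu>) \<Longrightarrow> i = 0 \<Longrightarrow> 0 \<le> \<mu> \<Longrightarrow> x \<in> row_strand n i \<mu>"
  by (simp add: row_strand_def int_grading_def row_grading_def)

lemma row_strand_zero: "\<zero>\<^bsub>L\<^esub> \<in> row_strand n i \<mu>"
  by (simp add: row_strand_def int_grading_def row_grading_def)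

lemma row_strand_carrier: "row_strand n i \<mu> \<subseteq> carrier L"
  using LG.H_carrier by (auto elim!: row_strand_cases)

lemma row_strand_row: "row_strand n i \<mu> \<subseteq> carrier (row_module L LG n)"
  using LG.partial_sum_zero LG.partial_sum_incl[of _ "{n} \<times> UNIV"]
  by (auto elim!: row_strand_cases simp: row_module_def graded_row_def)

lemma row_strand_family:
  assumes "Y \<subseteq> RG (0, 1)"
  shows "strand_family R L (\<lambda>_. \<zero>\<^bsub>L\<^esub>) Y (row_strand n)"
  unfolding strand_family_def
proof (intro conjI allI ballI)
  show "Y \<subseteq> carrier R" using assms RG.H_carrier by blast
  fix i \<mu>
  show "row_strand n i \<mu> \<subseteq> carrier L" by (rule row_strand_carrier)
  show z: "\<zero>\<^bsub>L\<^esub> \<in> row_strand n j \<nu>" for j \<nu> by (rule row_strand_zero)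
  fix a assume a: "a \<in> row_strand n i \<mu>"
  show "\<zero>\<^bsub>L\<^esub> \<in> row_strand n (i + 1) \<mu>" by (rule row_strand_zero)
  show "\<ominus>\<^bsub>L\<^esub> a \<in> row_strand n i \<mu>"
    using a by (cases rule: row_strand_cases) (auto intro: z row_strandI LG.H_neg)
  show "a \<oplus>\<^bsub>L\<^esub> b \<in> row_strand n i \<mu>" if b: "b \<in> row_strand n i \<mu>" for b
    using a
  proof (cases rule: row_strand_cases)
    case 1
    moreover have "b \<in> carrier L" using b row_strand_carrier by blast
    ultimately show ?thesis using b by simp
  next
    case a: 2
    from b show ?thesis
    proof (cases rule: row_strand_cases)
      case 1
      moreover have "a \<in> carrier L" using a LG.H_carrier by blast
      ultimately show ?thesis using \<open>a \<in> row_strand n i \<mu>\<close> by simp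
    next
      case 2
      then show ?thesis using a LG.H_add by (intro row_strandI) auto
    qed
  qed
  show "y \<odot>\<^bsub>L\<^esub> a \<in> row_strand n i (\<mu> + 1)" if y: "y \<in> Y" for y
  proof -
    have yG: "y \<in> RG (0, 1)" using y assms by blast
    from a show ?thesis
    proof (cases rule: row_strand_cases)
      case 1
      then show ?thesis using z RG.H_carrier[OF yG] by simp
    next
      case 2
      have "y \<odot>\<^bsub>L\<^esub> a \<in> LG (n, nat (\<mu> + 1))"
        using smult_LG[OF yG 2(3)] 2(2) by (simp add: nat_add_distrib)
      then show ?thesis using 2 by (intro row_strandI) auto
    qed
  qed
qed

text \<open>The part of \<open>r x\<close> in a given degree is the component of \<open>r\<close> in
  the difference of degrees, applied to \<open>x\<close>. Subtraction on natural vectors truncates,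
  so the existence of \<open>g\<close> with \<open>n = g + n'\<close> is demanded explicitly;
  without it there is no such component.\<close>

lemma row_proj_act:
  assumes r: "r \<in> carrier R" and x: "x \<in> row_strand n' i' \<mu>'"
  shows "row_proj n i \<mu> (r \<odot>\<^bsub>L\<^esub> x) =
    (if i - i' = 0 \<and> 0 \<le> \<mu> - \<mu>' \<and> (\<exists>g. n = g + n') then rc r (n - n', nat (\<mu> - \<mu>')) else \<zero>\<^bsub>R\<^esub>) \<odot>\<^bsub>L\<^esub> x"
  using x
proof (cases rule: row_strand_cases)
  case 1
  then show ?thesis using r by (simp add: row_proj_def)
next
  case 2
  have xc: "x \<in> carrier L" by (rule LG.H_carrier[OF 2(3)])
  note * = grade_comp_image[OF RG.grading_axioms LG.grading_axioms, where f = "\<lambda>r. r \<odot>\<^bsub>L\<^esub> x"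
      and s = "\<lambda>g. g + (n', nat \<mu>')" and I = UNIV]
  have 1: "grade_comp L LG (r \<odot>\<^bsub>L\<^esub> x) (g + (n', nat \<mu>')) = rc r g \<odot>\<^bsub>L\<^esub> x" for g
    by (rule *(1)) (use xc 2 r smult_LG RG.partial_sum_UNIV in \<open>auto simp: L.smult_l_distr inj_on_def\<close>)
  have 0: "grade_comp L LG (r \<odot>\<^bsub>L\<^esub> x) h = \<zero>\<^bsub>L\<^esub>" if "\<And>g. h \<noteq> g + (n', nat \<mu>')" for h
    by (rule *(2)) (use that xc 2 r smult_LG RG.partial_sum_UNIV in \<open>auto simp: L.smult_l_distr inj_on_def\<close>)
  show ?thesis
  proof (cases "i = 0 \<and> 0 \<le> \<mu>")
    case False
    then show ?thesis using 2 xc by (auto simp: row_proj_def)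
  next
    case i: True
    show ?thesis
    proof (cases "\<mu>' \<le> \<mu> \<and> (\<exists>g. n = g + n')")
      case True
      then obtain g where g: "n = g + n'" by blast
      have e: "(n, nat \<mu>) = (g, nat (\<mu> - \<mu>')) + (n', nat \<mu>')"
        using True 2 g by (simp add: nat_diff_distrib)
      have "row_proj n i \<mu> (r \<odot>\<^bsub>L\<^esub> x) = grade_comp L LG (r \<odot>\<^bsub>L\<^esub> x) (n, nat \<mu>)"
        using i by (simp add: row_proj_def)
      also have "\<dots> = rc r (g, nat (\<mu> - \<mu>')) \<odot>\<^bsub>L\<^esub> x"
        unfolding e by (rule 1)
      finally have "row_proj n i \<mu> (r \<odot>\<^bsub>L\<^esub> x) = rc r (g, nat (\<mu> - \<mu>')) \<odot>\<^bsub>L\<^esub> x" .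
      moreover have "n - n' = g" using g by simp
      ultimately show ?thesis using True i 2 by auto
    next
      case False
      have "(n, nat \<mu>) \<noteq> g + (n', nat \<mu>')" for g
      proof
        assume *: "(n, nat \<mu>) = g + (n', nat \<mu>')"
        then have "n = fst g + n'" "nat \<mu> = snd g + nat \<mu>'" by (simp_all add: prod_eq_iff)
        then show False using False i 2 by auto
      qed
      then have "row_proj n i \<mu> (r \<odot>\<^bsub>L\<^esub> x) = \<zero>\<^bsub>L\<^esub>"
        using i 0 by (simp add: row_proj_def)
      then show ?thesis using False xc by auto
    qed
  qed
qed

lemma row_proj_shift:
  assumes y: "y \<in> RG (0, 1)" and x: "x \<in> carrier L"
  shows "row_proj n i (\<mu> + 1) (y \<odot>\<^bsub>L\<^esub> x) = y \<odot>\<^bsub>L\<^esub> row_proj n i \<mu> x"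
proof -
  have yR: "y \<in> carrier R" by (rule RG.H_carrier[OF y])
  have yL: "y \<odot>\<^bsub>L\<^esub> z \<in> LG (g + (0, 1))" if "z \<in> LG g" for z g
    using smult_LG[OF y that] by (simp add: add.commute)
  note * = grade_comp_image[OF LG.grading_axioms LG.grading_axioms, where f = "\<lambda>x. y \<odot>\<^bsub>L\<^esub> x"
      and s = "\<lambda>g. g + (0, 1)" and I = UNIV]
  have 1: "grade_comp L LG (y \<odot>\<^bsub>L\<^esub> x) (g + (0, 1)) = y \<odot>\<^bsub>L\<^esub> grade_comp L LG x g" for g
    by (rule *(1)) (use x yR yL LG.partial_sum_UNIV in \<open>auto simp: L.smult_r_distr inj_on_def\<close>)
  have 0: "grade_comp L LG (y \<odot>\<^bsub>L\<^esub> x) h = \<zero>\<^bsub>L\<^esub>" if "\<And>g. h \<noteq> g + (0, 1)" for h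
    by (rule *(2)) (use that x yR yL LG.partial_sum_UNIV in \<open>auto simp: L.smult_r_distr inj_on_def\<close>)
  consider "i \<noteq> 0 \<or> \<mu> + 1 < 0" | "i = 0" "\<mu> + 1 = 0" | "i = 0" "0 \<le> \<mu>" by linarith
  then show ?thesis
  proof cases
    case 1
    then show ?thesis using yR by (auto simp: row_proj_def)
  next
    \<comment> \<open>The boundary case \<open>\<mu> = -1\<close>: the right side is zero by
      convention, and the left side is zero because \<open>y x\<close> has no part of second degree
      0.\<close>
    case 2
    have "(n, 0) \<noteq> g + (0, 1)" for g :: "(nat ^ 't) \<times> nat" by (auto simp: prod_eq_iff)
    from 0[OF this] 2 show ?thesis using yR by (auto simp: row_proj_def)
  next
    case 3
    then have "(n, nat (\<mu> + 1)) = (n, nat \<mu>) + (0, 1)" by (simp add: nat_add_distrib)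
    then show ?thesis using 3 1[of "(n, nat \<mu>)"] by (simp add: row_proj_def)
  qed
qed

lemma koszul_exact_large_degree:
  assumes xs: "set xs \<subseteq> RG (0, 1)"
    and b: "\<And>r m c. r \<in> carrier R \<Longrightarrow> b * total_degree m < c \<Longrightarrow> rc r (m, c) \<in> genideal R (set xs)"
  shows "\<exists>k0. \<forall>n i \<mu>. \<mu> > int (b * total_degree n) + k0 \<longrightarrow>
    exact_at (kos_module L xs) (kos_diff L (\<lambda>_. \<zero>\<^bsub>L\<^esub>) xs) (kos_strand (row_strand n) xs) i \<mu>"
proof (rule kos_exact_at_large_degree[where p = row_proj and c = "\<lambda>n n' r i \<mu>.
      if i = 0 \<and> 0 \<le> \<mu> \<and> (\<exists>g. n = g + n') then rc r (n - n', nat \<mu>) else \<zero>\<^bsub>R\<^esub>"])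
  have xsR: "set xs \<subseteq> carrier R" using xs RG.H_carrier by blast
  show "Module.module R L" by (rule L_module)
  show "acc_on R L (carrier L)" by (rule acc_on_fin_gen[OF R_cring noeth fg])
  show "set xs \<subseteq> carrier R" by (rule xsR)
  show "row_strand n i \<mu> \<subseteq> carrier L" for n i \<mu> by (rule row_strand_carrier)
  show "row_proj n i \<mu> x \<in> row_strand n i \<mu>" if "x \<in> carrier L" for n i \<mu> x
    using LG.grade_comp_props(1)[OF that] row_strandI row_strand_zero by (auto simp: row_proj_def)
  show "row_proj n i \<mu> x = x" if "x \<in> row_strand n i \<mu>" for n i \<mu> x
    using that
    by (cases rule: row_strand_cases) (auto simp: row_proj_def LG.grade_comp_hom_elt)
  show "row_proj n i \<mu> (x \<oplus>\<^bsub>L\<^esub> y) = row_proj n i \<mu> x \<oplus>\<^bsub>L\<^esub> row_proj n i \<mu> y"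
    if "x \<in> carrier L" "y \<in> carrier L" for n i \<mu> x y
    using that by (simp add: row_proj_def LG.grade_comp_add)
  show "row_proj n i (\<mu> + 1) (y \<odot>\<^bsub>L\<^esub> x) = y \<odot>\<^bsub>L\<^esub> row_proj n i \<mu> x"
    if "y \<in> set xs" "x \<in> carrier L" for n i \<mu> x y
    using row_proj_shift that xs by blast
  show "row_proj n i \<mu> (r \<odot>\<^bsub>L\<^esub> x) = (if i - i' = 0 \<and> 0 \<le> \<mu> - \<mu>' \<and> (\<exists>g. n = g + n')
      then rc r (n - n', nat (\<mu> - \<mu>')) else \<zero>\<^bsub>R\<^esub>) \<odot>\<^bsub>L\<^esub> x"
    if "r \<in> carrier R" "x \<in> row_strand n' i' \<mu>'" for n n' i \<mu> i' \<mu>' r x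
    using row_proj_act that by blast
  show "(if i = 0 \<and> 0 \<le> \<mu> \<and> (\<exists>g. n = g + n') then rc r (n - n', nat \<mu>) else \<zero>\<^bsub>R\<^esub>) \<in> genideal R (set xs)"
    if r: "r \<in> carrier R" and \<mu>: "int (b * total_degree n) < \<mu>" for n n' r i \<mu>
  proof (cases "\<exists>g. n = g + n'")
    case True
    then obtain g where g: "n = g + n'" by blast
    \<comment> \<open>The total degree of \<open>n - n'\<close> is at most that of \<open>n\<close>,
      so the bound for \<open>n\<close> covers generators from every row \<open>n'\<close>.\<close>
    have "b * total_degree (n - n') \<le> b * total_degree n"
      unfolding g by (simp add: total_degree_add)
    then have "b * total_degree (n - n') < nat \<mu>" using \<mu> by linarith
    from b[OF r this] show ?thesis
      using additive_subgroup.zero_closed[OF ideal.axioms(1)[OF R.genideal_ideal[OF xsR]]] by simp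
  next
    case False
    then show ?thesis
      using additive_subgroup.zero_closed[OF ideal.axioms(1)[OF R.genideal_ideal[OF xsR]]] by simp
  qed
qed

end

section \<open>Injective modules and torsion\<close>

context bigraded_ring
begin

lemma pow_RG: "y \<in> RG (0, 1) \<Longrightarrow> y [^]\<^bsub>A\<^esub> (l::nat) \<in> RG (0, l)"
proof (induction l)
  case 0
  then show ?case using one_RG by simp
next
  case (Suc l)
  then show ?case using mult_RG[of "y [^]\<^bsub>A\<^esub> l" "(0, l)" y "(0, 1)"] by simp
qed

text \<open>The assignment \<open>y\<^sup>l\<^sup>+\<^sup>k \<mapsto> y\<^sup>l u\<close> is well defined on \<open>ann u + (y\<^sup>l\<^sup>+\<^sup>k)\<close> once the
  annihilators of the \<open>y\<^sup>l u\<close> have become stationary; Baer's criterion extends it. The element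
  obtained is killed by \<open>ann u\<close>, so no torsion condition is lost and Artin--Rees is not needed.\<close>

lemma graded_injective_divisible:
  fixes J :: "('r, 'x) module"
  assumes J: "graded_injective A AG J JG" and y: "y \<in> RG (0, 1)" and u: "u \<in> JG (\<nu> + int k)"
  shows "\<exists>u'\<in>JG \<nu>. (\<forall>a\<in>carrier A. a \<odot>\<^bsub>J\<^esub> u = \<zero>\<^bsub>J\<^esub> \<longrightarrow> a \<odot>\<^bsub>J\<^esub> u' = \<zero>\<^bsub>J\<^esub>) \<and>
    (\<exists>l::nat. (y [^]\<^bsub>A\<^esub> l) \<odot>\<^bsub>J\<^esub> (u \<ominus>\<^bsub>J\<^esub> (y [^]\<^bsub>A\<^esub> k) \<odot>\<^bsub>J\<^esub> u') = \<zero>\<^bsub>J\<^esub>)"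
proof -
  have gJ: "graded_module A (int_grading A AG) J JG"
    using J by (simp add: graded_injective_def)
  interpret J: Module.module A J using gJ by (simp add: graded_module_def)
  interpret JG: grading J JG
    by unfold_locales (use gJ in \<open>simp add: graded_module_def\<close>)
  have smult_JG: "a \<odot>\<^bsub>J\<^esub> x \<in> JG (int i + j)" if "a \<in> RG (0, i)" "x \<in> JG j" for a x i j
  proof -
    have "a \<in> int_grading A AG (int i)" using that(1) by (simp add: int_grading_def)
    then show ?thesis using gJ that(2) unfolding graded_module_def by blast
  qed
  have rcA: "rc a (0, i) \<in> carrier A" if "a \<in> carrier A" for a i
    by (rule AG_carrier[OF rc_RG[OF A_carrier[OF that]]])
  have comp_smult: "grade_comp J JG (a \<odot>\<^bsub>J\<^esub> w) (int i + j) = rc a (0, i) \<odot>\<^bsub>J\<^esub> w"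
    if a: "a \<in> carrier A" and w: "w \<in> JG j" for a w i j
  proof -
    have wc: "w \<in> carrier J" by (rule JG.H_carrier[OF w])
    \<comment> \<open>Within row zero a degree is determined by its second entry, so the shift into
      the integer grading of \<open>J\<close> is injective.\<close>
    note * = grade_comp_image(1)[OF RG.grading_axioms JG.grading_axioms, where f = "\<lambda>a. a \<odot>\<^bsub>J\<^esub> w"
        and s = "\<lambda>g. int (snd g) + j" and I = "{0} \<times> UNIV" and i = "(0, i)"]
    have "grade_comp J JG (a \<odot>\<^bsub>J\<^esub> w) (int (snd (0 :: nat ^ 't, i)) + j) = rc a (0, i) \<odot>\<^bsub>J\<^esub> w"
    proof (rule *)
      show "(x \<oplus>\<^bsub>R\<^esub> z) \<odot>\<^bsub>J\<^esub> w = x \<odot>\<^bsub>J\<^esub> w \<oplus>\<^bsub>J\<^esub> z \<odot>\<^bsub>J\<^esub> w"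
        if "x \<in> partial_sum R RG ({0} \<times> UNIV)" "z \<in> partial_sum R RG ({0} \<times> UNIV)" for x z
        using J.smult_l_distr[of x z w] that wc by simp
      show "x \<odot>\<^bsub>J\<^esub> w \<in> JG (int (snd g) + j)" if "g \<in> {0} \<times> UNIV" "x \<in> RG g" for g x
        using smult_JG[OF _ w, of x "snd g"] that by (cases g) auto
      show "\<zero>\<^bsub>R\<^esub> \<odot>\<^bsub>J\<^esub> w = \<zero>\<^bsub>J\<^esub>" using J.smult_l_null[OF wc] by simp
      show "inj_on (\<lambda>g. int (snd g) + j) ({0 :: nat ^ 't} \<times> UNIV)" by (auto simp: inj_on_def)
      show "a \<in> partial_sum R RG ({0} \<times> UNIV)" using a by simp
    qed simp
    then show ?thesis by simp
  qed
  have rc_off: "rc a g = \<zero>\<^bsub>R\<^esub>" if "a \<in> carrier A" "g \<notin> {0} \<times> UNIV" for a g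
    using grade_comp_image(4)[OF RG.grading_axioms RG.grading_axioms, where f = "\<lambda>a. a" and s = "\<lambda>g. g"
        and I = "{0} \<times> UNIV" and x = a and i = g] that by auto
  have yA: "y \<in> carrier A" using AG_carrier y by blast
  have uc: "u \<in> carrier J" by (rule JG.H_carrier[OF u])
  have powA: "y [^]\<^bsub>A\<^esub> (l::nat) \<in> carrier A" for l by (rule A.nat_pow_closed[OF yA])
  define v where "v l = (y [^]\<^bsub>A\<^esub> (l::nat)) \<odot>\<^bsub>J\<^esub> u" for l
  have v: "v l \<in> JG (int l + (\<nu> + int k))" for l
    unfolding v_def by (rule smult_JG[OF pow_RG[OF y] u])
  have vc: "v l \<in> carrier J" for l by (rule JG.H_carrier[OF v])
  have v0: "v 0 = u" unfolding v_def using uc J.smult_one by simp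
  have v_add: "v (l + m) = (y [^]\<^bsub>A\<^esub> m) \<odot>\<^bsub>J\<^esub> v l" for l m
  proof -
    have "y [^]\<^bsub>A\<^esub> (l + m) = (y [^]\<^bsub>A\<^esub> m) \<otimes>\<^bsub>A\<^esub> (y [^]\<^bsub>A\<^esub> l)"
      using A.nat_pow_mult[OF yA, of m l] by (simp add: add.commute)
    then show ?thesis unfolding v_def using J.smult_assoc1[OF powA powA uc] by metis
  qed
  define ann where "ann l = {a \<in> carrier A. a \<odot>\<^bsub>J\<^esub> v l = \<zero>\<^bsub>J\<^esub>}" for l
  interpret AA: Module.module A "regular_module A" by (rule regular_module) (rule A_cring)
  have ann_ideal: "ideal (ann l) A" for l
  proof -
    have "submodule (ann l) A (regular_module A)"
      unfolding AA.submodule_iff ann_def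
      using vc by (auto simp: J.smult_l_distr J.smult_assoc1 simp del: A_sel)
    then show ?thesis using submodule_regular_iff[OF A_cring] by blast
  qed
  have ann_inc: "ann l \<subseteq> ann (Suc l)" for l
  proof
    fix a assume a: "a \<in> ann l"
    then have ac: "a \<in> carrier A" "a \<odot>\<^bsub>J\<^esub> v l = \<zero>\<^bsub>J\<^esub>" unfolding ann_def by auto
    have "v (Suc l) = y \<odot>\<^bsub>J\<^esub> v l" using v_add[of l 1] A.nat_pow_eone[OF yA] by simp
    then have "a \<odot>\<^bsub>J\<^esub> v (Suc l) = y \<odot>\<^bsub>J\<^esub> (a \<odot>\<^bsub>J\<^esub> v l)"
      using J.smult_assoc1[OF ac(1) yA vc] J.smult_assoc1[OF yA ac(1) vc] A.m_comm[OF ac(1) yA] by metis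
    then show "a \<in> ann (Suc l)" unfolding ann_def using ac J.smult_r_null[OF yA] by simp
  qed
  have ann_comp: "rc a (0, i) \<in> ann l" if "a \<in> ann l" for a i l
  proof -
    have a: "a \<in> carrier A" "a \<odot>\<^bsub>J\<^esub> v l = \<zero>\<^bsub>J\<^esub>" using that unfolding ann_def by auto
    have "rc a (0, i) \<odot>\<^bsub>J\<^esub> v l = \<zero>\<^bsub>J\<^esub>" using comp_smult[OF a(1) v[of l], of i] a(2) by simp
    then show ?thesis unfolding ann_def using rcA[OF a(1)] by blast
  qed
  \<comment> \<open>Stationarity on homogeneous elements is enough: the \<open>v l\<close> are
    homogeneous, so their annihilators contain the components of their elements.\<close>
  obtain l where l: "\<And>m i. m \<ge> l \<Longrightarrow> ann m \<inter> RG (0, i) \<subseteq> ann l"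
    using A_ideal_chain[of ann, OF ann_ideal ann_inc] by blast
  have in_ideal: "a \<in> I" if I: "ideal I A" and a: "a \<in> carrier A" "\<And>i. rc a (0, i) \<in> I" for I a
  proof -
    interpret I: ideal I A by fact
    show ?thesis
    proof (rule RG.in_carrier_if_comps[OF A_carrier[OF a(1)]])
      show z: "\<zero>\<^bsub>R\<^esub> \<in> I" using I.zero_closed by simp
      show "rc a g \<in> I" for g
      proof (cases "g \<in> {0} \<times> UNIV")
        case True
        then obtain j where "g = (0, j)" by blast
        then show ?thesis using a(2)[of j] by simp
      next
        case False
        from rc_off[OF a(1) False] z show ?thesis by simp
      qed
      show "x \<oplus>\<^bsub>R\<^esub> z \<in> I" if "x \<in> I" "z \<in> I" for x z using I.a_closed[OF that] by simp
    qed
  qed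
  \<comment> \<open>Beyond \<open>l\<close> the annihilators no longer grow: \<open>y^k\<close> acts
    injectively on the submodule generated by \<open>v l\<close>.\<close>
  have stat: "a \<odot>\<^bsub>J\<^esub> v l = \<zero>\<^bsub>J\<^esub>" if "a \<in> carrier A" "a \<odot>\<^bsub>J\<^esub> v (l + k) = \<zero>\<^bsub>J\<^esub>" for a
  proof -
    have alk: "a \<in> ann (l + k)" using that unfolding ann_def by blast
    have "rc a (0, i) \<in> ann l" for i
      by (rule subsetD[OF l[OF le_add1]], rule IntI[OF ann_comp[OF alk] rc_RG[OF A_carrier[OF that(1)]]])
    then have "a \<in> ann l" by (rule in_ideal[OF ann_ideal that(1)])
    then show ?thesis unfolding ann_def by blast
  qed
  define t where "t = y [^]\<^bsub>A\<^esub> (l + k)"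
  have tG: "t \<in> RG (0, l + k)" unfolding t_def by (rule pow_RG[OF y])
  have tA: "t \<in> carrier A" by (rule AG_carrier[OF tG])
  have tu: "t \<odot>\<^bsub>J\<^esub> u = v (l + k)" unfolding t_def v_def ..
  define K where "K = {q \<oplus>\<^bsub>A\<^esub> b \<otimes>\<^bsub>A\<^esub> t | q b. q \<in> ann 0 \<and> b \<in> carrier A}"
  have annA: "q \<in> carrier A" if "q \<in> ann l'" for q l' using that unfolding ann_def by blast
  have KI: "q \<oplus>\<^bsub>A\<^esub> b \<otimes>\<^bsub>A\<^esub> t \<in> K" if "q \<in> ann 0" "b \<in> carrier A" for q b
    unfolding K_def using that by blast
  have KA: "K \<subseteq> carrier A" unfolding K_def using annA tA by (auto simp del: A_sel)
  interpret ann0: ideal "ann 0" A by (rule ann_ideal)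
  have K_ideal: "ideal K A"
  proof -
    have "submodule K A (regular_module A)"
      unfolding AA.submodule_iff
    proof (intro conjI ballI)
      show "K \<subseteq> carrier (regular_module A)" using KA by simp
      show "\<zero>\<^bsub>regular_module A\<^esub> \<in> K"
        using KI[OF ann0.zero_closed A.zero_closed] tA by (simp del: A_sel)
    next
      fix a b assume "a \<in> K" "b \<in> K"
      then obtain q p q' p' where 1: "q \<in> ann 0" "p \<in> carrier A" "q' \<in> ann 0" "p' \<in> carrier A"
        "a = q \<oplus>\<^bsub>A\<^esub> p \<otimes>\<^bsub>A\<^esub> t" "b = q' \<oplus>\<^bsub>A\<^esub> p' \<otimes>\<^bsub>A\<^esub> t" unfolding K_def by blast
      have "a \<oplus>\<^bsub>A\<^esub> b = (q \<oplus>\<^bsub>A\<^esub> q') \<oplus>\<^bsub>A\<^esub> (p \<oplus>\<^bsub>A\<^esub> p') \<otimes>\<^bsub>A\<^esub> t"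
        using 1 annA[of q] annA[of q'] tA by (simp add: A.l_distr A.a_ac del: A_sel)
      then show "a \<oplus>\<^bsub>regular_module A\<^esub> b \<in> K"
        using KI[OF ann0.a_closed[OF 1(1,3)] A.a_closed[OF 1(2,4)]] by (simp del: A_sel)
    next
      fix r a assume r: "r \<in> carrier A" and "a \<in> K"
      then obtain q p where 1: "q \<in> ann 0" "p \<in> carrier A" "a = q \<oplus>\<^bsub>A\<^esub> p \<otimes>\<^bsub>A\<^esub> t"
        unfolding K_def by blast
      have "r \<otimes>\<^bsub>A\<^esub> a = r \<otimes>\<^bsub>A\<^esub> q \<oplus>\<^bsub>A\<^esub> (r \<otimes>\<^bsub>A\<^esub> p) \<otimes>\<^bsub>A\<^esub> t"
        using 1 r annA[of q] tA by (simp add: A.r_distr A.m_assoc del: A_sel)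
      then show "r \<odot>\<^bsub>regular_module A\<^esub> a \<in> K"
        using KI[OF ann0.I_l_closed[OF 1(1) r] A.m_closed[OF r 1(2)]] by (simp del: A_sel)
    qed
    then show ?thesis using submodule_regular_iff[OF A_cring] by blast
  qed
  have annK: "ann 0 \<subseteq> K"
  proof
    fix q assume q: "q \<in> ann 0"
    show "q \<in> K" using KI[OF q A.zero_closed] annA[OF q] tA by (simp del: A_sel)
  qed
  have tK: "t \<in> K" using KI[OF ann0.zero_closed A.one_closed] tA by (simp del: A_sel)
  have K_hom: "homogeneous_ideal A AG K"
    unfolding homogeneous_ideal_def
  proof (intro conjI K_ideal equalityI)
    let ?H = "K \<inter> (\<Union>i. AG i)"
    have HA: "?H \<subseteq> carrier A" using KA by blast
    show "genideal A ?H \<subseteq> K" by (rule A.genideal_minimal[OF K_ideal]) blast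
    interpret H: ideal "genideal A ?H" A by (rule A.genideal_ideal[OF HA])
    show "K \<subseteq> genideal A ?H"
    proof
      fix a assume "a \<in> K"
      then obtain q p where 1: "q \<in> ann 0" "p \<in> carrier A" "a = q \<oplus>\<^bsub>A\<^esub> p \<otimes>\<^bsub>A\<^esub> t"
        unfolding K_def by blast
      have "t \<in> ?H" using tK tG by auto
      then have "t \<in> genideal A ?H" using A.genideal_self[OF HA] by blast
      then have 2: "p \<otimes>\<^bsub>A\<^esub> t \<in> genideal A ?H" using H.I_l_closed 1(2) by blast
      have "rc q (0, i) \<in> ?H" for i
        using annK ann_comp[OF 1(1), of i] rc_RG[OF A_carrier[OF annA[OF 1(1)]], of "(0, i)"] by auto
      then have "rc q (0, i) \<in> genideal A ?H" for i using A.genideal_self[OF HA] by blast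
      then have "q \<in> genideal A ?H" by (rule in_ideal[OF H.ideal_axioms annA[OF 1(1)]])
      then show "a \<in> genideal A ?H" using 2 H.a_closed 1(3) by blast
    qed
  qed
  define \<phi> where "\<phi> a = (SOME w. \<exists>q\<in>ann 0. \<exists>b\<in>carrier A. a = q \<oplus>\<^bsub>A\<^esub> b \<otimes>\<^bsub>A\<^esub> t \<and> w = b \<odot>\<^bsub>J\<^esub> v l)" for a
  have \<phi>: "\<phi> (q \<oplus>\<^bsub>A\<^esub> b \<otimes>\<^bsub>A\<^esub> t) = b \<odot>\<^bsub>J\<^esub> v l" if q: "q \<in> ann 0" and b: "b \<in> carrier A" for q b
  proof -
    let ?P = "\<lambda>w. \<exists>q'\<in>ann 0. \<exists>b'\<in>carrier A. q \<oplus>\<^bsub>A\<^esub> b \<otimes>\<^bsub>A\<^esub> t = q' \<oplus>\<^bsub>A\<^esub> b' \<otimes>\<^bsub>A\<^esub> t \<and> w = b' \<odot>\<^bsub>J\<^esub> v l"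
    have "?P (\<phi> (q \<oplus>\<^bsub>A\<^esub> b \<otimes>\<^bsub>A\<^esub> t))"
      unfolding \<phi>_def by (rule someI_ex) (use q b in blast)
    then obtain q' b' where 1: "q' \<in> ann 0" "b' \<in> carrier A"
      "q \<oplus>\<^bsub>A\<^esub> b \<otimes>\<^bsub>A\<^esub> t = q' \<oplus>\<^bsub>A\<^esub> b' \<otimes>\<^bsub>A\<^esub> t" "\<phi> (q \<oplus>\<^bsub>A\<^esub> b \<otimes>\<^bsub>A\<^esub> t) = b' \<odot>\<^bsub>J\<^esub> v l" by blast
    have act: "(p \<oplus>\<^bsub>A\<^esub> c \<otimes>\<^bsub>A\<^esub> t) \<odot>\<^bsub>J\<^esub> u = c \<odot>\<^bsub>J\<^esub> v (l + k)" if "p \<in> ann 0" "c \<in> carrier A" for p c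
    proof -
      have p: "p \<in> carrier A" "p \<odot>\<^bsub>J\<^esub> u = \<zero>\<^bsub>J\<^esub>" using that(1) v0 unfolding ann_def by auto
      have "(p \<oplus>\<^bsub>A\<^esub> c \<otimes>\<^bsub>A\<^esub> t) \<odot>\<^bsub>J\<^esub> u = p \<odot>\<^bsub>J\<^esub> u \<oplus>\<^bsub>J\<^esub> (c \<otimes>\<^bsub>A\<^esub> t) \<odot>\<^bsub>J\<^esub> u"
        by (rule J.smult_l_distr[OF p(1) A.m_closed[OF that(2) tA] uc])
      also have "\<dots> = c \<odot>\<^bsub>J\<^esub> v (l + k)"
        using p(2) J.smult_assoc1[OF that(2) tA uc] tu J.smult_closed[OF that(2) vc] by simp
      finally show ?thesis .
    qed
    \<comment> \<open>Two representations of one element are applied to \<open>u\<close>. The parts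
      in \<open>ann 0\<close> disappear and \<open>t u = v (l + k)\<close> remains;
      \<open>stat\<close> lowers the index to \<open>l\<close>, which makes \<open>\<phi>\<close>
      independent of the representation.\<close>
    have "b \<odot>\<^bsub>J\<^esub> v (l + k) = b' \<odot>\<^bsub>J\<^esub> v (l + k)" using act[OF q b] act[OF 1(1,2)] 1(3) by simp
    then have "(b \<ominus>\<^bsub>A\<^esub> b') \<odot>\<^bsub>J\<^esub> v (l + k) = \<zero>\<^bsub>J\<^esub>"
      using b 1(2) vc J.M.r_neg
      by (simp add: A.minus_eq J.smult_l_distr J.smult_l_minus del: A_sel)
    then have "(b \<ominus>\<^bsub>A\<^esub> b') \<odot>\<^bsub>J\<^esub> v l = \<zero>\<^bsub>J\<^esub>" using stat[of "b \<ominus>\<^bsub>A\<^esub> b'"] b 1(2) by (simp del: A_sel)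
    then have "b \<odot>\<^bsub>J\<^esub> v l \<ominus>\<^bsub>J\<^esub> b' \<odot>\<^bsub>J\<^esub> v l = \<zero>\<^bsub>J\<^esub>"
      using b 1(2) vc by (simp add: A.minus_eq J.M.minus_eq J.smult_l_distr J.smult_l_minus del: A_sel)
    then have "b \<odot>\<^bsub>J\<^esub> v l = b' \<odot>\<^bsub>J\<^esub> v l"
      using J.M.minus_eq_zero_iff b 1(2) vc by simp
    then show ?thesis using 1(4) by simp
  qed
  have \<phi>_car: "\<phi> \<in> K \<rightarrow> carrier J"
  proof
    fix a assume "a \<in> K"
    then obtain q p where "q \<in> ann 0" "p \<in> carrier A" "a = q \<oplus>\<^bsub>A\<^esub> p \<otimes>\<^bsub>A\<^esub> t" unfolding K_def by blast
    then show "\<phi> a \<in> carrier J" using \<phi> J.smult_closed[OF _ vc] by simp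
  qed
  moreover have "\<forall>a\<in>K. \<forall>b\<in>K. \<phi> (a \<oplus>\<^bsub>A\<^esub> b) = \<phi> a \<oplus>\<^bsub>J\<^esub> \<phi> b"
  proof (intro ballI)
    fix a b assume "a \<in> K" "b \<in> K"
    then obtain q p q' p' where 1: "q \<in> ann 0" "p \<in> carrier A" "q' \<in> ann 0" "p' \<in> carrier A"
      "a = q \<oplus>\<^bsub>A\<^esub> p \<otimes>\<^bsub>A\<^esub> t" "b = q' \<oplus>\<^bsub>A\<^esub> p' \<otimes>\<^bsub>A\<^esub> t" unfolding K_def by blast
    have "a \<oplus>\<^bsub>A\<^esub> b = (q \<oplus>\<^bsub>A\<^esub> q') \<oplus>\<^bsub>A\<^esub> (p \<oplus>\<^bsub>A\<^esub> p') \<otimes>\<^bsub>A\<^esub> t"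
      using 1 annA[of q] annA[of q'] tA by (simp add: A.l_distr A.a_ac del: A_sel)
    then have "\<phi> (a \<oplus>\<^bsub>A\<^esub> b) = (p \<oplus>\<^bsub>A\<^esub> p') \<odot>\<^bsub>J\<^esub> v l"
      using \<phi>[OF ann0.a_closed[OF 1(1,3)] A.a_closed[OF 1(2,4)]] by simp
    then show "\<phi> (a \<oplus>\<^bsub>A\<^esub> b) = \<phi> a \<oplus>\<^bsub>J\<^esub> \<phi> b"
      using \<phi>[OF 1(1,2)] \<phi>[OF 1(3,4)] 1(5,6) J.smult_l_distr[OF 1(2,4) vc] by simp
  qed
  moreover have "\<forall>c\<in>carrier A. \<forall>a\<in>K. \<phi> (c \<otimes>\<^bsub>A\<^esub> a) = c \<odot>\<^bsub>J\<^esub> \<phi> a"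
  proof (intro ballI)
    fix r a assume r: "r \<in> carrier A" and "a \<in> K"
    then obtain q p where 1: "q \<in> ann 0" "p \<in> carrier A" "a = q \<oplus>\<^bsub>A\<^esub> p \<otimes>\<^bsub>A\<^esub> t"
      unfolding K_def by blast
    have "r \<otimes>\<^bsub>A\<^esub> a = r \<otimes>\<^bsub>A\<^esub> q \<oplus>\<^bsub>A\<^esub> (r \<otimes>\<^bsub>A\<^esub> p) \<otimes>\<^bsub>A\<^esub> t"
      using 1 r annA[of q] tA by (simp add: A.r_distr A.m_assoc del: A_sel)
    then have "\<phi> (r \<otimes>\<^bsub>A\<^esub> a) = (r \<otimes>\<^bsub>A\<^esub> p) \<odot>\<^bsub>J\<^esub> v l"
      using \<phi>[OF ann0.I_l_closed[OF 1(1) r] A.m_closed[OF r 1(2)]] by simp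
    then show "\<phi> (r \<otimes>\<^bsub>A\<^esub> a) = r \<odot>\<^bsub>J\<^esub> \<phi> a"
      using \<phi>[OF 1(1,2)] 1(3) J.smult_assoc1[OF r 1(2) vc] by simp
  qed
  \<comment> \<open>The shift is \<open>\<nu>\<close>, since \<open>t\<close> has degree
    \<open>l + k\<close> and is sent to \<open>v l\<close> of degree \<open>l + \<nu> + k\<close>.
    The representation of a homogeneous \<open>a\<close> is first replaced by its homogeneous part;
    below degree \<open>l + k\<close> that part lies in \<open>ann 0\<close>.\<close>
  moreover have "\<forall>i. \<forall>a\<in>K \<inter> AG i. \<phi> a \<in> JG (int i + \<nu>)"
  proof (intro allI ballI)
    fix i a assume a: "a \<in> K \<inter> AG i"
    then obtain q p where 1: "q \<in> ann 0" "p \<in> carrier A" "a = q \<oplus>\<^bsub>A\<^esub> p \<otimes>\<^bsub>A\<^esub> t"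
      unfolding K_def by blast
    have pc: "p \<in> carrier R" "q \<in> carrier R" "p \<otimes>\<^bsub>R\<^esub> t \<in> carrier R"
      using A_carrier[OF 1(2)] A_carrier[OF annA[OF 1(1)]] A_carrier[OF tA] by auto
    have aG: "a \<in> RG (0, i)" using a by simp
    have "a = rc a (0, i)" by (simp add: RG.grade_comp_hom_elt[OF aG])
    also have "\<dots> = rc q (0, i) \<oplus>\<^bsub>R\<^esub> rc (p \<otimes>\<^bsub>R\<^esub> t) (0, i)"
      unfolding 1(3) using RG.grade_comp_add[OF pc(2,3)] by simp
    finally have a': "a = rc q (0, i) \<oplus>\<^bsub>R\<^esub> rc (p \<otimes>\<^bsub>R\<^esub> t) (0, i)" .
    note qi = ann_comp[OF 1(1), of i]
    show "\<phi> a \<in> JG (int i + \<nu>)"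
    proof (cases "l + k \<le> i")
      case True
      have "rc (p \<otimes>\<^bsub>R\<^esub> t) (0, i) = rc p (0, i - (l + k)) \<otimes>\<^bsub>R\<^esub> t"
        using rc_mult(1)[OF tG pc(1), of "(0, i - (l + k))"] True by simp
      then have "\<phi> a = rc p (0, i - (l + k)) \<odot>\<^bsub>J\<^esub> v l"
        using \<phi>[OF qi rcA[OF 1(2)], of "i - (l + k)"] a' by simp
      moreover have "rc p (0, i - (l + k)) \<odot>\<^bsub>J\<^esub> v l \<in> JG (int (i - (l + k)) + (int l + (\<nu> + int k)))"
        by (rule smult_JG[OF rc_RG[OF pc(1)] v])
      moreover have "int (i - (l + k)) + (int l + (\<nu> + int k)) = int i + \<nu>" using True by simp
      ultimately show ?thesis by simp
    next
      case False
      have "rc (p \<otimes>\<^bsub>R\<^esub> t) (0, i) = \<zero>\<^bsub>R\<^esub>"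
        by (rule rc_mult(2)[OF tG pc(1)]) (use False in \<open>auto simp: prod_eq_iff\<close>)
      then have "a = rc q (0, i) \<oplus>\<^bsub>A\<^esub> \<zero>\<^bsub>A\<^esub> \<otimes>\<^bsub>A\<^esub> t"
        using a' A_carrier[OF tA] by simp
      then have "\<phi> a = \<zero>\<^bsub>J\<^esub>"
        using \<phi>[OF qi A.zero_closed] J.smult_l_null[OF vc] by simp
      then show ?thesis by simp
    qed
  qed
  ultimately obtain u' where u': "u' \<in> JG \<nu>" "\<And>a. a \<in> K \<Longrightarrow> \<phi> a = a \<odot>\<^bsub>J\<^esub> u'"
    using J K_hom unfolding graded_injective_def by blast
  have u'c: "u' \<in> carrier J" by (rule JG.H_carrier[OF u'(1)])
  have "a \<odot>\<^bsub>J\<^esub> u' = \<zero>\<^bsub>J\<^esub>" if "a \<in> carrier A" "a \<odot>\<^bsub>J\<^esub> u = \<zero>\<^bsub>J\<^esub>" for a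
  proof -
    have a: "a \<in> ann 0" using that v0 unfolding ann_def by simp
    have "\<phi> a = \<zero>\<^bsub>J\<^esub>"
      using \<phi>[OF a A.zero_closed] J.smult_l_null[OF vc] that(1) tA by (simp del: A_sel)
    then show ?thesis using u'(2) annK a by auto
  qed
  moreover have "(y [^]\<^bsub>A\<^esub> l) \<odot>\<^bsub>J\<^esub> (u \<ominus>\<^bsub>J\<^esub> (y [^]\<^bsub>A\<^esub> k) \<odot>\<^bsub>J\<^esub> u') = \<zero>\<^bsub>J\<^esub>"
  proof -
    \<comment> \<open>Writing \<open>t\<close> as zero plus one times \<open>t\<close> shows
      \<open>\<phi> t = v l\<close>; hence \<open>y^l\<close> takes \<open>y^k u'\<close> and
      \<open>u\<close> to the same element.\<close>
    have "t \<odot>\<^bsub>J\<^esub> u' = v l"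
      using \<phi>[OF ann0.zero_closed A.one_closed] u'(2)[OF tK] tA J.smult_one[OF vc] by (simp del: A_sel)
    moreover have "t \<odot>\<^bsub>J\<^esub> u' = (y [^]\<^bsub>A\<^esub> l) \<odot>\<^bsub>J\<^esub> ((y [^]\<^bsub>A\<^esub> k) \<odot>\<^bsub>J\<^esub> u')"
      unfolding t_def using J.smult_assoc1[OF powA powA u'c] A.nat_pow_mult[OF yA] by metis
    ultimately have "(y [^]\<^bsub>A\<^esub> l) \<odot>\<^bsub>J\<^esub> ((y [^]\<^bsub>A\<^esub> k) \<odot>\<^bsub>J\<^esub> u') = (y [^]\<^bsub>A\<^esub> l) \<odot>\<^bsub>J\<^esub> u"
      unfolding v_def by simp
    then show ?thesis
      using powA uc u'c J.M.r_neg
      by (simp add: J.M.minus_eq J.smult_r_distr J.smult_r_minus del: A_sel)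
  qed
  ultimately show ?thesis using u'(1) by blast
qed

end

section \<open>Torsion by powers of an ideal and by powers of its generators\<close>

lemma pow_mem_ideal_power:
  assumes "cring S" "ideal I S" "x \<in> I"
  shows "x [^]\<^bsub>S\<^esub> (k::nat) \<in> ideal_power S I k"
proof (induction k)
  interpret cring S by fact
  case 0
  then show ?case by simp
next
  interpret cring S by fact
  case (Suc k)
  have x: "x \<in> carrier S" using ideal.Icarr[OF assms(2,3)] .
  have "x \<otimes>\<^bsub>S\<^esub> x [^]\<^bsub>S\<^esub> k \<in> ideal_prod S I (ideal_power S I k)"
    using assms(3) Suc by (rule ideal_prod.prod)
  then show ?case using x by (simp add: m_comm)
qed

lemma ideal_power_ideal:
  assumes "cring S" "ideal I S"
  shows "ideal (ideal_power S I k) S"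
proof -
  interpret cring S by fact
  show ?thesis by (induction k) (auto intro: ideal_prod_is_ideal assms(2) oneideal)
qed

lemma ideal_power_antimono:
  assumes "cring S" "ideal I S" "k \<le> m"
  shows "ideal_power S I m \<subseteq> ideal_power S I k"
proof -
  interpret cring S by fact
  have "ideal_power S I (Suc k) \<subseteq> ideal_power S I k" for k
    using ideal_prod_inter[OF assms(2) ideal_power_ideal[OF assms(1,2)]] by auto
  then show ?thesis by (rule lift_Suc_antimono_le[OF _ assms(3)])
qed

text \<open>Induction on the sum of the exponents. Multiplying \<open>w\<close> by a generator
  lowers its exponent by 1, so every \<open>x w\<close> is killed by a power of \<open>I\<close>;
  one further factor of \<open>I\<close> then kills \<open>w\<close>.\<close>

lemma torsion_of_generator_torsion:
  assumes M: "Module.module S M" and I: "ideal I S" and xs: "finite Y" "Y \<subseteq> carrier S" "I \<subseteq> genideal S Y"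
    and w: "w \<in> carrier M" and e: "\<And>x. x \<in> Y \<Longrightarrow> (x [^]\<^bsub>S\<^esub> (e x :: nat)) \<odot>\<^bsub>M\<^esub> w = \<zero>\<^bsub>M\<^esub>"
  shows "\<exists>k. \<forall>a\<in>ideal_power S I k. a \<odot>\<^bsub>M\<^esub> w = \<zero>\<^bsub>M\<^esub>"
  using w e
proof (induction "sum e Y" arbitrary: e w rule: less_induct)
  interpret Module.module S M by fact
  interpret SS: Module.module S "regular_module S" by (rule regular_module) (rule R.is_cring)
  note S = R.is_cring
  case less
  note w = less.prems(1)
  show ?case
  proof (cases "\<exists>x\<in>Y. e x = 0")
    case True
    then have "w = \<zero>\<^bsub>M\<^esub>" using less.prems xs(2) by force
    then have "\<forall>a\<in>ideal_power S I 0. a \<odot>\<^bsub>M\<^esub> w = \<zero>\<^bsub>M\<^esub>" by simp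
    then show ?thesis by blast
  next
    case False
    have "\<exists>k. \<forall>a\<in>ideal_power S I k. a \<odot>\<^bsub>M\<^esub> (x \<odot>\<^bsub>M\<^esub> w) = \<zero>\<^bsub>M\<^esub>" if x: "x \<in> Y" for x
    proof (rule less.hyps)
      let ?e = "e(x := e x - 1)"
      have xS: "x \<in> carrier S" using x xs by blast
      show "x \<odot>\<^bsub>M\<^esub> w \<in> carrier M" using xS w by simp
      show "sum ?e Y < sum e Y"
        by (rule sum_strict_mono_ex1[OF xs(1)]) (use x False in \<open>auto intro!: bexI[of _ x]\<close>)
      fix z assume z: "z \<in> Y"
      then have zS: "z \<in> carrier S" using xs by blast
      show "(z [^]\<^bsub>S\<^esub> ?e z) \<odot>\<^bsub>M\<^esub> (x \<odot>\<^bsub>M\<^esub> w) = \<zero>\<^bsub>M\<^esub>"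
      proof (cases "z = x")
        case True
        have "x [^]\<^bsub>S\<^esub> (e x - 1) \<otimes>\<^bsub>S\<^esub> x = x [^]\<^bsub>S\<^esub> (Suc (e x - 1))" by simp
        also have "Suc (e x - 1) = e x" using False x by (cases "e x") auto
        finally show ?thesis
          using True less.prems(2)[OF x] smult_assoc1[OF _ xS w, of "x [^]\<^bsub>S\<^esub> (e x - 1)"] xS by simp
      next
        case False
        have "(z [^]\<^bsub>S\<^esub> e z) \<odot>\<^bsub>M\<^esub> (x \<odot>\<^bsub>M\<^esub> w) = x \<odot>\<^bsub>M\<^esub> ((z [^]\<^bsub>S\<^esub> e z) \<odot>\<^bsub>M\<^esub> w)"
          using smult_assoc1[OF _ xS w] smult_assoc1[OF xS _ w] R.m_comm[OF xS] zS by (metis R.nat_pow_closed)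
        then show ?thesis using False less.prems(2)[OF z] xS by simp
      qed
    qed
    then obtain k where k: "\<And>x a. x \<in> Y \<Longrightarrow> a \<in> ideal_power S I (k x) \<Longrightarrow> a \<odot>\<^bsub>M\<^esub> (x \<odot>\<^bsub>M\<^esub> w) = \<zero>\<^bsub>M\<^esub>"
      by metis
    define K where "K = Max (insert 0 (k ` Y))"
    have kK: "k x \<le> K" if "x \<in> Y" for x
      unfolding K_def using xs(1) that by simp
    let ?P = "ideal_power S I K"
    have PS: "j \<in> carrier S" if "j \<in> ?P" for j
      using ideal.Icarr[OF ideal_power_ideal[OF S I] that] .
    \<comment> \<open>The scalars \<open>r\<close> for which the \<open>K\<close>th power of
      \<open>I\<close> kills \<open>r w\<close> form an ideal. It contains the generators
      \<open>Y\<close>, hence \<open>I\<close>.\<close>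
    define Q where "Q = {r \<in> carrier S. \<forall>j\<in>?P. j \<odot>\<^bsub>M\<^esub> (r \<odot>\<^bsub>M\<^esub> w) = \<zero>\<^bsub>M\<^esub>}"
    have "submodule Q S (regular_module S)"
      unfolding SS.submodule_iff
    proof (intro conjI ballI)
      show "Q \<subseteq> carrier (regular_module S)" unfolding Q_def by auto
      show "\<zero>\<^bsub>regular_module S\<^esub> \<in> Q" unfolding Q_def using w PS by simp
      show "a \<oplus>\<^bsub>regular_module S\<^esub> b \<in> Q" if "a \<in> Q" "b \<in> Q" for a b
        using that w PS unfolding Q_def by (simp add: smult_l_distr smult_r_distr)
      show "r \<odot>\<^bsub>regular_module S\<^esub> a \<in> Q" if r: "r \<in> carrier S" and a: "a \<in> Q" for r a
      proof -
        have "j \<odot>\<^bsub>M\<^esub> ((r \<otimes>\<^bsub>S\<^esub> a) \<odot>\<^bsub>M\<^esub> w) = r \<odot>\<^bsub>M\<^esub> (j \<odot>\<^bsub>M\<^esub> (a \<odot>\<^bsub>M\<^esub> w))" if "j \<in> ?P" for j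
        proof -
          have c: "a \<in> carrier S" "a \<odot>\<^bsub>M\<^esub> w \<in> carrier M" using a w unfolding Q_def by auto
          have "j \<odot>\<^bsub>M\<^esub> (r \<odot>\<^bsub>M\<^esub> (a \<odot>\<^bsub>M\<^esub> w)) = r \<odot>\<^bsub>M\<^esub> (j \<odot>\<^bsub>M\<^esub> (a \<odot>\<^bsub>M\<^esub> w))"
            using smult_assoc1[OF PS[OF that] r c(2)] smult_assoc1[OF r PS[OF that] c(2)]
              R.m_comm[OF r PS[OF that]] by simp
          then show ?thesis using smult_assoc1[OF r c(1) w] by simp
        qed
        then show ?thesis using r a unfolding Q_def by simp
      qed
    qed
    then have "ideal Q S" using submodule_regular_iff[OF S] by blast
    moreover have "Y \<subseteq> Q"
      unfolding Q_def using k ideal_power_antimono[OF S I kK] xs(2) by blast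
    ultimately have IQ: "I \<subseteq> Q" using R.genideal_minimal xs(3) by blast
    have "a \<odot>\<^bsub>M\<^esub> w = \<zero>\<^bsub>M\<^esub>" if "a \<in> ideal_prod S I ?P" for a
    proof -
      have "a \<in> carrier S \<and> a \<odot>\<^bsub>M\<^esub> w = \<zero>\<^bsub>M\<^esub>"
        using that
      proof induction
        case (prod i j)
        then have i: "i \<in> carrier S" "j \<odot>\<^bsub>M\<^esub> (i \<odot>\<^bsub>M\<^esub> w) = \<zero>\<^bsub>M\<^esub>" using IQ unfolding Q_def by blast+
        have j: "j \<in> carrier S" by (rule PS[OF prod(2)])
        show ?case using i j smult_assoc1[OF j i(1) w] R.m_comm[OF i(1) j] by simp
      next
        case (sum a b)
        then show ?case using w by (simp add: smult_l_distr)
      qed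
      then show ?thesis ..
    qed
    then have "\<forall>a\<in>ideal_power S I (Suc K). a \<odot>\<^bsub>M\<^esub> w = \<zero>\<^bsub>M\<^esub>" by simp
    then show ?thesis by blast
  qed
qed

section \<open>The complex of a graded injective resolution\<close>

text \<open>All terms of the resolution in one module, so that its differential becomes a single
  endomorphism. The full product imposes no finiteness condition; the strands considered later are
  supported at one index.\<close>

definition prod_module :: "(nat \<Rightarrow> ('r, 'x) module) \<Rightarrow> ('r, nat \<Rightarrow> 'x) module" where
  "prod_module J = \<lparr>carrier = {f. \<forall>q. f q \<in> carrier (J q)},
     monoid.mult = (\<lambda>_ _ q. \<zero>\<^bsub>J q\<^esub>), one = (\<lambda>q. \<zero>\<^bsub>J q\<^esub>), ring.zero = (\<lambda>q. \<zero>\<^bsub>J q\<^esub>),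
     ring.add = (\<lambda>f g q. f q \<oplus>\<^bsub>J q\<^esub> g q), smult = (\<lambda>a f q. a \<odot>\<^bsub>J q\<^esub> f q)\<rparr>"

lemma prod_module_sel [simp]:
  "f \<in> carrier (prod_module J) \<longleftrightarrow> (\<forall>q. f q \<in> carrier (J q))"
  "\<zero>\<^bsub>prod_module J\<^esub> = (\<lambda>q. \<zero>\<^bsub>J q\<^esub>)"
  "f \<oplus>\<^bsub>prod_module J\<^esub> g = (\<lambda>q. f q \<oplus>\<^bsub>J q\<^esub> g q)"
  "a \<odot>\<^bsub>prod_module J\<^esub> f = (\<lambda>q. a \<odot>\<^bsub>J q\<^esub> f q)"
  by (simp_all add: prod_module_def)

lemma prod_module:
  assumes J: "\<And>q. Module.module S (J q)"
  shows "Module.module S (prod_module J)"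
proof -
  have S: "cring S" using J[of 0] by (simp add: module_def)
  note g = module.axioms(2)[OF J] and m = abelian_group.axioms(1)[OF module.axioms(2)[OF J]]
  have "abelian_group (prod_module J)"
  proof (rule abelian_groupI)
    fix f assume f: "f \<in> carrier (prod_module J)"
    show "\<exists>g\<in>carrier (prod_module J). g \<oplus>\<^bsub>prod_module J\<^esub> f = \<zero>\<^bsub>prod_module J\<^esub>"
      by (rule bexI[of _ "\<lambda>q. \<ominus>\<^bsub>J q\<^esub> f q"]) (use f g in \<open>auto intro: abelian_group.l_neg abelian_group.a_inv_closed\<close>)
  qed (auto intro!: ext intro: abelian_monoid.a_closed[OF m] abelian_monoid.zero_closed[OF m]
      abelian_monoid.a_assoc[OF m] abelian_monoid.a_comm[OF m] abelian_monoid.l_zero[OF m])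
  then show ?thesis
    by (intro moduleI S)
      (auto intro!: ext intro: module.smult_closed[OF J] module.smult_l_distr[OF J]
        module.smult_r_distr[OF J] module.smult_assoc1[OF J] module.smult_one[OF J])
qed

lemma prod_module_neg:
  assumes J: "\<And>q. Module.module S (J q)" and f: "f \<in> carrier (prod_module J)"
  shows "\<ominus>\<^bsub>prod_module J\<^esub> f = (\<lambda>q. \<ominus>\<^bsub>J q\<^esub> f q)"
proof -
  interpret P: Module.module S "prod_module J" by (rule prod_module) (rule J)
  note g = module.axioms(2)[OF J]
  show ?thesis
    by (rule P.minus_equality)
      (use f g in \<open>auto intro: abelian_group.l_neg abelian_group.a_inv_closed\<close>)
qed

lemma trivial_group_Mod_self:
  assumes "group G"
  shows "trivial_group (G Mod carrier G)"
proof -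
  interpret group G by fact
  have n: "carrier G \<lhd> G"
    unfolding normal_inv_iff using subgroup_self by auto
  have "rcosets\<^bsub>G\<^esub> carrier G = {carrier G}"
    unfolding RCOSETS_def using coset_join2[OF _ subgroup_self] one_closed by auto
  then show ?thesis
    unfolding trivial_group_def using normal.factorgroup_is_group[OF n] by (simp add: FactGroup_def)
qed

section \<open>Homogeneous parts of the resolution and its augmentation\<close>

locale injective_resolution = bigraded_module R RG L LG
  for R :: "'r ring" and RG :: "(nat ^ 't) \<times> nat \<Rightarrow> 'r set"
    and L :: "('r, 'm) module" and LG :: "(nat ^ 't) \<times> nat \<Rightarrow> 'm set" +
  fixes n :: "nat ^ 't" and C :: "('r, 'x) graded_cochain"
  assumes res: "graded_injective_resolution A AG (row_module L LG n) (int_grading L (row_grading LG n)) C"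
begin

abbreviation "J \<equiv> cc_obj C"
abbreviation "JG \<equiv> cc_comp C"
abbreviation "d \<equiv> cc_diff C"

lemma J_injective: "graded_injective A AG (J q) (JG q)"
  using res by (simp add: graded_injective_resolution_def)

lemma J_graded: "graded_module A (int_grading A AG) (J q) (JG q)"
  using J_injective by (simp add: graded_injective_def)

lemma J_module: "Module.module A (J q)"
  using J_graded by (simp add: graded_module_def)

lemma J_grading: "grading (J q) (JG q)"
  using J_graded[of q] module.axioms(2)[OF J_module[of q]]
  by (simp add: grading_def grading_axioms_def graded_module_def)

lemma d_hom: "graded_hom A (J q) (JG q) (J (Suc q)) (JG (Suc q)) (d q)"
  using res by (simp add: graded_injective_resolution_def)

lemma d_closed: "x \<in> carrier (J q) \<Longrightarrow> d q x \<in> carrier (J (Suc q))"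
  using d_hom[of q] unfolding graded_hom_def by blast

lemma d_add: "x \<in> carrier (J q) \<Longrightarrow> y \<in> carrier (J q) \<Longrightarrow> d q (x \<oplus>\<^bsub>J q\<^esub> y) = d q x \<oplus>\<^bsub>J (Suc q)\<^esub> d q y"
  using d_hom[of q] unfolding graded_hom_def by blast

lemma d_smult: "a \<in> carrier A \<Longrightarrow> x \<in> carrier (J q) \<Longrightarrow> d q (a \<odot>\<^bsub>J q\<^esub> x) = a \<odot>\<^bsub>J (Suc q)\<^esub> d q x"
  using d_hom[of q] unfolding graded_hom_def by blast

lemma d_JG: "x \<in> JG q \<mu> \<Longrightarrow> d q x \<in> JG (Suc q) \<mu>"
  using d_hom[of q] unfolding graded_hom_def by blast

lemma d_zero: "d q \<zero>\<^bsub>J q\<^esub> = \<zero>\<^bsub>J (Suc q)\<^esub>"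
proof -
  interpret J: Module.module A "J q" by (rule J_module)
  interpret J': Module.module A "J (Suc q)" by (rule J_module)
  have "d q (\<zero>\<^bsub>A\<^esub> \<odot>\<^bsub>J q\<^esub> \<zero>\<^bsub>J q\<^esub>) = \<zero>\<^bsub>A\<^esub> \<odot>\<^bsub>J (Suc q)\<^esub> d q \<zero>\<^bsub>J q\<^esub>"
    by (rule d_smult[OF A.zero_closed J.zero_closed])
  then show ?thesis
    using J.smult_l_null[OF J.zero_closed] J'.smult_l_null[OF d_closed[OF J.zero_closed]] by simp
qed

lemma d_kernel: "d q ` carrier (J q) = {x \<in> carrier (J (Suc q)). d (Suc q) x = \<zero>\<^bsub>J (Suc (Suc q))\<^esub>}"
  using res by (simp add: graded_injective_resolution_def)

lemma d_d: "x \<in> carrier (J q) \<Longrightarrow> d (Suc q) (d q x) = \<zero>\<^bsub>J (Suc (Suc q))\<^esub>"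
  using d_kernel[of q] by blast

lemma smult_JG: "a \<in> RG (0, i) \<Longrightarrow> x \<in> JG q j \<Longrightarrow> a \<odot>\<^bsub>J q\<^esub> x \<in> JG q (int i + j)"
proof -
  assume a: "a \<in> RG (0, i)" and x: "x \<in> JG q j"
  have "a \<in> int_grading A AG (int i)" using a by (simp add: int_grading_def)
  then show ?thesis using J_graded[of q] x unfolding graded_module_def by blast
qed

lemma JG_carrier: "x \<in> JG q \<mu> \<Longrightarrow> x \<in> carrier (J q)"
  by (rule grading.H_carrier[OF J_grading])

lemma JG_zero [simp]: "\<zero>\<^bsub>J q\<^esub> \<in> JG q \<mu>"
  by (rule grading.H_zero[OF J_grading])

lemma J_zero [simp]: "\<zero>\<^bsub>J q\<^esub> \<in> carrier (J q)"
  using JG_carrier JG_zero by blast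

text \<open>Exactness provides a preimage without regard to degrees; the differential has degree 0,
  so the component of degree \<open>\<mu>\<close> is a preimage too.\<close>

lemma d_exact_homogeneous:
  assumes x: "x \<in> JG (Suc q) \<mu>" "d (Suc q) x = \<zero>\<^bsub>J (Suc (Suc q))\<^esub>"
  obtains w where "w \<in> JG q \<mu>" "d q w = x"
proof -
  have "x \<in> d q ` carrier (J q)"
    unfolding d_kernel using x JG_carrier[OF x(1)] by simp
  then obtain w where w: "w \<in> carrier (J q)" "d q w = x" by blast
  interpret J: grading "J q" "JG q" by (rule J_grading)
  interpret J': grading "J (Suc q)" "JG (Suc q)" by (rule J_grading)
  have "grade_comp (J (Suc q)) (JG (Suc q)) (d q w) ((\<lambda>i. i) \<mu>) = d q (grade_comp (J q) (JG q) w \<mu>)"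
    by (rule grade_comp_image(1)[OF J_grading J_grading, where I = UNIV])
      (use w d_add d_JG d_zero J.partial_sum_UNIV in auto)
  then have "d q (grade_comp (J q) (JG q) w \<mu>) = x"
    using J'.grade_comp_hom_elt[OF x(1)] w(2) by simp
  then show thesis using that[OF J.grade_comp_props(1)[OF w(1)]] by blast
qed

definition eps :: "'m \<Rightarrow> 'x" where
  "eps = (SOME \<epsilon>. graded_hom A (row_module L LG n) (int_grading L (row_grading LG n)) (J 0) (JG 0) \<epsilon> \<and>
     inj_on \<epsilon> (carrier (row_module L LG n)) \<and>
     \<epsilon> ` carrier (row_module L LG n) = {x \<in> carrier (J 0). d 0 x = \<zero>\<^bsub>J 1\<^esub>})"

lemma eps:
  "graded_hom A (row_module L LG n) (int_grading L (row_grading LG n)) (J 0) (JG 0) eps"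
  "inj_on eps (carrier (row_module L LG n))"
  "eps ` carrier (row_module L LG n) = {x \<in> carrier (J 0). d 0 x = \<zero>\<^bsub>J (Suc 0)\<^esub>}"
proof -
  have "\<exists>\<epsilon>. graded_hom A (row_module L LG n) (int_grading L (row_grading LG n)) (J 0) (JG 0) \<epsilon> \<and>
     inj_on \<epsilon> (carrier (row_module L LG n)) \<and>
     \<epsilon> ` carrier (row_module L LG n) = {x \<in> carrier (J 0). d 0 x = \<zero>\<^bsub>J 1\<^esub>}"
    using res by (simp add: graded_injective_resolution_def)
  from someI_ex[OF this, folded eps_def]
  show "graded_hom A (row_module L LG n) (int_grading L (row_grading LG n)) (J 0) (JG 0) eps"
    "inj_on eps (carrier (row_module L LG n))"
    "eps ` carrier (row_module L LG n) = {x \<in> carrier (J 0). d 0 x = \<zero>\<^bsub>J (Suc 0)\<^esub>}"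
    by simp_all
qed

lemma row_sel: "carrier (row_module L LG n) = partial_sum L LG ({n} \<times> UNIV)"
    "ring.add (row_module L LG n) = ring.add L" "smult (row_module L LG n) = smult L"
  by (simp_all add: row_module_def graded_row_def)

lemma eps_add: "x \<in> partial_sum L LG ({n} \<times> UNIV) \<Longrightarrow> y \<in> partial_sum L LG ({n} \<times> UNIV) \<Longrightarrow>
    eps (x \<oplus>\<^bsub>L\<^esub> y) = eps x \<oplus>\<^bsub>J 0\<^esub> eps y"
  using eps(1) unfolding graded_hom_def row_sel by blast

lemma eps_smult: "a \<in> carrier A \<Longrightarrow> x \<in> partial_sum L LG ({n} \<times> UNIV) \<Longrightarrow>
    eps (a \<odot>\<^bsub>L\<^esub> x) = a \<odot>\<^bsub>J 0\<^esub> eps x"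
  using eps(1) unfolding graded_hom_def row_sel by blast

lemma eps_carrier: "x \<in> partial_sum L LG ({n} \<times> UNIV) \<Longrightarrow> eps x \<in> carrier (J 0)"
  using eps(3) unfolding row_sel by blast

lemma d_eps: "x \<in> partial_sum L LG ({n} \<times> UNIV) \<Longrightarrow> d 0 (eps x) = \<zero>\<^bsub>J (Suc 0)\<^esub>"
  using eps(3) unfolding row_sel by blast

lemma eps_zero: "eps \<zero>\<^bsub>L\<^esub> = \<zero>\<^bsub>J 0\<^esub>"
proof -
  interpret J: Module.module A "J 0" by (rule J_module)
  have z: "\<zero>\<^bsub>L\<^esub> \<in> partial_sum L LG ({n} \<times> UNIV)" by (rule LG.partial_sum_zero)
  have "\<zero>\<^bsub>R\<^esub> \<odot>\<^bsub>L\<^esub> \<zero>\<^bsub>L\<^esub> = \<zero>\<^bsub>L\<^esub>" by simp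
  then show ?thesis
    using eps_smult[OF A.zero_closed z] J.smult_l_null[OF eps_carrier[OF z]] by simp
qed

lemma eps_JG: "x \<in> row_strand n 0 \<mu> \<Longrightarrow> eps x \<in> JG 0 \<mu>"
proof -
  assume x: "x \<in> row_strand n 0 \<mu>"
  have "eps ` int_grading L (row_grading LG n) \<mu> \<subseteq> JG 0 \<mu>"
    using eps(1) unfolding graded_hom_def by blast
  then show ?thesis using x unfolding row_strand_def by auto
qed

lemma row_strand_partial_sum: "x \<in> row_strand n i \<mu> \<Longrightarrow> x \<in> partial_sum L LG ({n} \<times> UNIV)"
  using row_strand_row[of n] unfolding row_sel by blast

text \<open>As for the differential, a component of an arbitrary preimage does it. In a negative
  degree the row has no component, so \<open>z\<close> must be zero.\<close>

lemma eps_surj: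
  assumes z: "z \<in> JG 0 \<mu>" "d 0 z = \<zero>\<^bsub>J (Suc 0)\<^esub>"
  obtains l where "l \<in> row_strand n 0 \<mu>" "eps l = z"
proof -
  have "z \<in> eps ` partial_sum L LG ({n} \<times> UNIV)"
    unfolding eps(3)[unfolded row_sel] using z JG_carrier[OF z(1)] by simp
  then obtain l where l: "l \<in> partial_sum L LG ({n} \<times> UNIV)" "eps l = z" by blast
  interpret J0: grading "J 0" "JG 0" by (rule J_grading)
  have zc: "grade_comp (J 0) (JG 0) z \<mu> = z"
    using J0.grade_comp_hom_elt[OF z(1)] by simp
  have epsG: "eps x \<in> JG 0 (int (snd g))" if "g \<in> {n} \<times> UNIV" "x \<in> LG g" for g x
    by (rule eps_JG, rule row_strandI) (use that in auto)
  have inj: "inj_on (\<lambda>g. int (snd g)) ({n} \<times> UNIV)" by (auto simp: inj_on_def)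
  note * = grade_comp_image[where f = eps and s = "\<lambda>g. int (snd g)" and I = "{n} \<times> UNIV",
      OF LG.grading_axioms J_grading _ epsG eps_zero inj l(1)]
  show thesis
  proof (cases "0 \<le> \<mu>")
    case True
    have "grade_comp (J 0) (JG 0) (eps l) (int (snd (n, nat \<mu>))) = eps (grade_comp L LG l (n, nat \<mu>))"
      by (rule *(1)) (use eps_add in auto)
    then have "eps (grade_comp L LG l (n, nat \<mu>)) = z" using True l(2) zc by simp
    moreover have "grade_comp L LG l (n, nat \<mu>) \<in> row_strand n 0 \<mu>"
      using LG.grade_comp_props(1)[OF LG.partial_sum_carrier[OF l(1)]] True by (intro row_strandI) auto
    ultimately show thesis using that by blast
  next
    case False
    have "grade_comp (J 0) (JG 0) (eps l) \<mu> = \<zero>\<^bsub>J 0\<^esub>"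
      by (rule *(2)) (use eps_add False in auto)
    then have "eps \<zero>\<^bsub>L\<^esub> = z" using zc l(2) eps_zero by simp
    then show thesis using that row_strand_zero by blast
  qed
qed

section \<open>The resolution as one module with differential\<close>

definition tot_diff :: "(nat \<Rightarrow> 'x) \<Rightarrow> nat \<Rightarrow> 'x" where
  "tot_diff f q = (case q of 0 \<Rightarrow> \<zero>\<^bsub>J 0\<^esub> | Suc p \<Rightarrow> d p (f p))"

text \<open>Families supported at the single index \<open>i\<close>. Cohomological degrees are
  integers so that cones may pass to \<open>i - 1\<close>; strands of negative degree contain only
  zero.\<close>

definition inj_strand :: "int \<Rightarrow> int \<Rightarrow> (nat \<Rightarrow> 'x) set" where
  "inj_strand i \<mu> = {f. \<forall>q. f q \<in> (if int q = i then JG q \<mu> else {\<zero>\<^bsub>J q\<^esub>})}"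

definition single :: "nat \<Rightarrow> 'x \<Rightarrow> nat \<Rightarrow> 'x" where
  "single q x = (\<lambda>p. if p = q then x else \<zero>\<^bsub>J p\<^esub>)"

abbreviation "P \<equiv> prod_module J"

lemma P_module: "Module.module A P"
  by (rule prod_module) (rule J_module)

sublocale P: Module.module A P by (rule P_module)

lemma tot_diff_module: "diff_module A P tot_diff"
proof (rule diff_moduleI[OF P_module])
  show "tot_diff f \<in> carrier P" if "f \<in> carrier P" for f
    using that d_closed by (auto simp: tot_diff_def split: nat.split)
  show "tot_diff (f \<oplus>\<^bsub>P\<^esub> g) = tot_diff f \<oplus>\<^bsub>P\<^esub> tot_diff g" if "f \<in> carrier P" "g \<in> carrier P" for f g
  proof
    fix q
    have "\<zero>\<^bsub>J 0\<^esub> \<oplus>\<^bsub>J 0\<^esub> \<zero>\<^bsub>J 0\<^esub> = \<zero>\<^bsub>J 0\<^esub>"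
      using abelian_monoid.l_zero[OF abelian_group.axioms(1)[OF module.axioms(2)[OF J_module]]] by simp
    then show "tot_diff (f \<oplus>\<^bsub>P\<^esub> g) q = (tot_diff f \<oplus>\<^bsub>P\<^esub> tot_diff g) q"
      using that d_add by (auto simp: tot_diff_def split: nat.split)
  qed
  show "tot_diff (r \<odot>\<^bsub>P\<^esub> f) = r \<odot>\<^bsub>P\<^esub> tot_diff f" if "r \<in> carrier A" "f \<in> carrier P" for r f
  proof
    fix q
    have "r \<odot>\<^bsub>J 0\<^esub> \<zero>\<^bsub>J 0\<^esub> = \<zero>\<^bsub>J 0\<^esub>"
      by (rule module.smult_r_null[OF J_module that(1)])
    then show "tot_diff (r \<odot>\<^bsub>P\<^esub> f) q = (r \<odot>\<^bsub>P\<^esub> tot_diff f) q"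
      using that d_smult by (auto simp: tot_diff_def split: nat.split)
  qed
  show "tot_diff (tot_diff f) = \<zero>\<^bsub>P\<^esub>" if "f \<in> carrier P" for f
  proof
    show "tot_diff (tot_diff f) q = \<zero>\<^bsub>P\<^esub> q" for q
      using that d_d d_zero by (auto simp: tot_diff_def split: nat.split)
  qed
qed

lemma inj_strandD:
  assumes "f \<in> inj_strand i \<mu>"
  shows "int q = i \<Longrightarrow> f q \<in> JG q \<mu>" and "int q \<noteq> i \<Longrightarrow> f q = \<zero>\<^bsub>J q\<^esub>" and "f q \<in> carrier (J q)"
proof -
  have *: "f q \<in> (if int q = i then JG q \<mu> else {\<zero>\<^bsub>J q\<^esub>})"
    using assms unfolding inj_strand_def by blast
  then show "int q = i \<Longrightarrow> f q \<in> JG q \<mu>" and "int q \<noteq> i \<Longrightarrow> f q = \<zero>\<^bsub>J q\<^esub>" by simp_all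
  from * show "f q \<in> carrier (J q)" using JG_carrier J_zero by (auto split: if_splits)
qed

lemma inj_strandI:
  assumes "\<And>q. int q = i \<Longrightarrow> f q \<in> JG q \<mu>" "\<And>q. int q \<noteq> i \<Longrightarrow> f q = \<zero>\<^bsub>J q\<^esub>"
  shows "f \<in> inj_strand i \<mu>"
  unfolding inj_strand_def using assms by auto

lemma single_strand: "x \<in> JG q \<mu> \<Longrightarrow> single q x \<in> inj_strand (int q) \<mu>"
  by (rule inj_strandI) (auto simp: single_def)

lemma strand_single: "f \<in> inj_strand (int q) \<mu> \<Longrightarrow> f = single q (f q)"
  by (rule ext) (auto simp: single_def inj_strandD(2))

lemma strand_neg: "f \<in> inj_strand i \<mu> \<Longrightarrow> i < 0 \<Longrightarrow> f = \<zero>\<^bsub>P\<^esub>"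
  by (rule ext) (auto simp: inj_strandD(2))

lemma single_zero: "single q \<zero>\<^bsub>J q\<^esub> = \<zero>\<^bsub>P\<^esub>"
  by (auto simp: single_def)

lemma single_carrier: "x \<in> carrier (J q) \<Longrightarrow> single q x \<in> carrier P"
  by (simp add: single_def)

lemma tot_diff_single:
  assumes "x \<in> carrier (J q)"
  shows "tot_diff (single q x) = single (Suc q) (d q x)"
  by (rule ext) (auto simp: tot_diff_def single_def d_zero split: nat.split)

lemma smult_single: "a \<in> carrier A \<Longrightarrow> a \<odot>\<^bsub>P\<^esub> single q x = single q (a \<odot>\<^bsub>J q\<^esub> x)"
  using module.smult_r_null[OF J_module] by (auto simp: single_def)

lemma single_add: "single q (x \<oplus>\<^bsub>J q\<^esub> y) = single q x \<oplus>\<^bsub>P\<^esub> single q y"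
  using abelian_monoid.l_zero[OF abelian_group.axioms(1)[OF module.axioms(2)[OF J_module]] J_zero]
  by (auto simp: single_def)

lemma single_neg: "x \<in> carrier (J q) \<Longrightarrow> single q (\<ominus>\<^bsub>J q\<^esub> x) = \<ominus>\<^bsub>P\<^esub> single q x"
  using abelian_group.neg_zero[OF module.axioms(2)[OF J_module]]
  by (subst prod_module_neg[of A J, OF J_module single_carrier]) (auto simp: single_def)

lemma single_minus: "y \<in> carrier (J q) \<Longrightarrow> single q (x \<ominus>\<^bsub>J q\<^esub> y) = single q x \<ominus>\<^bsub>P\<^esub> single q y"
  unfolding a_minus_def by (simp only: single_add single_neg)

lemma single_eq_zero: "single q x = \<zero>\<^bsub>P\<^esub> \<longleftrightarrow> x = \<zero>\<^bsub>J q\<^esub>"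
  by (auto simp: single_def fun_eq_iff)

lemma zero_strand: "\<zero>\<^bsub>P\<^esub> \<in> inj_strand i \<mu>"
  by (rule inj_strandI) auto

lemma inj_strand_family:
  assumes Y: "Y \<subseteq> RG (0, 1)"
  shows "strand_family A P tot_diff Y inj_strand"
  unfolding strand_family_def
proof (intro conjI allI ballI)
  show "Y \<subseteq> carrier A" using Y AG_carrier by blast
  fix i \<mu>
  show "inj_strand i \<mu> \<subseteq> carrier P" using inj_strandD(3) by auto
  show "\<zero>\<^bsub>P\<^esub> \<in> inj_strand i \<mu>" by (rule zero_strand)
  fix f assume f: "f \<in> inj_strand i \<mu>"
  have fP: "f \<in> carrier P" using inj_strandD(3)[OF f] by simp
  show "\<ominus>\<^bsub>P\<^esub> f \<in> inj_strand i \<mu>"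
    unfolding prod_module_neg[of A J f, OF J_module fP]
  proof (rule inj_strandI)
    show "\<ominus>\<^bsub>J q\<^esub> f q \<in> JG q \<mu>" if "int q = i" for q
      by (rule grading.H_neg[OF J_grading inj_strandD(1)[OF f that]])
    show "\<ominus>\<^bsub>J q\<^esub> f q = \<zero>\<^bsub>J q\<^esub>" if "int q \<noteq> i" for q
      using inj_strandD(2)[OF f that] abelian_group.neg_zero[OF module.axioms(2)[OF J_module]] by simp
  qed
  show "f \<oplus>\<^bsub>P\<^esub> g \<in> inj_strand i \<mu>" if g: "g \<in> inj_strand i \<mu>" for g
  proof (rule inj_strandI)
    show "(f \<oplus>\<^bsub>P\<^esub> g) q \<in> JG q \<mu>" if "int q = i" for q
      using grading.H_add[OF J_grading inj_strandD(1)[OF f that] inj_strandD(1)[OF g that]] by simp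
    show "(f \<oplus>\<^bsub>P\<^esub> g) q = \<zero>\<^bsub>J q\<^esub>" if "int q \<noteq> i" for q
      using inj_strandD(2)[OF f that] inj_strandD(2)[OF g that]
        abelian_monoid.l_zero[OF abelian_group.axioms(1)[OF module.axioms(2)[OF J_module]] J_zero] by simp
  qed
  show "tot_diff f \<in> inj_strand (i + 1) \<mu>"
  proof (rule inj_strandI)
    show "tot_diff f q \<in> JG q \<mu>" if "int q = i + 1" for q
      using that inj_strandD(1)[OF f] d_JG by (cases q) (auto simp: tot_diff_def)
    show "tot_diff f q = \<zero>\<^bsub>J q\<^esub>" if "int q \<noteq> i + 1" for q
      using that inj_strandD(2)[OF f] d_zero by (cases q) (auto simp: tot_diff_def)
  qed
  show "y \<odot>\<^bsub>P\<^esub> f \<in> inj_strand i (\<mu> + 1)" if y: "y \<in> Y" for y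
  proof (rule inj_strandI)
    have yG: "y \<in> RG (0, 1)" using y Y by blast
    show "(y \<odot>\<^bsub>P\<^esub> f) q \<in> JG q (\<mu> + 1)" if "int q = i" for q
      using smult_JG[OF yG inj_strandD(1)[OF f that]] by (simp add: add.commute)
    show "(y \<odot>\<^bsub>P\<^esub> f) q = \<zero>\<^bsub>J q\<^esub>" if "int q \<noteq> i" for q
      using inj_strandD(2)[OF f that] module.smult_r_null[OF J_module AG_carrier[OF yG]] by simp
  qed
qed

text \<open>The row, embedded in the first injective module and placed in cohomological degree 0. In
  all other degrees it is zero, because \<open>row_strand\<close> is.\<close>

definition eps_strand :: "int \<Rightarrow> int \<Rightarrow> (nat \<Rightarrow> 'x) set" where
  "eps_strand i \<mu> = (\<lambda>l. single 0 (eps l)) ` row_strand n i \<mu>"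

lemma eps_strand_pos: "i \<noteq> 0 \<Longrightarrow> eps_strand i \<mu> = {\<zero>\<^bsub>P\<^esub>}"
  unfolding eps_strand_def row_strand_def by (simp add: eps_zero single_zero)

lemma tot_diff_eps: "x \<in> row_strand n i \<mu> \<Longrightarrow> tot_diff (single 0 (eps x)) = \<zero>\<^bsub>P\<^esub>"
  using tot_diff_single[OF eps_carrier] d_eps single_zero row_strand_partial_sum by simp

lemma eps_neg:
  assumes "x \<in> partial_sum L LG ({n} \<times> UNIV)"
  shows "eps (\<ominus>\<^bsub>L\<^esub> x) = \<ominus>\<^bsub>J 0\<^esub> eps x"
proof -
  interpret J0: Module.module A "J 0" by (rule J_module)
  note nx = LG.partial_sum_neg[OF assms]
  have "eps (\<ominus>\<^bsub>L\<^esub> x) \<oplus>\<^bsub>J 0\<^esub> eps x = \<zero>\<^bsub>J 0\<^esub>"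
    using eps_add[OF nx assms] LG.partial_sum_carrier[OF assms] by (simp add: L.M.l_neg eps_zero)
  then show ?thesis
    using J0.M.minus_equality eps_carrier[OF nx] eps_carrier[OF assms] by metis
qed

lemma eps_strand_family:
  assumes Y: "Y \<subseteq> RG (0, 1)"
  shows "strand_family A P tot_diff Y eps_strand"
proof -
  note V = strand_familyD[OF row_strand_family[OF Y, of n]]
  note pj = row_strand_partial_sum
  show ?thesis
    unfolding strand_family_def
  proof (intro conjI allI ballI)
    show "Y \<subseteq> carrier A" using Y AG_carrier by blast
    fix i \<mu>
    show "eps_strand i \<mu> \<subseteq> carrier P"
      unfolding eps_strand_def using single_carrier eps_carrier pj by blast
    have z: "\<zero>\<^bsub>P\<^esub> \<in> eps_strand i \<mu>" for i \<mu>
      unfolding eps_strand_def using V(3) eps_zero single_zero by (metis imageI)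
    then show "\<zero>\<^bsub>P\<^esub> \<in> eps_strand i \<mu>" .
    fix f assume "f \<in> eps_strand i \<mu>"
    then obtain l where l: "l \<in> row_strand n i \<mu>" "f = single 0 (eps l)"
      unfolding eps_strand_def by blast
    show "\<ominus>\<^bsub>P\<^esub> f \<in> eps_strand i \<mu>"
      unfolding l(2) single_neg[OF eps_carrier[OF pj[OF l(1)]], symmetric] eps_neg[OF pj[OF l(1)], symmetric] eps_strand_def
      using V(5)[OF l(1)] by blast
    show "tot_diff f \<in> eps_strand (i + 1) \<mu>"
      unfolding l(2) tot_diff_eps[OF l(1)] by (rule z)
    show "f \<oplus>\<^bsub>P\<^esub> g \<in> eps_strand i \<mu>" if g: "g \<in> eps_strand i \<mu>" for g
    proof -
      obtain m where m: "m \<in> row_strand n i \<mu>" "g = single 0 (eps m)"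
        using g unfolding eps_strand_def by blast
      show ?thesis
        unfolding l(2) m(2) single_add[symmetric] eps_add[OF pj[OF l(1)] pj[OF m(1)], symmetric] eps_strand_def
        using V(4)[OF l(1) m(1)] by blast
    qed
    show "y \<odot>\<^bsub>P\<^esub> f \<in> eps_strand i (\<mu> + 1)" if y: "y \<in> Y" for y
    proof -
      have yA: "y \<in> carrier A" using y Y AG_carrier by blast
      show ?thesis
        unfolding l(2) smult_single[OF yA] eps_smult[OF yA pj[OF l(1)], symmetric] eps_strand_def
        using V(7)[OF y l(1)] by blast
    qed
  qed
qed

text \<open>This is the exactness of the resolution, degree by degree. Surjectivity on cohomology is
  \<open>eps_surj\<close> in degree 0 and \<open>d_exact_homogeneous\<close> above. For injectivity,
  a coboundary in \<open>eps_strand\<close> is zero: below degree 0 there is nothing to map, and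
  elsewhere \<open>eps_strand\<close> is trivial.\<close>

lemma eps_quasi_iso: "quasi_iso_sub P tot_diff eps_strand inj_strand"
  unfolding quasi_iso_sub_def
proof (intro allI conjI ballI impI)
  have z: "\<zero>\<^bsub>P\<^esub> \<in> eps_strand i \<mu>" for i \<mu>
    unfolding eps_strand_def using row_strand_zero eps_zero single_zero by (metis imageI)
  interpret D: diff_module A P tot_diff by (rule tot_diff_module)
  fix i \<mu>
  show "eps_strand i \<mu> \<subseteq> inj_strand i \<mu>"
  proof (cases "i = 0")
    case True
    then show ?thesis
      unfolding eps_strand_def using single_strand[OF eps_JG] by auto
  next
    case False
    then show ?thesis using eps_strand_pos zero_strand by simp
  qed
  {
    fix f assume f: "f \<in> inj_strand i \<mu>" and Df: "tot_diff f = \<zero>\<^bsub>P\<^esub>"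
    have fP: "f \<in> carrier P" using inj_strandD(3)[OF f] by simp
    consider "i < 0" | "i = 0" | q where "i = int (Suc q)"
    proof (cases i rule: linorder_cases[of _ 0])
      case greater
      then have "i = int (Suc (nat i - 1))" by simp
      then show ?thesis using that by blast
    qed (use that in blast)+
    then show "\<exists>e\<in>eps_strand i \<mu>. \<exists>w\<in>inj_strand (i - 1) \<mu>. tot_diff e = \<zero>\<^bsub>P\<^esub> \<and> f = e \<oplus>\<^bsub>P\<^esub> tot_diff w"
    proof cases
      case 1
      have "f = \<zero>\<^bsub>P\<^esub> \<oplus>\<^bsub>P\<^esub> tot_diff \<zero>\<^bsub>P\<^esub>"
        using strand_neg[OF f 1] P.M.l_zero[OF P.M.zero_closed] D.D_zero by metis
      then show ?thesis using z zero_strand D.D_zero by blast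
    next
      case 2
      have f0: "f 0 \<in> JG 0 \<mu>" using inj_strandD(1)[OF f, of 0] 2 by simp
      have "tot_diff f (Suc 0) = \<zero>\<^bsub>J (Suc 0)\<^esub>" using Df by simp
      then have "d 0 (f 0) = \<zero>\<^bsub>J (Suc 0)\<^esub>" by (simp add: tot_diff_def)
      then obtain l where l: "l \<in> row_strand n 0 \<mu>" "eps l = f 0" using eps_surj[OF f0] by blast
      have "f = single 0 (eps l)" using strand_single[of f 0 \<mu>] f 2 l(2) by simp
      then have "f \<in> eps_strand i \<mu>" unfolding eps_strand_def using l(1) 2 by blast
      moreover have "f = f \<oplus>\<^bsub>P\<^esub> tot_diff \<zero>\<^bsub>P\<^esub>" unfolding D.D_zero using P.M.r_zero[OF fP] by simp
      ultimately show ?thesis using Df zero_strand by blast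
    next
      case 3
      have fq: "f (Suc q) \<in> JG (Suc q) \<mu>" using inj_strandD(1)[OF f] 3 by simp
      have "tot_diff f (Suc (Suc q)) = \<zero>\<^bsub>J (Suc (Suc q))\<^esub>" using Df by simp
      then have "d (Suc q) (f (Suc q)) = \<zero>\<^bsub>J (Suc (Suc q))\<^esub>" by (simp add: tot_diff_def)
      then obtain w where w: "w \<in> JG q \<mu>" "d q w = f (Suc q)"
        using d_exact_homogeneous[OF fq] by blast
      have "f = single (Suc q) (d q w)" using strand_single[of f "Suc q" \<mu>] f w(2) unfolding 3 by simp
      then have "f = tot_diff (single q w)" using tot_diff_single[OF JG_carrier[OF w(1)]] by simp
      then have "f = \<zero>\<^bsub>P\<^esub> \<oplus>\<^bsub>P\<^esub> tot_diff (single q w)" using P.M.l_zero[OF fP] by simp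
      moreover have "single q w \<in> inj_strand (i - 1) \<mu>" using single_strand[OF w(1)] 3 by simp
      ultimately show ?thesis using z D.D_zero by blast
    qed
  }
  fix w assume w: "w \<in> inj_strand (i - 1) \<mu>" and Dw: "tot_diff w \<in> eps_strand i \<mu>"
  have "tot_diff w = \<zero>\<^bsub>P\<^esub>"
  proof (cases "i = 0")
    case True
    then have "w = \<zero>\<^bsub>P\<^esub>" using strand_neg[OF w] by simp
    then show ?thesis using D.D_zero by metis
  next
    case False
    then show ?thesis using Dw eps_strand_pos by blast
  qed
  then have "tot_diff \<zero>\<^bsub>P\<^esub> = tot_diff w" using D.D_zero by metis
  then show "\<exists>v\<in>eps_strand (i - 1) \<mu>. tot_diff v = tot_diff w" using z by blast
qed

text \<open>The element found by Baer's criterion is killed by everything that kills the given one,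
  so it inherits torsion with respect to each member of \<open>zs\<close>. Divisibility therefore
  survives the earlier exchanges.\<close>

lemma inj_strand_divisible:
  assumes y: "y \<in> RG (0, 1)" and zs: "set zs \<subseteq> carrier A"
  shows "divisible_mod_torsion A P y (tor_list A P zs inj_strand)"
  unfolding divisible_mod_torsion_def
proof (intro allI ballI)
  have yA: "y \<in> carrier A" using AG_carrier y by blast
  interpret D: diff_module A P tot_diff by (rule tot_diff_module)
  fix i \<mu> and k :: nat and f assume "f \<in> tor_list A P zs inj_strand i (\<mu> + int k)"
  then have f: "f \<in> inj_strand i (\<mu> + int k)"
    and ft: "\<And>z. z \<in> set zs \<Longrightarrow> \<exists>m::nat. (z [^]\<^bsub>A\<^esub> m) \<odot>\<^bsub>P\<^esub> f = \<zero>\<^bsub>P\<^esub>"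
    unfolding tor_list_iff by auto
  show "\<exists>u'\<in>tor_list A P zs inj_strand i \<mu>. \<exists>l::nat. (y [^]\<^bsub>A\<^esub> l) \<odot>\<^bsub>P\<^esub>
      (f \<ominus>\<^bsub>P\<^esub> (y [^]\<^bsub>A\<^esub> k) \<odot>\<^bsub>P\<^esub> u') = \<zero>\<^bsub>P\<^esub>"
  proof (cases "i < 0")
    case True
    have f0: "f = \<zero>\<^bsub>P\<^esub>" by (rule strand_neg[OF f True])
    have "(z [^]\<^bsub>A\<^esub> (0::nat)) \<odot>\<^bsub>P\<^esub> f = \<zero>\<^bsub>P\<^esub>" for z
      unfolding f0 A.nat_pow_0 by (rule P.smult_r_null[OF A.one_closed])
    then have "\<zero>\<^bsub>P\<^esub> \<in> tor_list A P zs inj_strand i \<mu>"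
      unfolding tor_list_iff f0 using zero_strand by blast
    moreover have "(y [^]\<^bsub>A\<^esub> (0::nat)) \<odot>\<^bsub>P\<^esub> (f \<ominus>\<^bsub>P\<^esub> (y [^]\<^bsub>A\<^esub> k) \<odot>\<^bsub>P\<^esub> \<zero>\<^bsub>P\<^esub>) = \<zero>\<^bsub>P\<^esub>"
      unfolding f0 P.smult_r_null[OF A.nat_pow_closed[OF yA]] P.M.minus_self[OF P.M.zero_closed]
      by (rule refl)
    ultimately show ?thesis by blast
  next
    case False
    then obtain q where q: "i = int q" using nonneg_int_cases by (metis not_less)
    interpret J: Module.module A "J q" by (rule J_module)
    have u: "f q \<in> JG q (\<mu> + int k)" using inj_strandD(1)[OF f] q by simp
    obtain u' and l :: nat where u': "u' \<in> JG q \<mu>"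
      "\<And>a. a \<in> carrier A \<Longrightarrow> a \<odot>\<^bsub>J q\<^esub> f q = \<zero>\<^bsub>J q\<^esub> \<Longrightarrow> a \<odot>\<^bsub>J q\<^esub> u' = \<zero>\<^bsub>J q\<^esub>"
      "(y [^]\<^bsub>A\<^esub> l) \<odot>\<^bsub>J q\<^esub> (f q \<ominus>\<^bsub>J q\<^esub> (y [^]\<^bsub>A\<^esub> k) \<odot>\<^bsub>J q\<^esub> u') = \<zero>\<^bsub>J q\<^esub>"
      using graded_injective_divisible[OF J_injective y u] by blast
    have fs: "f = single q (f q)" using strand_single f q by simp
    note c = JG_carrier[OF u] JG_carrier[OF u'(1)]
    have powA: "z [^]\<^bsub>A\<^esub> (m::nat) \<in> carrier A" if "z \<in> carrier A" for z m
      using that by (rule A.nat_pow_closed)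
    have "\<exists>m::nat. (z [^]\<^bsub>A\<^esub> m) \<odot>\<^bsub>P\<^esub> single q u' = \<zero>\<^bsub>P\<^esub>" if z: "z \<in> set zs" for z
    proof -
      have zA: "z \<in> carrier A" using z zs by blast
      obtain m :: nat where "(z [^]\<^bsub>A\<^esub> m) \<odot>\<^bsub>P\<^esub> f = \<zero>\<^bsub>P\<^esub>" using ft[OF z] by blast
      then have "(z [^]\<^bsub>A\<^esub> m) \<odot>\<^bsub>J q\<^esub> f q = \<zero>\<^bsub>J q\<^esub>" by (simp add: fun_eq_iff)
      then have "(z [^]\<^bsub>A\<^esub> m) \<odot>\<^bsub>J q\<^esub> u' = \<zero>\<^bsub>J q\<^esub>" by (rule u'(2)[OF powA[OF zA]])
      then have "(z [^]\<^bsub>A\<^esub> m) \<odot>\<^bsub>P\<^esub> single q u' = \<zero>\<^bsub>P\<^esub>"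
        unfolding smult_single[OF powA[OF zA]] single_eq_zero .
      then show ?thesis by blast
    qed
    then have "single q u' \<in> tor_list A P zs inj_strand i \<mu>"
      unfolding tor_list_iff q using single_strand[OF u'(1)] by blast
    moreover have "(y [^]\<^bsub>A\<^esub> l) \<odot>\<^bsub>P\<^esub> (f \<ominus>\<^bsub>P\<^esub> (y [^]\<^bsub>A\<^esub> k) \<odot>\<^bsub>P\<^esub> single q u') = \<zero>\<^bsub>P\<^esub>"
    proof -
      have ku: "(y [^]\<^bsub>A\<^esub> k) \<odot>\<^bsub>J q\<^esub> u' \<in> carrier (J q)" by (rule J.smult_closed[OF powA[OF yA] c(2)])
      have "f \<ominus>\<^bsub>P\<^esub> (y [^]\<^bsub>A\<^esub> k) \<odot>\<^bsub>P\<^esub> single q u' = single q (f q \<ominus>\<^bsub>J q\<^esub> (y [^]\<^bsub>A\<^esub> k) \<odot>\<^bsub>J q\<^esub> u')"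
        unfolding single_minus[OF ku] smult_single[OF powA[OF yA]] fs[symmetric] ..
      then show ?thesis
        using smult_single[OF powA[OF yA]] u'(3) single_zero by simp
    qed
    ultimately show ?thesis by blast
  qed
qed

lemma kos_exact_eps_strand:
  assumes xs: "set xs \<subseteq> RG (0, 1)"
    and ex: "exact_at (kos_module L xs) (kos_diff L (\<lambda>_. \<zero>\<^bsub>L\<^esub>) xs) (kos_strand (row_strand n) xs) i \<mu>"
  shows "exact_at (kos_module P xs) (kos_diff P tot_diff xs) (kos_strand eps_strand xs) i \<mu>"
proof -
  note pj = row_strand_partial_sum
  have "exact_at (kos_module P xs) (kos_diff P tot_diff xs)
      (kos_strand (\<lambda>i \<mu>. (\<lambda>l. single 0 (eps l)) ` row_strand n i \<mu>) xs) i \<mu>"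
  proof (rule exact_at_kos_image[OF L_module P_module row_strand_family[OF xs] order_refl _ _ _ _ _ _ ex])
    show "single 0 (eps x) \<in> carrier P" if "x \<in> row_strand n i \<mu>" for i \<mu> x
      by (rule single_carrier[OF eps_carrier[OF pj[OF that]]])
    show "single 0 (eps (x \<ominus>\<^bsub>L\<^esub> y)) = single 0 (eps x) \<ominus>\<^bsub>P\<^esub> single 0 (eps y)"
      if "x \<in> row_strand n i \<mu>" "y \<in> row_strand n i \<mu>" for i \<mu> x y
    proof -
      have "eps (x \<ominus>\<^bsub>L\<^esub> y) = eps x \<ominus>\<^bsub>J 0\<^esub> eps y"
        unfolding a_minus_def
          eps_add[OF pj[OF that(1)] LG.partial_sum_neg[OF pj[OF that(2)]]] eps_neg[OF pj[OF that(2)]] ..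
      then show ?thesis using single_minus[OF eps_carrier[OF pj[OF that(2)]]] by simp
    qed
    show "single 0 (eps (y \<odot>\<^bsub>L\<^esub> x)) = y \<odot>\<^bsub>P\<^esub> single 0 (eps x)"
      if "y \<in> set xs" "x \<in> row_strand n i \<mu>" for i \<mu> x y
    proof -
      have "y \<in> carrier A" using that(1) xs AG_carrier by blast
      then show ?thesis using eps_smult[OF _ pj[OF that(2)]] smult_single by metis
    qed
    show "single 0 (eps \<zero>\<^bsub>L\<^esub>) = \<zero>\<^bsub>P\<^esub>"
      unfolding eps_zero by (rule single_zero)
    show "x = \<zero>\<^bsub>L\<^esub>" if "x \<in> row_strand n i \<mu>" "single 0 (eps x) = \<zero>\<^bsub>P\<^esub>" for i \<mu> x
    proof (rule inj_onD[OF eps(2)[unfolded row_sel] _ pj[OF that(1)] LG.partial_sum_zero])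
      show "eps x = eps \<zero>\<^bsub>L\<^esub>" using that(2) unfolding single_eq_zero eps_zero .
    qed
    show "tot_diff (single 0 (eps x)) = \<zero>\<^bsub>P\<^esub>" if "x \<in> row_strand n i \<mu>" for i \<mu> x
      by (rule tot_diff_eps[OF that])
  qed
  then show ?thesis unfolding eps_strand_def .
qed

text \<open>A Koszul complex on \<open>length xs\<close> elements, with coefficients in degree 0,
  has no entries in higher cohomological degrees.\<close>

lemma kos_exact_eps_strand_trivial:
  assumes xs: "set xs \<subseteq> RG (0, 1)" and i: "i > int (length xs)"
  shows "exact_at (kos_module P xs) (kos_diff P tot_diff xs) (kos_strand eps_strand xs) i \<mu>"
  unfolding exact_at_def
proof (intro ballI impI)
  have xsA: "set xs \<subseteq> carrier A" using xs AG_carrier by blast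
  interpret K: diff_module A "kos_module P xs" "kos_diff P tot_diff xs"
    by (rule kos_diff_module[OF tot_diff_module xsA])
  fix z assume "z \<in> kos_strand eps_strand xs i \<mu>"
  moreover have "kos_strand eps_strand xs i \<mu> \<subseteq> {\<zero>\<^bsub>kos_module P xs\<^esub>}"
    by (rule kos_strand_trivial[OF _ i]) (simp add: eps_strand_pos)
  ultimately have z: "z = \<zero>\<^bsub>kos_module P xs\<^esub>" by blast
  have "\<zero>\<^bsub>kos_module P xs\<^esub> \<in> kos_strand eps_strand xs (i - 1) \<mu>"
    by (rule strand_familyD(3)[OF kos_strand_family[OF tot_diff_module eps_strand_family[OF xs] order_refl]])
  then show "\<exists>w\<in>kos_strand eps_strand xs (i - 1) \<mu>. kos_diff P tot_diff xs w = z"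
    unfolding z using K.D_zero by blast
qed

section \<open>Vanishing of local cohomology and the resulting bound\<close>

lemma irrelevant_ideal: "ideal (irrelevant_ideal A AG) A"
  unfolding irrelevant_ideal_def by (rule A.genideal_ideal) (use AG_carrier in auto)

text \<open>Exactness travels from the Koszul complex of the row to that of the resolution along the
  quasi-isomorphism, then by exchange of cones to the torsion subcomplex, whose strand in degree
  \<open>\<mu>\<close> computes local cohomology.\<close>

lemma local_cohomology_vanishes:
  assumes xs: "set xs \<subseteq> RG (0, 1)" "\<And>i. i > 0 \<Longrightarrow> RG (0, i) \<subseteq> genideal A (set xs)"
    and ex: "\<And>\<mu>. \<mu> \<ge> \<mu>0 \<Longrightarrow> exact_at (kos_module P xs) (kos_diff P tot_diff xs) (kos_strand eps_strand xs) (int i) \<mu>"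
    and \<mu>: "\<mu> \<ge> \<mu>0"
  shows "trivial_group (local_cohomology_comp A (irrelevant_ideal A AG) C i \<mu>)"
proof -
  let ?I = "irrelevant_ideal A AG"
  have xsA: "set xs \<subseteq> carrier A" using xs(1) AG_carrier by blast
  note fam = inj_strand_family[OF xs(1)] and efam = eps_strand_family[OF xs(1)]
  have gen_sub: "(\<Union>i\<in>{0<..}. AG i) \<subseteq> carrier A" using AG_carrier by auto
  have I_sub: "?I \<subseteq> genideal A (set xs)"
    unfolding irrelevant_ideal_def
    by (rule A.genideal_minimal[OF A.genideal_ideal[OF xsA]]) (use xs(2) in auto)
  have xI: "x \<in> ?I" if "x \<in> set xs" for x
  proof -
    have "x \<in> (\<Union>i\<in>{0<..}. AG i)" using xs(1) that by (auto intro!: bexI[of _ 1])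
    then show ?thesis unfolding irrelevant_ideal_def using A.genideal_self[OF gen_sub] by blast
  qed
  have exJ: "exact_at (kos_module P xs) (kos_diff P tot_diff xs) (kos_strand inj_strand xs) (int i) \<mu>"
    if "\<mu> \<ge> \<mu>0" for \<mu>
    by (rule quasi_iso_sub_exact_at[OF kos_diff_module[OF tot_diff_module xsA]
          kos_strand_family[OF tot_diff_module fam order_refl]
          kos_quasi_iso_sub[OF tot_diff_module fam efam eps_quasi_iso order_refl] ex[OF that]])
  have dv: "divisible_mod_torsion A P y (tor_list A P zs inj_strand)" if "y \<in> set xs" "set zs \<subseteq> set xs" for y zs
    by (rule inj_strand_divisible) (use that xs(1) xsA in auto)
  have ex0: "exact_at P tot_diff (tor_list A P (rev xs @ []) inj_strand) (int i) \<mu>"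
    by (rule exact_at_tor_list[OF tot_diff_module fam dv order_refl _ _ \<mu>]) (use exJ in simp_all)
  define Z where "Z = {z \<in> torsion_strand A ?I C i \<mu>. d i z = \<zero>\<^bsub>J (Suc i)\<^esub>}"
  define B where "B = (case i of 0 \<Rightarrow> {\<zero>\<^bsub>J 0\<^esub>} | Suc j \<Rightarrow> d j ` torsion_strand A ?I C j \<mu>)"
  interpret J: Module.module A "J i" by (rule J_module)
  interpret JGi: grading "J i" "JG i" by (rule J_grading)
  have Ipow: "a \<in> carrier A" if "a \<in> ideal_power A ?I k" for a k
    using ideal.Icarr[OF ideal_power_ideal[OF A_cring irrelevant_ideal] that] .
  have tor: "x \<in> torsion_strand A ?I C q \<mu> \<longleftrightarrow>
      x \<in> JG q \<mu> \<and> (\<forall>z\<in>set xs. \<exists>k::nat. (z [^]\<^bsub>A\<^esub> k) \<odot>\<^bsub>J q\<^esub> x = \<zero>\<^bsub>J q\<^esub>)" for x q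
  proof
    assume "x \<in> torsion_strand A ?I C q \<mu>"
    then obtain k where "x \<in> JG q \<mu>" "\<forall>a\<in>ideal_power A ?I k. a \<odot>\<^bsub>J q\<^esub> x = \<zero>\<^bsub>J q\<^esub>"
      unfolding torsion_strand_def torsion_part_def by blast
    then show "x \<in> JG q \<mu> \<and> (\<forall>z\<in>set xs. \<exists>k::nat. (z [^]\<^bsub>A\<^esub> k) \<odot>\<^bsub>J q\<^esub> x = \<zero>\<^bsub>J q\<^esub>)"
      using pow_mem_ideal_power[OF A_cring irrelevant_ideal xI] by blast
  next
    assume x: "x \<in> JG q \<mu> \<and> (\<forall>z\<in>set xs. \<exists>k::nat. (z [^]\<^bsub>A\<^esub> k) \<odot>\<^bsub>J q\<^esub> x = \<zero>\<^bsub>J q\<^esub>)"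
    then obtain e :: "'r \<Rightarrow> nat" where e: "\<And>z. z \<in> set xs \<Longrightarrow> (z [^]\<^bsub>A\<^esub> e z) \<odot>\<^bsub>J q\<^esub> x = \<zero>\<^bsub>J q\<^esub>"
      by metis
    have "\<exists>k. \<forall>a\<in>ideal_power A ?I k. a \<odot>\<^bsub>J q\<^esub> x = \<zero>\<^bsub>J q\<^esub>"
      by (rule torsion_of_generator_torsion[OF J_module irrelevant_ideal _ xsA I_sub _ e])
        (use x JG_carrier in auto)
    then show "x \<in> torsion_strand A ?I C q \<mu>"
      unfolding torsion_strand_def torsion_part_def using x JG_carrier by blast
  qed
  \<comment> \<open>Elements supported at one index identify the torsion strands of the product
    module with those of the single terms.\<close>
  have ts: "single q x \<in> tor_list A P (rev xs @ []) inj_strand (int q) \<mu> \<longleftrightarrow> x \<in> torsion_strand A ?I C q \<mu>" for q x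
  proof -
    have "single q x \<in> inj_strand (int q) \<mu> \<longleftrightarrow> x \<in> JG q \<mu>"
      using single_strand inj_strandD(1)[of "single q x" "int q" \<mu> q] by (auto simp: single_def)
    moreover have "(z [^]\<^bsub>A\<^esub> (k::nat)) \<odot>\<^bsub>P\<^esub> single q x = \<zero>\<^bsub>P\<^esub> \<longleftrightarrow> (z [^]\<^bsub>A\<^esub> k) \<odot>\<^bsub>J q\<^esub> x = \<zero>\<^bsub>J q\<^esub>"
      if "z \<in> set xs" for z k
      using that xsA smult_single[OF A.nat_pow_closed] single_eq_zero by (metis subsetD)
    ultimately show ?thesis unfolding tor_list_iff tor by simp
  qed
  have ZB: "Z = B"
  proof
    show "Z \<subseteq> B"
    proof
      fix z assume z: "z \<in> Z"
      then have z1: "single i z \<in> tor_list A P (rev xs @ []) inj_strand (int i) \<mu>"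
        and zc: "z \<in> carrier (J i)" and dz: "d i z = \<zero>\<^bsub>J (Suc i)\<^esub>"
        unfolding Z_def ts using JG_carrier by (auto simp: tor)
      have "tot_diff (single i z) = \<zero>\<^bsub>P\<^esub>"
        unfolding tot_diff_single[OF zc] dz by (rule single_zero)
      then obtain w where w: "w \<in> tor_list A P (rev xs @ []) inj_strand (int i - 1) \<mu>" "tot_diff w = single i z"
        using ex0 z1 unfolding exact_at_def by blast
      have "tot_diff w i = z" using w(2) by (simp add: single_def)
      then show "z \<in> B"
      proof (cases i)
        case 0
        then show ?thesis using \<open>tot_diff w i = z\<close> unfolding B_def tot_diff_def by simp
      next
        case (Suc j)
        then have w': "w \<in> tor_list A P (rev xs @ []) inj_strand (int j) \<mu>" using w(1) by simp
        then have "w = single j (w j)" unfolding tor_list_iff using strand_single by blast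
        then have "w j \<in> torsion_strand A ?I C j \<mu>" using w' ts by metis
        moreover have "d j (w j) = z" using \<open>tot_diff w i = z\<close> unfolding Suc tot_diff_def by simp
        ultimately show ?thesis unfolding B_def Suc by auto
      qed
    qed
    \<comment> \<open>The quotient is formed without asking that the boundaries be cycles. The
      equality of both sets presents it as a group modulo itself.\<close>
    show "B \<subseteq> Z"
    proof (cases i)
      case 0
      have "\<zero>\<^bsub>J 0\<^esub> \<in> Z"
        unfolding Z_def 0 using d_zero module.smult_r_null[OF J_module] A.nat_pow_closed xsA by (auto simp: tor)
      then show ?thesis unfolding B_def 0 by simp
    next
      case (Suc j)
      have "d j w \<in> Z" if w: "w \<in> torsion_strand A ?I C j \<mu>" for w
      proof -
        have wj: "w \<in> JG j \<mu>" using w tor by blast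
        have "\<exists>k::nat. (z [^]\<^bsub>A\<^esub> k) \<odot>\<^bsub>J (Suc j)\<^esub> d j w = \<zero>\<^bsub>J (Suc j)\<^esub>" if z: "z \<in> set xs" for z
        proof -
          obtain k :: nat where k: "(z [^]\<^bsub>A\<^esub> k) \<odot>\<^bsub>J j\<^esub> w = \<zero>\<^bsub>J j\<^esub>" using w z tor by blast
          have "(z [^]\<^bsub>A\<^esub> k) \<odot>\<^bsub>J (Suc j)\<^esub> d j w = d j ((z [^]\<^bsub>A\<^esub> k) \<odot>\<^bsub>J j\<^esub> w)"
            by (rule d_smult[symmetric]) (use z xsA JG_carrier[OF wj] A.nat_pow_closed in blast)+
          then show ?thesis using k d_zero by auto
        qed
        then show ?thesis
          unfolding Z_def Suc using tor d_JG[OF wj] d_d[OF JG_carrier[OF wj]] by blast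
      qed
      then show ?thesis unfolding B_def Suc by auto
    qed
  qed
  have Zc: "Z \<subseteq> carrier (J i)" unfolding Z_def using tor JG_carrier by blast
  have "subgroup Z (add_monoid (J i))"
  proof (rule J.M.add.subgroupI)
    show "Z \<subseteq> carrier (J i)" by (rule Zc)
    have fam_i: "strand_family A P tot_diff (set xs) (tor_list A P (rev xs @ []) inj_strand)"
      by (rule tor_list_family[OF tot_diff_module fam]) (use xsA in simp)
    note F = strand_familyD[OF fam_i]
    have ZF: "z \<in> Z \<longleftrightarrow> z \<in> carrier (J i) \<and> single i z \<in> tor_list A P (rev xs @ []) inj_strand (int i) \<mu> \<and> d i z = \<zero>\<^bsub>J (Suc i)\<^esub>" for z
      unfolding ts Z_def using tor JG_carrier by blast
    have "single i \<zero>\<^bsub>J i\<^esub> \<in> tor_list A P (rev xs @ []) inj_strand (int i) \<mu>"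
      unfolding single_zero by (rule F(3))
    then show "Z \<noteq> {}" using ZF d_zero J_zero by blast
    show "a \<oplus>\<^bsub>J i\<^esub> b \<in> Z" if "a \<in> Z" "b \<in> Z" for a b
      using that F(4)[of "single i a" "int i" \<mu> "single i b"] d_add
        abelian_monoid.l_zero[OF abelian_group.axioms(1)[OF module.axioms(2)[OF J_module]] J_zero]
      unfolding ZF single_add by auto
    show "\<ominus>\<^bsub>J i\<^esub> a \<in> Z" if a: "a \<in> Z" for a
    proof -
      have ac: "a \<in> carrier (J i)" "d i a = \<zero>\<^bsub>J (Suc i)\<^esub>" using a ZF by blast+
      have "(\<ominus>\<^bsub>A\<^esub> \<one>\<^bsub>A\<^esub>) \<odot>\<^bsub>J i\<^esub> a = \<ominus>\<^bsub>J i\<^esub> a"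
        using J.smult_l_minus[OF A.one_closed ac(1)] J.smult_one[OF ac(1)] by simp
      then have "d i (\<ominus>\<^bsub>J i\<^esub> a) = \<zero>\<^bsub>J (Suc i)\<^esub>"
        using d_smult[OF A.a_inv_closed[OF A.one_closed] ac(1)] ac(2)
          module.smult_r_null[OF J_module A.a_inv_closed[OF A.one_closed]] by simp
      moreover have "\<ominus>\<^bsub>J i\<^esub> a \<in> carrier (J i)" using ac by simp
      moreover have "single i (\<ominus>\<^bsub>J i\<^esub> a) \<in> tor_list A P (rev xs @ []) inj_strand (int i) \<mu>"
        unfolding single_neg[OF ac(1)] using F(5) a ZF by blast
      ultimately show ?thesis unfolding ZF by blast
    qed
  qed
  then have "group ((add_monoid (J i))\<lparr>carrier := Z\<rparr>)"
    using subgroup.subgroup_is_group J.M.add.is_group by blast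
  from trivial_group_Mod_self[OF this] show ?thesis
    unfolding local_cohomology_comp_def Z_def[symmetric] B_def[symmetric] ZB[symmetric] by simp
qed

end

text \<open>The witnesses are \<open>k = b\<close> and \<open>k' = k0 + length xs\<close>. Both are
  fixed before the row and its resolution are chosen.\<close>

lemma (in bigraded_module) regularity_linear_bound:
  "\<exists>k k' :: int. \<forall>(n :: nat ^ 't) (C :: ('r, 'x) graded_cochain).
     graded_injective_resolution A AG (row_module L LG n) (int_grading L (row_grading LG n)) C \<longrightarrow>
     cm_regularity A AG C \<le> ereal (of_int ((\<Sum>j\<in>UNIV. int (n $ j)) * k + k'))"
proof -
  obtain xs b where xs: "set xs \<subseteq> RG (0, 1)" "\<And>i. i > 0 \<Longrightarrow> RG (0, i) \<subseteq> genideal A (set xs)"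
    and b: "\<And>r m c. r \<in> carrier R \<Longrightarrow> b * total_degree m < c \<Longrightarrow> rc r (m, c) \<in> genideal R (set xs)"
    using exists_generators by metis
  obtain k0 where k0: "\<And>n i \<mu>. \<mu> > int (b * total_degree n) + k0 \<Longrightarrow>
      exact_at (kos_module L xs) (kos_diff L (\<lambda>_. \<zero>\<^bsub>L\<^esub>) xs) (kos_strand (row_strand n) xs) i \<mu>"
    using koszul_exact_large_degree[OF xs(1) b] by blast
  have "cm_regularity A AG C \<le> ereal (of_int ((\<Sum>j\<in>UNIV. int (n $ j)) * int b + (k0 + int (length xs))))"
    if C: "graded_injective_resolution A AG (row_module L LG n) (int_grading L (row_grading LG n)) C"
    for n and C :: "('r, 'x) graded_cochain"
  proof -
    interpret injective_resolution R RG L LG n C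
      by unfold_locales (rule C)
    let ?H = "local_cohomology_comp A (irrelevant_ideal A AG) C"
    let ?N = "int (b * total_degree n) + k0"
    have N: "(\<Sum>j\<in>UNIV. int (n $ j)) * int b + (k0 + int (length xs)) = ?N + int (length xs)"
      by (simp add: total_degree_def)
    \<comment> \<open>The bound on the internal degree is the same for every \<open>i\<close>.
      Exactness beyond \<open>?N\<close> is a half-line condition, so the starting degree can be
      taken to be \<open>\<mu>\<close> itself.\<close>
    have large: "trivial_group (?H i \<mu>)" if "\<mu> > ?N" for i \<mu>
      by (rule local_cohomology_vanishes[OF xs kos_exact_eps_strand[OF xs(1) k0] order_refl]) (use that in auto)
    have high: "trivial_group (?H i \<mu>)" if "i > length xs" for i \<mu>
      by (rule local_cohomology_vanishes[OF xs kos_exact_eps_strand_trivial[OF xs(1)] order_refl])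
        (use that in auto)
    have "a_invariant A AG C i + ereal (of_nat i) \<le> ereal (of_int (?N + int (length xs)))" for i
    proof (cases "i > length xs")
      case True
      \<comment> \<open>Beyond \<open>length xs\<close> no degree contributes, so the supremum is
        that of the empty set and stays below any bound after \<open>i\<close> is added.\<close>
      then have "a_invariant A AG C i = - \<infinity>"
        unfolding a_invariant_def using high by (simp add: bot_ereal_def)
      then show ?thesis by simp
    next
      case False
      have "a_invariant A AG C i \<le> ereal (of_int ?N)"
        unfolding a_invariant_def
      proof (rule Sup_least)
        fix x assume "x \<in> {ereal (of_int \<mu>) | \<mu>. \<not> trivial_group (?H i \<mu>)}"
        then obtain \<mu> where \<mu>: "x = ereal (of_int \<mu>)" "\<not> trivial_group (?H i \<mu>)" by blast
        then have "\<mu> \<le> ?N" using large[of \<mu> i] by linarith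
        then show "x \<le> ereal (of_int ?N)" unfolding \<mu>(1) ereal_less_eq(3) of_int_le_iff .
      qed
      then have "a_invariant A AG C i + ereal (of_nat i) \<le> ereal (of_int ?N) + ereal (of_nat i)"
        by (rule add_right_mono)
      also have "\<dots> \<le> ereal (of_int (?N + int (length xs)))"
        using False by simp
      finally show ?thesis .
    qed
    then show ?thesis
      unfolding cm_regularity_def N by (intro SUP_least)
  qed
  then show ?thesis by blast
qed

theorem theorem5p3p3:
  fixes R :: "'r ring"
    and RG :: "(nat ^ 't) \<times> nat \<Rightarrow> 'r set"
    and L :: "('r, 'm) module"
    and LG :: "(nat ^ 't) \<times> nat \<Rightarrow> 'm set"
  defines "A \<equiv> row_ring R RG"
    and "AG \<equiv> row_grading RG 0"
  assumes "noetherian_ring R"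
    and "graded_ring R RG"
    and "graded_module R RG L LG"
    and "fin_gen_module R L"
    and "generate_ring R (graded_row R RG 0 \<union> (\<Union>j. graded_row R RG (axis j 1))) = carrier R"
    and "generate_ring A (AG 0 \<union> AG 1) = carrier A"
    and "artinian_ring (A\<lparr>carrier := AG 0\<rparr>)"
    and "local_ring (A\<lparr>carrier := AG 0\<rparr>)"
  shows "\<exists>k k' :: int. \<forall>(n :: nat ^ 't) (C :: ('r, 'x) graded_cochain).
           graded_injective_resolution A AG
             (row_module L LG n) (int_grading L (row_grading LG n)) C \<longrightarrow>
           cm_regularity A AG C \<le> ereal (of_int ((\<Sum>j\<in>UNIV. int (n $ j)) * k + k'))"
proof -
  have "bigraded_module R RG L LG"
    using assms(3-8) unfolding A_def AG_def
    by (intro bigraded_module.intro bigraded_module_axioms.intro standard_bigraded_ring.intro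
        standard_bigraded_ring_axioms.intro bigraded_ring.intro)
  then interpret bigraded_module R RG L LG .
  show ?thesis
    unfolding A_def AG_def by (rule regularity_linear_bound)
qed

end
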